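(* Let $\Omega\subseteq\mathbb{R}^d$ be convex with non-empty interior (not necessarily compact), and let $P$ be the joint law on $\mathcal{W}_2(\Omega)\times\mathcal{W}_2(\Omega)$ of a random pair $(\mu,\nu)$ generated by the regression model $\nu=T_\epsilon\#(T_0\#\mu)$, where: (i) every measure $\mu$ in the support of the marginal law $P_M$ of $\mu$ is absolutely continuous with respect to Lebesgue measure; (ii) $T_0\in\mathcal{T}$ is a fixed map; (iii) $T_\epsilon$ is a random element of $\mathcal{T}$, independent of $\mu$, with $\mathbb{E}(T_\epsilon)=\mathrm{id}$. For $T\in\mathcal{T}$ define $$M(T):=\frac12\int_{\mathcal{W}_2(\Omega)\times\mathcal{W}_2(\Omega)} d^2_{\mathcal{W}}(T\#\mu,\nu)\,\mathrm{d}P(\mu,\nu).$$ Then the regression operator $\Gamma(\mu)=T_0\#\mu$ is identifiable over the class of maps $T\in\mathcal{T}$, up to $Q$-null sets; specifically, for any $T\in\mathcal{T}$ with $\|T-T_0\|_{L^2(Q)}>0$ it holds that $$M(T)>M(T_0).$$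
   Context: $\mathcal{W}_2(\Omega)$ is the set of Borel probability measures on $\Omega$ with finite second moment, with the 2-Wasserstein distance $d_{\mathcal{W}}$, $d^2_{\mathcal{W}}(\nu,\mu)=\inf_\gamma\int\|x-y\|^2\,\mathrm{d}\gamma(x,y)$, the infimum being over couplings $\gamma$ of $\nu$ and $\mu$. $T\#\mu$ is the push-forward, $T\#\mu(B)=\mu(T^{-1}(B))$. A constant $L>0$ is fixed and known throughout. For $0\le\alpha<L$, $\Phi_\alpha$ is the set of twice differentiable $\varphi:\mathbb{R}^d\to\mathbb{R}$ with $\alpha I\preceq\nabla^2\varphi(x)\preceq LI$ for all $x\in\mathbb{R}^d$, and $\Phi:=\bigcup_{\alpha>0}\Phi_\alpha$. Here $A\preceq B$ means that $B-A$ is positive semi-definite. Then $$\mathcal{T}:=\{T:\Omega\to\Omega \;:\; T=\nabla\varphi\text{ for some }\varphi\in\Phi\}.$$ $Q$ is the linear average (Bochner mean) of $P_M$: $Q(A)=\int_{\mathcal{W}_2(\Omega)}\mu(A)\,\mathrm{d}P_M(\mu)$ for Borel $A$. $\mathbb{E}(T_\epsilon)$ denotes the Bochner mean of the random map $T_\epsilon$, and $\mathrm{id}$ is the identity map.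
   Formalization: The formal theorem additionally assumes M(T_0) < ∞; without it the claim fails (e.g. T_ε(x) = x + Z with E Z = 0 and E Z² = ∞ on Ω = R gives M(T) = M(T_0) = ∞ for T(x) = x + 1), and the strict inequality itself implies it. *)

theory Defs
  imports "HOL-Probability.Probability"
begin

definition psd :: "real^'n^'n \<Rightarrow> bool" where
  "psd A \<longleftrightarrow> transpose A = A \<and> (\<forall>v. 0 \<le> v \<bullet> (A *v v))"

definition loewner_le :: "real^'n^'n \<Rightarrow> real^'n^'n \<Rightarrow> bool" where
  "loewner_le A B \<longleftrightarrow> psd (B - A)"

text \<open>Here \<open>G\<close> is the gradient of \<open>\<phi>\<close> and \<open>H\<close> its Hessian matrix; both are determined by \<open>\<phi>\<close>.\<close>

definition Phi_alpha :: "real \<Rightarrow> real \<Rightarrow> (real^'n \<Rightarrow> real) set" where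
  "Phi_alpha L \<alpha> = {\<phi>. \<exists>(G :: real^'n \<Rightarrow> real^'n) (H :: real^'n \<Rightarrow> real^'n^'n).
     (\<forall>x. GDERIV \<phi> x :> G x) \<and>
     (\<forall>x. (G has_derivative (\<lambda>h. H x *v h)) (at x)) \<and>
     (\<forall>x. loewner_le (mat \<alpha>) (H x) \<and> loewner_le (H x) (mat L))}"

definition Phi :: "real \<Rightarrow> (real^'n \<Rightarrow> real) set" where
  "Phi L = (\<Union>\<alpha>\<in>{0<..<L}. Phi_alpha L \<alpha>)"

text \<open>Maps \<open>\<Omega> \<rightarrow> \<Omega>\<close> are total functions whose values outside \<open>\<Omega>\<close> are immaterial:
  every notion below depends on them only through their restriction to \<open>\<Omega>\<close>.\<close>

definition reg_maps :: "real \<Rightarrow> (real^'n) set \<Rightarrow> (real^'n \<Rightarrow> real^'n) set" where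
  "reg_maps L \<Omega> = {T. T \<in> \<Omega> \<rightarrow> \<Omega> \<and> (\<exists>\<phi>\<in>Phi L. \<forall>x\<in>\<Omega>. GDERIV \<phi> x :> T x)}"

text \<open>The Borel \<open>\<sigma>\<close>-algebra of the subspace \<open>\<Omega>\<close>, which itself need not be a Borel set.
  Only the sets of this measure space matter.\<close>

abbreviation borel_on :: "(real^'n) set \<Rightarrow> (real^'n) measure" where
  "borel_on \<Omega> \<equiv> restrict_space borel \<Omega>"

definition W2 :: "(real^'n) set \<Rightarrow> (real^'n) measure set" where
  "W2 \<Omega> = {\<mu>. prob_space \<mu> \<and> sets \<mu> = sets (borel_on \<Omega>) \<and>
     (\<integral>\<^sup>+ x. ennreal ((norm x)\<^sup>2) \<partial>\<mu>) < \<infinity>}"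

definition pushforward ::
  "(real^'n) set \<Rightarrow> (real^'n \<Rightarrow> real^'n) \<Rightarrow> (real^'n) measure \<Rightarrow> (real^'n) measure" where
  "pushforward \<Omega> T \<mu> = distr \<mu> (borel_on \<Omega>) T"

definition couplings ::
  "(real^'n) set \<Rightarrow> (real^'n) measure \<Rightarrow> (real^'n) measure \<Rightarrow> ((real^'n) \<times> (real^'n)) measure set" where
  "couplings \<Omega> \<mu> \<nu> = {\<gamma>. prob_space \<gamma> \<and> sets \<gamma> = sets (borel_on \<Omega> \<Otimes>\<^sub>M borel_on \<Omega>) \<and>
     distr \<gamma> (borel_on \<Omega>) fst = \<mu> \<and> distr \<gamma> (borel_on \<Omega>) snd = \<nu>}"

text \<open>The infimum is finite for \<open>\<mu>, \<nu> \<in> W2 \<Omega>\<close> (product coupling), so \<^const>\<open>enn2real\<close> loses nothing.\<close>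

definition wass_dist :: "(real^'n) set \<Rightarrow> (real^'n) measure \<Rightarrow> (real^'n) measure \<Rightarrow> real" where
  "wass_dist \<Omega> \<mu> \<nu> =
     sqrt (enn2real (INF \<gamma>\<in>couplings \<Omega> \<mu> \<nu>. \<integral>\<^sup>+ (x, y). ennreal ((norm (x - y))\<^sup>2) \<partial>\<gamma>))"

definition W2_open :: "(real^'n) set \<Rightarrow> (real^'n) measure set \<Rightarrow> bool" where
  "W2_open \<Omega> U \<longleftrightarrow> U \<subseteq> W2 \<Omega> \<and>
     (\<forall>\<mu>\<in>U. \<exists>r>0. \<forall>\<nu>\<in>W2 \<Omega>. wass_dist \<Omega> \<mu> \<nu> < r \<longrightarrow> \<nu> \<in> U)"

definition W2_borel :: "(real^'n) set \<Rightarrow> (real^'n) measure measure" where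
  "W2_borel \<Omega> = sigma (W2 \<Omega>) {U. W2_open \<Omega> U}"

definition W2_support :: "(real^'n) set \<Rightarrow> (real^'n) measure measure \<Rightarrow> (real^'n) measure set" where
  "W2_support \<Omega> PM = {\<mu>\<in>W2 \<Omega>. \<forall>U. W2_open \<Omega> U \<and> \<mu> \<in> U \<longrightarrow> 0 < emeasure PM U}"

text \<open>Absolute continuity of a measure on \<open>\<Omega>\<close>, regarded as a measure on the whole space.\<close>

definition abs_cont :: "(real^'n) measure \<Rightarrow> bool" where
  "abs_cont \<mu> \<longleftrightarrow> absolutely_continuous lborel (distr \<mu> borel (\<lambda>x. x))"

definition linear_average :: "(real^'n) set \<Rightarrow> (real^'n) measure measure \<Rightarrow> (real^'n) measure" where
  "linear_average \<Omega> PM =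
     measure_of \<Omega> (sets (borel_on \<Omega>)) (\<lambda>A. \<integral>\<^sup>+ \<mu>. emeasure \<mu> A \<partial>PM)"

definition L2_norm_sq :: "(real^'n) measure \<Rightarrow> (real^'n \<Rightarrow> real^'n) \<Rightarrow> ennreal" where
  "L2_norm_sq Q f = (\<integral>\<^sup>+ x. ennreal ((norm (f x))\<^sup>2) \<partial>Q)"

text \<open>Random maps carry the \<open>\<sigma>\<close>-algebra generated by the evaluations at points of \<open>\<Omega>\<close>.
  On \<^const>\<open>reg_maps\<close>, whose members are all \<open>L\<close>-Lipschitz on \<open>\<Omega>\<close>, this is the Borel
  \<open>\<sigma>\<close>-algebra of uniform convergence on compact sets.\<close>

abbreviation map_algebra :: "(real^'n) set \<Rightarrow> (real^'n \<Rightarrow> real^'n) measure" where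
  "map_algebra \<Omega> \<equiv> Pi\<^sub>M \<Omega> (\<lambda>_. borel)"

text \<open>The Bochner mean of a random map, as a map on \<open>\<Omega>\<close>: the library's Bochner integral is
  taken at every point of \<open>\<Omega>\<close>. For equi-Lipschitz random maps this agrees with the Bochner
  integral in the space of continuous maps under uniform convergence on compact sets.\<close>

definition has_bochner_mean ::
  "'w measure \<Rightarrow> (real^'n) set \<Rightarrow> ('w \<Rightarrow> real^'n \<Rightarrow> real^'n) \<Rightarrow> (real^'n \<Rightarrow> real^'n) \<Rightarrow> bool" where
  "has_bochner_mean R \<Omega> S m \<longleftrightarrow> (\<forall>x\<in>\<Omega>. has_bochner_integral R (\<lambda>\<omega>. S \<omega> x) (m x))"

definition M_functional ::
  "(real^'n) set \<Rightarrow> ((real^'n) measure \<times> (real^'n) measure) measure \<Rightarrow> (real^'n \<Rightarrow> real^'n) \<Rightarrow> ennreal" where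
  "M_functional \<Omega> P T =
     1/2 * (\<integral>\<^sup>+ (\<mu>, \<nu>). ennreal ((wass_dist \<Omega> (pushforward \<Omega> T \<mu>) \<nu>)\<^sup>2) \<partial>P)"

end

theory Submission
  imports Defs
begin

text \<open>Write \<open>\<rho> = T#\<mu>\<close>, \<open>\<sigma> = T0#\<mu>\<close> and let \<open>\<phi>\<close> be the potential of the noise map, with gradient \<open>G\<close>.
  The easy half of Kantorovich duality, applied to the pair \<open>|x|\<^sup>2 - 2 \<phi>(x)\<close> and \<open>|y|\<^sup>2 - 2 \<phi>*(y)\<close>,
  bounds \<open>d\<^sup>2(\<rho>, G#\<sigma>)\<close> from below by
  \<open>\<integral>|G z - z|\<^sup>2 d\<sigma> + \<integral>(|x|\<^sup>2 - 2 \<phi>(x)) d\<rho> - \<integral>(|x|\<^sup>2 - 2 \<phi>(x)) d\<sigma>\<close>, whereas the coupling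
  by \<open>G\<close> bounds \<open>d\<^sup>2(\<sigma>, G#\<sigma>)\<close> from above by the first of these three terms. The noise has mean
  the identity, so \<open>\<phi>\<close> averages to \<open>|x|\<^sup>2/2\<close> up to a constant; by independence the last two terms
  cancel in the mean, conditionally on \<open>\<mu>\<close>.

  The inequality is strict wherever \<open>T \<noteq> T0\<close> on a set of positive \<open>\<mu>\<close>-measure: if \<open>b\<close> is the
  difference of the conjugates of the potentials of \<open>T0\<close> and \<open>T\<close>, then \<open>\<integral>b d\<sigma> < \<integral>b d\<rho>\<close>, and the
  strong convexity of \<open>\<phi>\<close> leaves room to add a small multiple of \<open>b\<close> to the dual pair.

  Measurability of \<open>d\<close> on the product \<open>\<sigma>\<close>-algebra is never needed: the lower bound passes through
  the supremum of a countable family of dual functionals, which is measurable and still dominates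
  every continuous dual pair of quadratic growth.\<close>

section \<open>Strongly convex potentials and their conjugates\<close>

text \<open>The potential of the noise is only known to exist for each outcome, so it need not
  depend measurably on the outcome and cannot be averaged directly. Differences of potentials are
  therefore written as line integrals of the noise map along the segment from \<open>T0 x\<close> to
  \<open>T x\<close>. Convexity of \<open>\<Omega>\<close> keeps the segment where evaluations are
  measurable and have the prescribed mean, and Fubini then gives zero. The correction term obtained
  this way is linear in the noise, so a first moment makes it integrable. The displacement cost is
  quadratic, and its integrability is drawn from
  \<open>M_functional \<Omega> P T0 < \<infinity>\<close>, without which no strict inequality could
  be concluded. Conditioning on \<open>\<mu>\<close> is done by splitting the sample space into two
  copies, carrying the sigma-algebras generated by \<open>\<mu>\<close> and by the noise;
  independence makes the diagonal law a product. The squared distance to \<open>\<nu>\<close> is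
  never shown measurable. The library integral is a supremum over simple functions below the
  integrand, so a measurable minorant suffices on one side and a one-sided change of variables on
  the other.\<close>

lemma loewner_bounds:
  fixes H :: "real^'n^'n"
  assumes "loewner_le (mat \<alpha>) H" "loewner_le H (mat L)"
  shows "transpose H = H" "\<alpha> * (v \<bullet> v) \<le> v \<bullet> (H *v v)" "v \<bullet> (H *v v) \<le> L * (v \<bullet> v)"
proof -
  have m: "mat c *v v = c *\<^sub>R v" for c :: real and v :: "real^'n"
    by (simp add: vec_eq_iff matrix_vector_mult_def mat_def if_distrib[where f="\<lambda>x. x * _"] cong: if_cong)
  have sym: "transpose (mat L - H) = mat L - H"
    using assms(2) by (simp add: loewner_le_def psd_def)
  have "H $ j $ i = H $ i $ j" for i j
    using arg_cong[OF sym, of "\<lambda>A. A $ i $ j"] by (cases "i = j") (auto simp: transpose_def mat_def)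
  then show "transpose H = H"
    by (simp add: vec_eq_iff transpose_def)
  show "\<alpha> * (v \<bullet> v) \<le> v \<bullet> (H *v v)" "v \<bullet> (H *v v) \<le> L * (v \<bullet> v)"
    using assms[unfolded loewner_le_def psd_def, THEN conjunct2, THEN spec, of v]
    by (simp_all add: matrix_vector_mult_diff_rdistrib inner_diff_right m)
qed

text \<open>No spectral theorem is used: with \<open>w = H *v v\<close>, nonnegativity of the form
  at \<open>L *\<^sub>R v - w\<close> reads \<open>0 \<le> L\<^sup>2 * (v \<bullet> (H *v v)) - 2 *
  L * (w \<bullet> w) + w \<bullet> (H *v w)\<close>, and the upper bound on the form at
  \<open>v\<close> and at \<open>w\<close> finishes.\<close>

lemma norm_matrix_vector_le:
  fixes H :: "real^'n^'n"
  assumes L: "0 < L" and sym: "transpose H = H"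
    and nonneg: "\<And>v. 0 \<le> v \<bullet> (H *v v)" and le: "\<And>v. v \<bullet> (H *v v) \<le> L * (v \<bullet> v)"
  shows "norm (H *v v) \<le> L * norm v"
proof -
  define w where "w = H *v v"
  have symm: "x \<bullet> (H *v y) = y \<bullet> (H *v x)" for x y
    by (metis dot_lmul_matrix inner_commute sym vector_transpose_matrix)
  have expand: "(x + c *\<^sub>R y) \<bullet> (H *v (x + c *\<^sub>R y)) =
      x \<bullet> (H *v x) + 2 * c * (x \<bullet> (H *v y)) + c\<^sup>2 * (y \<bullet> (H *v y))" for x y c
    by (simp add: matrix_vector_right_distrib matrix_vector_mult_scaleR inner_add_left
        inner_add_right symm[of y x] power2_eq_square distrib_left)
  have "v \<bullet> (H *v w) = w \<bullet> w" unfolding symm[of v w] by (simp add: w_def)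
  moreover have "0 \<le> (L *\<^sub>R v + (-1) *\<^sub>R w) \<bullet> (H *v (L *\<^sub>R v + (-1) *\<^sub>R w))" by (rule nonneg)
  ultimately have "0 \<le> L\<^sup>2 * (v \<bullet> (H *v v)) - 2 * L * (w \<bullet> w) + w \<bullet> (H *v w)"
    unfolding expand by (simp add: matrix_vector_mult_scaleR power2_eq_square)
  moreover have "L\<^sup>2 * (v \<bullet> (H *v v)) \<le> L\<^sup>2 * (L * (v \<bullet> v))"
    by (intro mult_left_mono le) auto
  moreover have "L\<^sup>2 * (L * (v \<bullet> v)) = L * (L\<^sup>2 * (v \<bullet> v))" by simp
  ultimately have "L * (w \<bullet> w) \<le> L * (L\<^sup>2 * (v \<bullet> v))"
    using le[of w] by linarith
  with L have "w \<bullet> w \<le> L\<^sup>2 * (v \<bullet> v)" by simp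
  then have "(norm w)\<^sup>2 \<le> (L * norm v)\<^sup>2"
    by (simp add: power_mult_distrib power2_norm_eq_inner)
  then have "norm w \<le> L * norm v"
    by (rule power2_le_imp_le) (use L in simp)
  then show ?thesis by (simp add: w_def)
qed

lemma DERIV_GDERIV_along_line:
  fixes \<phi> :: "real^'n \<Rightarrow> real"
  assumes "\<And>x. GDERIV \<phi> x :> G x"
  shows "((\<lambda>t. \<phi> (z + t *\<^sub>R v)) has_real_derivative G (z + t *\<^sub>R v) \<bullet> v) (at t)"
proof -
  have "(\<phi> has_derivative (\<lambda>h. h \<bullet> G (z + t *\<^sub>R v))) (at (z + t *\<^sub>R v))"
    using assms by (simp add: gderiv_def)
  moreover have "((\<lambda>t. z + t *\<^sub>R v) has_derivative (\<lambda>h. h *\<^sub>R v)) (at t)"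
    by (auto intro!: derivative_eq_intros)
  ultimately have "((\<lambda>t. \<phi> (z + t *\<^sub>R v)) has_derivative (\<lambda>h. (h *\<^sub>R v) \<bullet> G (z + t *\<^sub>R v))) (at t)"
    using has_derivative_compose by (fastforce simp: o_def)
  then show ?thesis
    by (auto simp: has_field_derivative_def inner_commute elim!: has_derivative_eq_rhs)
qed

text \<open>Two monotonicity arguments along the segment from \<open>z\<close> to \<open>x\<close>:
  the Hessian bound makes \<open>G \<bullet> v\<close> grow at rate at least
  \<open>\<alpha> * (v \<bullet> v)\<close>, and this in turn bounds the derivative of
  \<open>\<phi>\<close>.\<close>

lemma strongly_convex_of_hessian:
  fixes \<phi> :: "real^'n \<Rightarrow> real"
  assumes grad: "\<And>x. GDERIV \<phi> x :> G x"
    and hess: "\<And>x. (G has_derivative (\<lambda>h. H x *v h)) (at x)"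
    and lb: "\<And>x v. \<alpha> * (v \<bullet> v) \<le> v \<bullet> (H x *v v)"
  shows "\<phi> z + G z \<bullet> (x - z) + \<alpha> / 2 * (norm (x - z))\<^sup>2 \<le> \<phi> x"
proof -
  define v where "v = x - z"
  have dG: "((\<lambda>t. G (z + t *\<^sub>R v) \<bullet> v) has_real_derivative v \<bullet> (H (z + t *\<^sub>R v) *v v)) (at t)" for t
  proof -
    have "((\<lambda>t. z + t *\<^sub>R v) has_derivative (\<lambda>h. h *\<^sub>R v)) (at t)"
      by (auto intro!: derivative_eq_intros)
    from has_derivative_compose[OF this hess]
    have "((\<lambda>t. G (z + t *\<^sub>R v)) has_derivative (\<lambda>h. H (z + t *\<^sub>R v) *v (h *\<^sub>R v))) (at t)" .
    then have "((\<lambda>t. G (z + t *\<^sub>R v) \<bullet> v) has_derivative (\<lambda>h. (H (z + t *\<^sub>R v) *v (h *\<^sub>R v)) \<bullet> v)) (at t)"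
      by (rule has_derivative_inner_left)
    then show ?thesis
      by (auto simp: has_field_derivative_def matrix_vector_mult_scaleR inner_commute
          elim!: has_derivative_eq_rhs)
  qed
  have mono: "G z \<bullet> v + \<alpha> * t * (v \<bullet> v) \<le> G (z + t *\<^sub>R v) \<bullet> v" if "0 \<le> t" for t
  proof -
    have "(\<lambda>t. G (z + t *\<^sub>R v) \<bullet> v - \<alpha> * t * (v \<bullet> v)) 0 \<le> (\<lambda>t. G (z + t *\<^sub>R v) \<bullet> v - \<alpha> * t * (v \<bullet> v)) t"
    proof (rule DERIV_nonneg_imp_nondecreasing[OF that, where f="\<lambda>t. G (z + t *\<^sub>R v) \<bullet> v - \<alpha> * t * (v \<bullet> v)"])
      fix s
      have "((\<lambda>t. G (z + t *\<^sub>R v) \<bullet> v - \<alpha> * t * (v \<bullet> v)) has_real_derivative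
          v \<bullet> (H (z + s *\<^sub>R v) *v v) - \<alpha> * (v \<bullet> v)) (at s)"
        by (auto intro!: derivative_eq_intros dG)
      then show "\<exists>y. ((\<lambda>t. G (z + t *\<^sub>R v) \<bullet> v - \<alpha> * t * (v \<bullet> v)) has_real_derivative y) (at s) \<and> 0 \<le> y"
        using lb[of v] by fastforce
    qed
    then show ?thesis by simp
  qed
  let ?f = "\<lambda>t. \<phi> (z + t *\<^sub>R v) - t * (G z \<bullet> v) - \<alpha> * t\<^sup>2 / 2 * (v \<bullet> v)"
  have "?f 0 \<le> ?f 1"
  proof (rule DERIV_nonneg_imp_nondecreasing[where f="?f"])
    fix s :: real assume "0 \<le> s"
    have "(?f has_real_derivative G (z + s *\<^sub>R v) \<bullet> v - G z \<bullet> v - \<alpha> * s * (v \<bullet> v)) (at s)"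
      by (auto intro!: derivative_eq_intros DERIV_GDERIV_along_line[OF grad])
    then show "\<exists>y. (?f has_real_derivative y) (at s) \<and> 0 \<le> y"
      using mono[OF \<open>0 \<le> s\<close>] by fastforce
  qed simp
  then show ?thesis by (simp add: v_def power2_norm_eq_inner)
qed

text \<open>All that is kept of the Hessian bounds. \<open>S\<close> is the inverse of the gradient,
  that is, the gradient of the convex conjugate. The modulus \<open>\<alpha>\<close> belongs to the
  single potential, as the union over \<open>\<alpha>\<close> in \<open>Phi\<close> has no common
  lower bound, whereas \<open>L\<close> is shared.\<close>

locale convex_potential =
  fixes \<phi> :: "real^'n \<Rightarrow> real" and G S :: "real^'n \<Rightarrow> real^'n" and \<alpha> L :: real
  assumes \<alpha>_pos: "0 < \<alpha>" and L_nonneg: "0 \<le> L"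
    and grad: "\<And>x. GDERIV \<phi> x :> G x"
    and strongly_convex: "\<And>x z. \<phi> z + G z \<bullet> (x - z) + \<alpha> / 2 * (norm (x - z))\<^sup>2 \<le> \<phi> x"
    and lipschitz: "\<And>x y. norm (G x - G y) \<le> L * norm (x - y)"
    and G_S [simp]: "\<And>y. G (S y) = y"

text \<open>A solution of \<open>G x = y\<close> is a fixed point of
  \<open>x - c *\<^sub>R (G x - y)\<close>. Monotonicity and the Lipschitz bound give the squared
  contraction factor \<open>1 - 2 * c * \<alpha> + c\<^sup>2 * L\<^sup>2\<close>; the choice
  \<open>c = \<alpha> / L\<^sup>2\<close> minimises it, with value \<open>q\<^sup>2\<close>.\<close>

lemma strongly_monotone_surj:
  fixes G :: "real^'n \<Rightarrow> real^'n"
  assumes "0 < \<alpha>" "0 < L"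
    and mono: "\<And>x z. \<alpha> * (norm (x - z))\<^sup>2 \<le> (G x - G z) \<bullet> (x - z)"
    and lip: "\<And>x y. norm (G x - G y) \<le> L * norm (x - y)"
  shows "\<exists>x. G x = y"
proof -
  define c where "c = \<alpha> / L\<^sup>2"
  define q where "q = sqrt (1 - \<alpha>\<^sup>2 / L\<^sup>2)"
  have "c > 0" using assms by (simp add: c_def)
  \<comment> \<open>The two bounds on \<open>G\<close>, compared at a unit vector and 0, keep the
    radicand in \<open>q\<close> nonnegative.\<close>
  have "\<alpha> \<le> L"
  proof -
    obtain x :: "real^'n" where x: "norm x = 1" using vector_choose_size[of 1] by auto
    have "\<alpha> \<le> (G x - G 0) \<bullet> (x - 0)" using mono[of x 0] x by simp
    also have "\<dots> \<le> norm (G x - G 0) * norm (x - 0)" by (rule norm_cauchy_schwarz)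
    also have "\<dots> \<le> L" using lip[of x 0] x by simp
    finally show ?thesis .
  qed
  then have q: "0 \<le> q" "q < 1" "q\<^sup>2 = 1 - \<alpha>\<^sup>2 / L\<^sup>2"
    using assms(1,2) by (auto simp: q_def power_mono)
  define f where "f x = x - c *\<^sub>R (G x - y)" for x
  have "dist (f x) (f x') \<le> q * dist x x'" for x x'
  proof -
    define d e where "d = x - x'" and "e = G x - G x'"
    have "(norm e)\<^sup>2 \<le> (L * norm d)\<^sup>2" unfolding d_def e_def by (intro power_mono lip) simp
    then have e2: "c\<^sup>2 * (norm e)\<^sup>2 \<le> c\<^sup>2 * (L\<^sup>2 * (norm d)\<^sup>2)"
      by (simp add: power_mult_distrib mult_left_mono)
    have de: "2 * c * (\<alpha> * (norm d)\<^sup>2) \<le> 2 * c * (e \<bullet> d)"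
      using mono[of x x'] \<open>c > 0\<close> by (simp add: d_def e_def)
    have "(norm (d - c *\<^sub>R e))\<^sup>2 = (norm d)\<^sup>2 - 2 * c * (e \<bullet> d) + c\<^sup>2 * (norm e)\<^sup>2"
      unfolding power2_norm_eq_inner
      by (simp add: inner_diff_left inner_diff_right inner_commute power2_eq_square)
    also have "\<dots> \<le> (norm d)\<^sup>2 - 2 * c * (\<alpha> * (norm d)\<^sup>2) + c\<^sup>2 * (L\<^sup>2 * (norm d)\<^sup>2)"
      using e2 de by linarith
    also have "\<dots> = (q * norm d)\<^sup>2"
      unfolding power_mult_distrib q(3) c_def
      using assms(2) by (simp add: field_simps power2_eq_square)
    finally have "norm (d - c *\<^sub>R e) \<le> q * norm d" 
      by (rule power2_le_imp_le) (use q(1) in simp)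
    moreover have "f x - f x' = d - c *\<^sub>R e" by (simp add: f_def d_def e_def algebra_simps)
    ultimately show ?thesis by (simp add: dist_norm d_def)
  qed
  then have "\<exists>!x. f x = x" using q by (intro banach_fix_type) auto
  then show ?thesis using \<open>c > 0\<close> by (auto simp: f_def)
qed

lemma Phi_imp_convex_potential:
  fixes \<phi> :: "real^'n \<Rightarrow> real"
  assumes "\<phi> \<in> Phi L"
  obtains G S \<alpha> where "convex_potential \<phi> G S \<alpha> L"
proof -
  obtain \<alpha> G H where \<alpha>: "0 < \<alpha>" "\<alpha> < L" and grad: "\<And>x. GDERIV \<phi> x :> G x"
    and hess: "\<And>x. (G has_derivative (\<lambda>h. H x *v h)) (at x)"
    and lo: "\<And>x. loewner_le (mat \<alpha>) (H x)" "\<And>x. loewner_le (H x) (mat L)"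
    using assms unfolding Phi_def Phi_alpha_def by fastforce
  note b = loewner_bounds[OF lo]
  have sc: "\<phi> z + G z \<bullet> (x - z) + \<alpha> / 2 * (norm (x - z))\<^sup>2 \<le> \<phi> x" for x z
    using strongly_convex_of_hessian[OF grad hess b(2)] .
  have "norm (H x *v v) \<le> L * norm v" for x v
    using \<alpha> by (intro norm_matrix_vector_le b(1,3) order_trans[OF _ b(2)]) auto
  then have lip: "norm (G x - G y) \<le> L * norm (x - y)" for x y
    using \<alpha> by (intro differentiable_bound[OF convex_UNIV] onorm_bound) (auto intro: hess)
  have "\<alpha> * (norm (x - z))\<^sup>2 \<le> (G x - G z) \<bullet> (x - z)" for x z
    using sc[of x z] sc[of z x] by (simp add: norm_minus_commute inner_diff_left inner_diff_right algebra_simps)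
  then have "\<exists>x. G x = y" for y
    using \<alpha> lip by (intro strongly_monotone_surj[of \<alpha> L]) auto
  then obtain S where "\<And>y. G (S y) = y" by metis
  with \<alpha> grad sc lip show ?thesis by (intro that[of G S \<alpha>]) (unfold_locales, auto)
qed

text \<open>The class of test functions for the dual problem: integrable under every measure with
  finite second moment, and stable under the sums, products with constants and Lipschitz
  substitutions that occur below.\<close>

definition quad_growth :: "(real^'n \<Rightarrow> real) \<Rightarrow> bool" where
  "quad_growth f \<longleftrightarrow> (\<exists>C. \<forall>x. \<bar>f x\<bar> \<le> C * (1 + (norm x)\<^sup>2))"

lemma quad_growthI: "(\<And>x. \<bar>f x\<bar> \<le> C * (1 + (norm x)\<^sup>2)) \<Longrightarrow> quad_growth f"
  by (auto simp: quad_growth_def)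

lemma quad_growth_add: "quad_growth f \<Longrightarrow> quad_growth g \<Longrightarrow> quad_growth (\<lambda>x. f x + g x)"
  unfolding quad_growth_def
proof (elim exE)
  fix C D assume "\<forall>x. \<bar>f x\<bar> \<le> C * (1 + (norm x)\<^sup>2)" "\<forall>x. \<bar>g x\<bar> \<le> D * (1 + (norm x)\<^sup>2)"
  then have "\<bar>f x + g x\<bar> \<le> (C + D) * (1 + (norm x)\<^sup>2)" for x
    by (smt (verit) distrib_right)
  then show "\<exists>C. \<forall>x. \<bar>f x + g x\<bar> \<le> C * (1 + (norm x)\<^sup>2)" by blast
qed

lemma quad_growth_cmult: "quad_growth f \<Longrightarrow> quad_growth (\<lambda>x. c * f x)"
  unfolding quad_growth_def
proof (elim exE)
  fix C assume *: "\<forall>x. \<bar>f x\<bar> \<le> C * (1 + (norm x)\<^sup>2)"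
  have "\<bar>c * f x\<bar> \<le> (\<bar>c\<bar> * C) * (1 + (norm x)\<^sup>2)" for x
    using mult_left_mono[OF spec[OF *, of x], of "\<bar>c\<bar>"] by (simp add: abs_mult mult.assoc)
  then show "\<exists>C. \<forall>x. \<bar>c * f x\<bar> \<le> C * (1 + (norm x)\<^sup>2)" by blast
qed

lemma quad_growth_diff: "quad_growth f \<Longrightarrow> quad_growth g \<Longrightarrow> quad_growth (\<lambda>x. f x - g x)"
  using quad_growth_add[OF _ quad_growth_cmult[of g "-1"]] by simp

lemma quad_growth_norm_sq: "quad_growth (\<lambda>x. (norm x)\<^sup>2)"
  by (rule quad_growthI[where C=1]) simp

lemma quad_growth_mono:
  fixes f g :: "real^'n \<Rightarrow> real"
  assumes "quad_growth g" "\<And>x. \<bar>f x\<bar> \<le> g x" shows "quad_growth f"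
  using assms unfolding quad_growth_def by (meson abs_ge_self order_trans)

lemma quad_growth_lipschitz:
  fixes F :: "real^'n \<Rightarrow> real^'n"
  assumes lip: "\<And>x y. norm (F x - F y) \<le> K * norm (x - y)"
  shows "quad_growth (\<lambda>x. (norm (F x))\<^sup>2)"
proof (rule quad_growthI)
  fix x
  have "norm (F x) \<le> norm (F 0) + K * norm x"
    using lip[of x 0] norm_triangle_ineq4[of "F x" "F 0"] norm_triangle_sub[of "F x" "F 0"] by simp
  then have "(norm (F x))\<^sup>2 \<le> (norm (F 0) + K * norm x)\<^sup>2" by (intro power_mono) auto
  also have "\<dots> \<le> 2 * (norm (F 0))\<^sup>2 + 2 * (K * norm x)\<^sup>2"
    using sum_squares_bound[of "norm (F 0)" "K * norm x"] by (simp add: power2_sum)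
  also have "\<dots> \<le> (2 * (norm (F 0))\<^sup>2 + 2 * K\<^sup>2) * (1 + (norm x)\<^sup>2)"
    by (simp add: algebra_simps power_mult_distrib)
  finally show "\<bar>(norm (F x))\<^sup>2\<bar> \<le> (2 * (norm (F 0))\<^sup>2 + 2 * K\<^sup>2) * (1 + (norm x)\<^sup>2)" by simp
qed

lemma abs_inner_le_norm_sq: "\<bar>u \<bullet> v\<bar> \<le> (norm u)\<^sup>2 + (norm v)\<^sup>2"
  using Cauchy_Schwarz_ineq2[of u v] sum_squares_bound[of "norm u" "norm v"]
    zero_le_power2[of "norm u"] zero_le_power2[of "norm v"] by linarith

lemma quad_growth_inner:
  fixes F F' :: "real^'n \<Rightarrow> real^'n"
  assumes "quad_growth (\<lambda>x. (norm (F x))\<^sup>2)" "quad_growth (\<lambda>x. (norm (F' x))\<^sup>2)"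
  shows "quad_growth (\<lambda>x. F x \<bullet> F' x)"
  by (rule quad_growth_mono[OF quad_growth_add[OF assms]]) (rule abs_inner_le_norm_sq)

lemma quad_growth_const: "quad_growth (\<lambda>x. c)"
  by (rule quad_growthI[where C="\<bar>c\<bar>"]) (simp add: distrib_left)

lemma quad_growth_compose:
  assumes "quad_growth f" "quad_growth (\<lambda>x. (norm (F x))\<^sup>2)"
  shows "quad_growth (\<lambda>x. f (F x))"
proof -
  obtain C where C: "\<And>x. \<bar>f x\<bar> \<le> C * (1 + (norm x)\<^sup>2)" using assms(1) by (auto simp: quad_growth_def)
  show ?thesis
    by (rule quad_growth_mono[OF quad_growth_cmult[OF quad_growth_add[OF quad_growth_const[of 1] assms(2)], of C]])
      (rule C)
qed

context convex_potential
begin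

text \<open>The convex conjugate of \<open>\<phi>\<close>, written with its maximiser
  \<open>S y\<close> instead of a supremum, so that continuity and growth follow from those of
  \<open>S\<close> and \<open>\<phi>\<close>.\<close>

definition legendre where "legendre y = y \<bullet> S y - \<phi> (S y)"

lemma strongly_monotone: "\<alpha> * (norm (x - z))\<^sup>2 \<le> (G x - G z) \<bullet> (x - z)"
  using strongly_convex[of x z] strongly_convex[of z x]
  by (simp add: norm_minus_commute inner_diff_left inner_diff_right algebra_simps)

lemma G_inj: "G x = G y \<Longrightarrow> x = y"
  using strongly_monotone[of x y] \<alpha>_pos by (simp add: mult_le_0_iff)

lemma S_G [simp]: "S (G x) = x"
  by (rule G_inj) simp

lemma S_lipschitz: "norm (S x - S y) \<le> (1 / \<alpha>) * norm (x - y)"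
proof -
  have "\<alpha> * (norm (S x - S y))\<^sup>2 \<le> norm (x - y) * norm (S x - S y)"
    using strongly_monotone[of "S x" "S y"] norm_cauchy_schwarz[of "x - y" "S x - S y"] by simp
  then show ?thesis
    using \<alpha>_pos by (cases "S x = S y") (auto simp: power2_eq_square field_simps)
qed

lemma continuous_G: "continuous_on UNIV G"
  by (rule lipschitz_on_continuous_on[of L]) (auto simp: lipschitz_on_def dist_norm lipschitz L_nonneg)

lemma continuous_S: "continuous_on UNIV S"
  by (rule lipschitz_on_continuous_on[of "1/\<alpha>"])
    (use \<alpha>_pos S_lipschitz in \<open>auto simp: lipschitz_on_def dist_norm\<close>)

lemma continuous_\<phi>: "continuous_on UNIV \<phi>"
  using grad by (auto simp: gderiv_def continuous_on_eq_continuous_at intro: has_derivative_continuous)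

lemma continuous_legendre: "continuous_on UNIV legendre"
  unfolding legendre_def
  by (intro continuous_intros continuous_S continuous_on_compose2[OF continuous_\<phi> continuous_S]) auto

lemma quad_growth_S: "quad_growth (\<lambda>x. (norm (S x))\<^sup>2)"
  using quad_growth_lipschitz[OF S_lipschitz] .

lemma quad_growth_G: "quad_growth (\<lambda>x. (norm (G x))\<^sup>2)"
  using quad_growth_lipschitz[OF lipschitz] .

lemma quad_growth_\<phi>: "quad_growth \<phi>"
proof (rule quad_growth_mono)
  show "quad_growth (\<lambda>x. (\<bar>\<phi> 0\<bar> + (norm (G 0))\<^sup>2) + ((norm (G x))\<^sup>2 + (norm x)\<^sup>2))"
    by (intro quad_growth_add quad_growth_const quad_growth_G quad_growth_norm_sq)
  fix x :: "real^'n"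
  have "0 \<le> \<alpha> / 2 * (norm x)\<^sup>2" using \<alpha>_pos by simp
  then have "\<phi> 0 + G 0 \<bullet> x \<le> \<phi> x" "\<phi> x \<le> \<phi> 0 + G x \<bullet> x"
    using strongly_convex[of 0 x] strongly_convex[of x 0] by auto
  then show "\<bar>\<phi> x\<bar> \<le> (\<bar>\<phi> 0\<bar> + (norm (G 0))\<^sup>2) + ((norm (G x))\<^sup>2 + (norm x)\<^sup>2)"
    using abs_inner_le_norm_sq[of "G 0" x] abs_inner_le_norm_sq[of "G x" x]
    zero_le_power2[of "norm (G x)"] zero_le_power2[of "norm (G 0)"] by linarith
qed

lemma quad_growth_legendre: "quad_growth legendre"
  unfolding legendre_def[abs_def]
  by (intro quad_growth_diff quad_growth_inner quad_growth_S quad_growth_norm_sq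
      quad_growth_compose[OF quad_growth_\<phi>])

text \<open>Strong convexity with base point \<open>S y\<close>. The quadratic surplus has two uses:
  it leaves room to perturb the dual pair, and it detects where two gradient maps differ.\<close>

lemma fenchel_young: "x \<bullet> y + \<alpha> / 2 * (norm (x - S y))\<^sup>2 \<le> \<phi> x + legendre y"
  using strongly_convex[of "S y" x] by (simp add: legendre_def inner_diff_right inner_commute)

lemma legendre_G: "legendre (G x) = G x \<bullet> x - \<phi> x"
  by (simp add: legendre_def)

lemma legendre_subgradient: "legendre z + S z \<bullet> (x - z) \<le> legendre x"
proof -
  have "S z \<bullet> x + 0 \<le> \<phi> (S z) + legendre x"
    using fenchel_young[of "S z" x] \<alpha>_pos by (smt (verit) divide_nonneg_nonneg mult_nonneg_nonneg zero_le_power2)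
  then show ?thesis by (simp add: legendre_def[of z] inner_diff_right inner_commute)
qed

text \<open>The subgradient inequality taken at \<open>x\<close>, with \<open>S x\<close> exchanged
  for \<open>S z\<close> at the cost of the Lipschitz constant of \<open>S\<close>. The optimal
  constant would be half as large; any finite one serves.\<close>

lemma legendre_upper: "legendre x \<le> legendre z + S z \<bullet> (x - z) + (1 / \<alpha>) * (norm (x - z))\<^sup>2"
proof -
  have "(S x - S z) \<bullet> (x - z) \<le> (1 / \<alpha>) * norm (x - z) * norm (x - z)"
    by (meson S_lipschitz mult_right_mono norm_cauchy_schwarz norm_ge_zero order_trans)
  then show ?thesis using legendre_subgradient[of x z]
    by (simp add: power2_eq_square inner_diff_left inner_diff_right)
qed

end

section \<open>Couplings and weak duality\<close>

lemma W2D: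
  assumes "m \<in> W2 \<Omega>"
  shows "prob_space m" "sets m = sets (borel_on \<Omega>)" "space m = \<Omega>"
  using assms by (auto simp: W2_def dest: sets_eq_imp_space_eq simp: space_restrict_space)

lemma borel_measurable_on:
  assumes "sets m = sets (borel_on \<Omega>)" "f \<in> borel_measurable borel"
  shows "f \<in> borel_measurable m"
  using measurable_restrict_space1[OF assms(2)] assms(1) by (simp cong: measurable_cong_sets)

lemma measurable_on_cong:
  assumes "sets m = sets (borel_on \<Omega>)"
  shows "measurable m N = measurable (borel_on \<Omega>) N"
  using assms by (rule measurable_cong_sets) simp

lemma W2_integrable_norm_sq:
  assumes "m \<in> W2 \<Omega>"
  shows "integrable m (\<lambda>x. (norm x)\<^sup>2)"
  using assms by (intro integrableI_nonneg borel_measurable_on[OF W2D(2)[OF assms]]) (auto simp: W2_def)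

lemma W2_integrable:
  assumes m: "m \<in> W2 \<Omega>" and f: "f \<in> borel_measurable borel" "quad_growth f"
  shows "integrable m f"
proof -
  interpret prob_space m by (rule W2D[OF m])
  obtain C where C: "\<And>x. \<bar>f x\<bar> \<le> C * (1 + (norm x)\<^sup>2)" using f(2) by (auto simp: quad_growth_def)
  have "integrable m (\<lambda>x. C * (1 + (norm x)\<^sup>2))"
    using W2_integrable_norm_sq[OF m] by (intro integrable_mult_right integrable_add) auto
  then show ?thesis
    by (rule Bochner_Integration.integrable_bound)
      (use borel_measurable_on[OF W2D(2)[OF m] f(1)] C in \<open>auto intro: order_trans[OF C abs_ge_self]\<close>)
qed

lemma couplingsD:
  assumes "\<gamma> \<in> couplings \<Omega> \<rho> \<nu>"
  shows "prob_space \<gamma>" "fst \<in> \<gamma> \<rightarrow>\<^sub>M borel_on \<Omega>" "snd \<in> \<gamma> \<rightarrow>\<^sub>M borel_on \<Omega>"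
    "distr \<gamma> (borel_on \<Omega>) fst = \<rho>" "distr \<gamma> (borel_on \<Omega>) snd = \<nu>" "space \<gamma> = \<Omega> \<times> \<Omega>"
proof -
  have s: "sets \<gamma> = sets (borel_on \<Omega> \<Otimes>\<^sub>M borel_on \<Omega>)" using assms by (simp add: couplings_def)
  show "fst \<in> \<gamma> \<rightarrow>\<^sub>M borel_on \<Omega>" "snd \<in> \<gamma> \<rightarrow>\<^sub>M borel_on \<Omega>"
    using s by (simp_all cong: measurable_cong_sets)
  show "space \<gamma> = \<Omega> \<times> \<Omega>"
    using sets_eq_imp_space_eq[OF s] by (simp add: space_pair_measure space_restrict_space)
qed (use assms in \<open>auto simp: couplings_def\<close>)

text \<open>\<open>ennreal\<close> cuts negative values off at 0, so the right side is the integral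
  of the positive part.\<close>

lemma ennreal_integral_le_nn_integral:
  fixes h :: "_ \<Rightarrow> real"
  assumes "integrable M h"
  shows "ennreal (integral\<^sup>L M h) \<le> (\<integral>\<^sup>+ x. ennreal (h x) \<partial>M)"
proof -
  have "ennreal (integral\<^sup>L M h) \<le> ennreal (\<integral>x. max 0 (h x) \<partial>M)"
    using assms by (intro ennreal_leI integral_mono) auto
  also have "\<dots> = (\<integral>\<^sup>+ x. ennreal (max 0 (h x)) \<partial>M)"
    using assms by (intro nn_integral_eq_integral[symmetric]) auto
  also have "\<dots> = (\<integral>\<^sup>+ x. ennreal (h x) \<partial>M)"
    by (intro nn_integral_cong) (auto simp: max_def ennreal_neg)
  finally show ?thesis .
qed

text \<open>Weak duality: the integral of \<open>f x + g y\<close> under a coupling depends on the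
  two marginals alone.\<close>

lemma dual_le_coupling_cost:
  assumes \<gamma>: "\<gamma> \<in> couplings \<Omega> \<rho> \<nu>" and W: "\<rho> \<in> W2 \<Omega>" "\<nu> \<in> W2 \<Omega>"
    and f: "f \<in> borel_measurable borel" "quad_growth f"
    and g: "g \<in> borel_measurable borel" "quad_growth g"
    and le: "\<And>x y. x \<in> \<Omega> \<Longrightarrow> y \<in> \<Omega> \<Longrightarrow> f x + g y \<le> (norm (x - y))\<^sup>2"
  shows "ennreal ((\<integral>x. f x \<partial>\<rho>) + (\<integral>y. g y \<partial>\<nu>)) \<le> (\<integral>\<^sup>+ (x, y). ennreal ((norm (x - y))\<^sup>2) \<partial>\<gamma>)"
proof -
  note c = couplingsD[OF \<gamma>]
  have fm: "f \<in> borel_measurable (borel_on \<Omega>)" "g \<in> borel_measurable (borel_on \<Omega>)"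
    by (intro borel_measurable_on[OF refl] f g)+
  have i: "integrable \<gamma> (\<lambda>z. f (fst z))" "integrable \<gamma> (\<lambda>z. g (snd z))"
    using W2_integrable[OF W(1) f] W2_integrable[OF W(2) g]
    unfolding c(4,5)[symmetric] using fm c(2,3) by (auto simp: integrable_distr_eq)
  have "(\<integral>x. f x \<partial>\<rho>) + (\<integral>y. g y \<partial>\<nu>) = (\<integral>z. f (fst z) + g (snd z) \<partial>\<gamma>)"
    unfolding c(4,5)[symmetric] using fm c(2,3) i by (simp add: integral_distr)
  also have "ennreal \<dots> \<le> (\<integral>\<^sup>+ z. ennreal (f (fst z) + g (snd z)) \<partial>\<gamma>)"
    by (intro ennreal_integral_le_nn_integral) (use i in simp)
  also have "\<dots> \<le> (\<integral>\<^sup>+ (x, y). ennreal ((norm (x - y))\<^sup>2) \<partial>\<gamma>)"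
    by (intro nn_integral_mono) (use le c(6) in \<open>auto intro!: ennreal_leI\<close>)
  finally show ?thesis .
qed

lemma product_coupling:
  assumes W: "\<rho> \<in> W2 \<Omega>" "\<nu> \<in> W2 \<Omega>"
  shows "\<rho> \<Otimes>\<^sub>M \<nu> \<in> couplings \<Omega> \<rho> \<nu>"
    and "(\<integral>\<^sup>+ (x, y). ennreal ((norm (x - y))\<^sup>2) \<partial>(\<rho> \<Otimes>\<^sub>M \<nu>)) < \<infinity>"
proof -
  interpret \<rho>: prob_space \<rho> by (rule W2D[OF W(1)])
  interpret \<nu>: prob_space \<nu> by (rule W2D[OF W(2)])
  interpret pair_prob_space \<rho> \<nu> ..
  note s = W2D(2)[OF W(1)] W2D(2)[OF W(2)]
  have 1: "distr (\<rho> \<Otimes>\<^sub>M \<nu>) (borel_on \<Omega>) fst = \<rho>"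
    using \<nu>.distr_pair_fst[of \<rho>] distr_cong[OF refl s(1), of "\<rho> \<Otimes>\<^sub>M \<nu>" fst fst] by simp
  have "distr (\<rho> \<Otimes>\<^sub>M \<nu>) \<nu> snd = \<nu>"
  proof (rule measure_eqI)
    fix A assume "A \<in> sets (distr (\<rho> \<Otimes>\<^sub>M \<nu>) \<nu> snd)"
    then have A: "A \<in> sets \<nu>" by simp
    then have "snd -` A \<inter> space (\<rho> \<Otimes>\<^sub>M \<nu>) = space \<rho> \<times> A"
      using sets.sets_into_space[OF A] by (auto simp: space_pair_measure)
    with A show "emeasure (distr (\<rho> \<Otimes>\<^sub>M \<nu>) \<nu> snd) A = emeasure \<nu> A"
      by (simp add: emeasure_distr \<nu>.emeasure_pair_measure_Times \<rho>.emeasure_space_1)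
  qed simp
  then have 2: "distr (\<rho> \<Otimes>\<^sub>M \<nu>) (borel_on \<Omega>) snd = \<nu>"
    using distr_cong[OF refl s(2), of "\<rho> \<Otimes>\<^sub>M \<nu>" snd snd] by simp
  show "\<rho> \<Otimes>\<^sub>M \<nu> \<in> couplings \<Omega> \<rho> \<nu>"
    unfolding couplings_def using 1 2 sets_pair_measure_cong[OF s] prob_space_axioms by simp
  have n: "(\<lambda>x. ennreal ((norm x)\<^sup>2)) \<in> borel_measurable \<rho>" "(\<lambda>x. ennreal ((norm x)\<^sup>2)) \<in> borel_measurable \<nu>"
    by (rule borel_measurable_on[OF s(1)], simp, rule borel_measurable_on[OF s(2)], simp)
  have "(\<integral>\<^sup>+ (x, y). ennreal ((norm (x - y))\<^sup>2) \<partial>(\<rho> \<Otimes>\<^sub>M \<nu>)) \<le>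
      (\<integral>\<^sup>+ z. 2 * ennreal ((norm (fst z))\<^sup>2) + 2 * ennreal ((norm (snd z))\<^sup>2) \<partial>(\<rho> \<Otimes>\<^sub>M \<nu>))"
  proof (intro nn_integral_mono, clarify)
    fix x y :: "real^'a"
    have "(norm (x - y))\<^sup>2 \<le> (norm x + norm y)\<^sup>2" by (intro power_mono norm_triangle_ineq4) auto
    also have "\<dots> \<le> 2 * (norm x)\<^sup>2 + 2 * (norm y)\<^sup>2"
      using sum_squares_bound[of "norm x" "norm y"] by (simp add: power2_sum)
    finally have "ennreal ((norm (x - y))\<^sup>2) \<le> ennreal (2 * (norm x)\<^sup>2 + 2 * (norm y)\<^sup>2)"
      by (rule ennreal_leI)
    also have "\<dots> = 2 * ennreal ((norm x)\<^sup>2) + 2 * ennreal ((norm y)\<^sup>2)"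
      by (simp add: ennreal_plus ennreal_mult)
    finally show "ennreal ((norm (x - y))\<^sup>2) \<le>
      2 * ennreal ((norm (fst (x, y)))\<^sup>2) + 2 * ennreal ((norm (snd (x, y)))\<^sup>2)" by simp
  qed
  also have "\<dots> = 2 * (\<integral>\<^sup>+ z. ennreal ((norm (fst z))\<^sup>2) \<partial>(\<rho> \<Otimes>\<^sub>M \<nu>))
      + 2 * (\<integral>\<^sup>+ z. ennreal ((norm (snd z))\<^sup>2) \<partial>(\<rho> \<Otimes>\<^sub>M \<nu>))"
    using n by (subst nn_integral_add) (auto simp: nn_integral_cmult)
  also have "\<dots> = 2 * (\<integral>\<^sup>+ x. ennreal ((norm x)\<^sup>2) \<partial>\<rho>) + 2 * (\<integral>\<^sup>+ x. ennreal ((norm x)\<^sup>2) \<partial>\<nu>)"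
    using n by (simp add: \<nu>.nn_integral_fst[symmetric] \<rho>.emeasure_space_1 \<nu>.emeasure_space_1)
  also have "\<dots> < \<infinity>" using W by (auto simp: W2_def ennreal_mult_less_top)
  finally show "(\<integral>\<^sup>+ (x, y). ennreal ((norm (x - y))\<^sup>2) \<partial>(\<rho> \<Otimes>\<^sub>M \<nu>)) < \<infinity>" .
qed

lemma wass_dist_sq:
  assumes W: "\<rho> \<in> W2 \<Omega>" "\<nu> \<in> W2 \<Omega>"
  shows "ennreal ((wass_dist \<Omega> \<rho> \<nu>)\<^sup>2) =
    (INF \<gamma>\<in>couplings \<Omega> \<rho> \<nu>. \<integral>\<^sup>+ (x, y). ennreal ((norm (x - y))\<^sup>2) \<partial>\<gamma>)"
proof -
  have "(INF \<gamma>\<in>couplings \<Omega> \<rho> \<nu>. \<integral>\<^sup>+ (x, y). ennreal ((norm (x - y))\<^sup>2) \<partial>\<gamma>) < \<infinity>"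
    using INF_lower[OF product_coupling(1)[OF W]] product_coupling(2)[OF W] by (rule order.strict_trans1)
  then show ?thesis by (simp add: wass_dist_def)
qed

lemma dual_le_wass_dist_sq:
  assumes "\<rho> \<in> W2 \<Omega>" "\<nu> \<in> W2 \<Omega>"
    and "f \<in> borel_measurable borel" "quad_growth f" "g \<in> borel_measurable borel" "quad_growth g"
    and "\<And>x y. x \<in> \<Omega> \<Longrightarrow> y \<in> \<Omega> \<Longrightarrow> f x + g y \<le> (norm (x - y))\<^sup>2"
  shows "ennreal ((\<integral>x. f x \<partial>\<rho>) + (\<integral>y. g y \<partial>\<nu>)) \<le> ennreal ((wass_dist \<Omega> \<rho> \<nu>)\<^sup>2)"
  unfolding wass_dist_sq[OF assms(1,2)]
  by (intro INF_greatest dual_le_coupling_cost) (use assms in auto)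

lemma wass_dist_sq_distr_le:
  assumes m: "prob_space m" and [measurable]: "A \<in> m \<rightarrow>\<^sub>M borel_on \<Omega>" "B \<in> m \<rightarrow>\<^sub>M borel_on \<Omega>"
  shows "ennreal ((wass_dist \<Omega> (distr m (borel_on \<Omega>) A) (distr m (borel_on \<Omega>) B))\<^sup>2)
    \<le> (\<integral>\<^sup>+ x. ennreal ((norm (A x - B x))\<^sup>2) \<partial>m)"
proof -
  interpret prob_space m by fact
  define \<gamma> where "\<gamma> = distr m (borel_on \<Omega> \<Otimes>\<^sub>M borel_on \<Omega>) (\<lambda>x. (A x, B x))"
  have "\<gamma> \<in> couplings \<Omega> (distr m (borel_on \<Omega>) A) (distr m (borel_on \<Omega>) B)"
    by (auto simp: couplings_def \<gamma>_def distr_distr o_def intro!: prob_space_distr)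
  \<comment> \<open>If the infimum were infinite, \<open>enn2real\<close> would make the left side
    0, so the bound holds in either case.\<close>
  then have "ennreal ((wass_dist \<Omega> (distr m (borel_on \<Omega>) A) (distr m (borel_on \<Omega>) B))\<^sup>2)
    \<le> (\<integral>\<^sup>+ (x, y). ennreal ((norm (x - y))\<^sup>2) \<partial>\<gamma>)"
    unfolding wass_dist_def by (auto simp: ennreal_enn2real_if intro: INF_lower)
  also have "\<dots> = (\<integral>\<^sup>+ x. ennreal ((norm (A x - B x))\<^sup>2) \<partial>m)"
  proof -
    have [measurable]: "(\<lambda>x. x) \<in> borel_on \<Omega> \<rightarrow>\<^sub>M borel" by (simp add: measurable_restrict_space1)
    have "(\<lambda>z. fst z) \<in> borel_on \<Omega> \<Otimes>\<^sub>M borel_on \<Omega> \<rightarrow>\<^sub>M borel"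
      "(\<lambda>z. snd z) \<in> borel_on \<Omega> \<Otimes>\<^sub>M borel_on \<Omega> \<rightarrow>\<^sub>M borel"
      using measurable_compose[OF measurable_fst, of "\<lambda>x. x" "borel_on \<Omega>" borel "borel_on \<Omega>"]
        measurable_compose[OF measurable_snd, of "\<lambda>x. x" "borel_on \<Omega>" borel "borel_on \<Omega>"] by auto
    then have "(\<lambda>z. ennreal ((norm (fst z - snd z))\<^sup>2)) \<in> borel_measurable (borel_on \<Omega> \<Otimes>\<^sub>M borel_on \<Omega>)"
      by measurable
    then show ?thesis unfolding \<gamma>_def by (simp add: nn_integral_distr case_prod_beta)
  qed
  finally show ?thesis .
qed

section \<open>A countable family of dual pairs\<close>

text \<open>The maximum of the constants \<open>r\<close> over those listed sets \<open>U\<close>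
  that contain \<open>x\<close>, with a quadratic floor. The floor supplies the lower half of a
  dominating function; finite lists over a countable basis and the rationals leave only countably
  many such functions.\<close>

definition lower_envelope :: "nat \<Rightarrow> ((real^'n) set \<times> real) list \<Rightarrow> real^'n \<Rightarrow> real" where
  "lower_envelope C us x = foldr (\<lambda>(U, r) v. if x \<in> U then max r v else v) us (- (real C * (1 + (norm x)\<^sup>2)))"

lemma lower_envelope_Nil [simp]: "lower_envelope C [] x = - (real C * (1 + (norm x)\<^sup>2))"
  by (simp add: lower_envelope_def)

lemma lower_envelope_Cons [simp]:
  "lower_envelope C ((U, r) # us) x =
    (if x \<in> U then max r (lower_envelope C us x) else lower_envelope C us x)"
  by (simp add: lower_envelope_def)

lemma borel_measurable_lower_envelope:
  "(\<And>U r. (U, r) \<in> set us \<Longrightarrow> open U) \<Longrightarrow> lower_envelope C us \<in> borel_measurable borel"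
proof (induction us)
  case Nil
  have "(\<lambda>x::real^'a. - (real C * (1 + (norm x)\<^sup>2))) \<in> borel_measurable borel" by measurable
  then show ?case by (rule measurable_cong[THEN iffD1, rotated]) simp
next
  case (Cons u us)
  obtain U r where u: "u = (U, r)" by (cases u)
  have [measurable]: "lower_envelope C us \<in> borel_measurable borel" "U \<in> sets borel"
    using Cons u by (auto intro!: borel_open)
  have "(\<lambda>x. if x \<in> U then max r (lower_envelope C us x) else lower_envelope C us x) \<in> borel_measurable borel"
    by measurable
  then show ?case by (rule measurable_cong[THEN iffD1, rotated]) (simp add: u)
qed

lemma quad_growth_lower_envelope: "quad_growth (lower_envelope C us)"
proof (induction us)
  case Nil
  show ?case by (rule quad_growthI[where C="real C"]) simp
next
  case (Cons u us)
  obtain U r where u: "u = (U, r)" by (cases u)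
  have "quad_growth (\<lambda>x. \<bar>lower_envelope C us x\<bar>)" using Cons.IH by (simp add: quad_growth_def)
  then have "quad_growth (\<lambda>x. \<bar>r\<bar> + \<bar>lower_envelope C us x\<bar>)"
    by (intro quad_growth_add quad_growth_const)
  then show ?case by (rule quad_growth_mono) (auto simp: u)
qed

lemma lower_envelope_lower: "- (real C * (1 + (norm x)\<^sup>2)) \<le> lower_envelope C us x"
  by (induction us) auto

lemma lower_envelope_ge: "(U, r) \<in> set us \<Longrightarrow> x \<in> U \<Longrightarrow> r \<le> lower_envelope C us x"
  by (induction us) auto

lemma lower_envelope_le:
  "- (real C * (1 + (norm x)\<^sup>2)) \<le> c \<Longrightarrow> (\<forall>(U, r)\<in>set us. x \<in> U \<longrightarrow> r \<le> c)
    \<Longrightarrow> lower_envelope C us x \<le> c"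
  by (induction us) auto

text \<open>By continuity \<open>f x\<close> is the supremum of the rationals \<open>r\<close> that
  lie below \<open>f\<close> on some basic neighbourhood of \<open>x\<close>. The set
  \<open>J\<close> of these pairs is countable, and \<open>us n\<close> lists the first
  \<open>n\<close> terms of an enumeration.\<close>

lemma lower_envelope_tendsto:
  fixes f :: "real^'n \<Rightarrow> real"
  assumes B: "topological_basis B" "countable B"
    and f: "continuous_on UNIV f" and bd: "\<And>x. \<bar>f x\<bar> \<le> real C * (1 + (norm x)\<^sup>2)"
  obtains us where "\<And>n. us n \<in> lists (B \<times> \<rat>)"
    "\<And>n x. lower_envelope C (us n) x \<le> f x"
    "\<And>x. (\<lambda>n. lower_envelope C (us n) x) \<longlonglongrightarrow> f x"
proof -
  define J where "J = {(U, r). U \<in> B \<and> r \<in> \<rat> \<and> (\<forall>x\<in>U. r \<le> f x)}"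
  have "countable J"
    by (rule countable_subset[of _ "B \<times> \<rat>"]) (auto simp: J_def B countable_rat)
  have J: "\<exists>(U, r)\<in>J. x \<in> U \<and> f x - e < r" if "0 < e" for x e
  proof -
    obtain r where r: "r \<in> \<rat>" "f x - e < r" "r < f x" using Rats_dense_in_real[of "f x - e" "f x"] \<open>0 < e\<close> by auto
    have "open (f -` {r<..})" using f by (simp add: continuous_on_open_vimage)
    with r obtain U where "U \<in> B" "x \<in> U" "U \<subseteq> f -` {r<..}"
      using topological_basisE[OF B(1), of "f -` {r<..}" x] by auto
    with r have "(U, r) \<in> J" by (auto simp: J_def intro: less_imp_le)
    with r \<open>x \<in> U\<close> show ?thesis by blast
  qed
  then have "J \<noteq> {}" using zero_less_one by blast
  define us where "us n = map (from_nat_into J) [0..<n]" for n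
  have us: "set (us n) \<subseteq> J" for n using from_nat_into[OF \<open>J \<noteq> {}\<close>] by (auto simp: us_def)
  have le: "lower_envelope C (us n) x \<le> f x" for n x
    using bd[of x] us[of n] by (intro lower_envelope_le) (auto simp: J_def)
  have "(\<lambda>n. lower_envelope C (us n) x) \<longlonglongrightarrow> f x" for x
  proof (rule LIMSEQ_I)
    fix e :: real assume "0 < e"
    then obtain U r where Ur: "(U, r) \<in> J" "x \<in> U" "f x - e < r" using J[of e x] by blast
    then obtain k where k: "from_nat_into J k = (U, r)"
      using from_nat_into_surj[OF \<open>countable J\<close>] by blast
    have "norm (lower_envelope C (us n) x - f x) < e" if "n \<ge> Suc k" for n
    proof -
      have "k \<in> set [0..<n]" using that by auto
      then have "(U, r) \<in> set (us n)" unfolding us_def set_map k[symmetric] by (rule imageI)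
      from lower_envelope_ge[OF this Ur(2), of C] le[of n x] Ur(3) show ?thesis by auto
    qed
    then show "\<exists>no. \<forall>n\<ge>no. norm (lower_envelope C (us n) x - f x) < e" by blast
  qed
  moreover have "us n \<in> lists (B \<times> \<rat>)" for n using us[of n] by (auto simp: J_def)
  ultimately show ?thesis using that le by blast
qed

lemma tendsto_integral_W2:
  fixes h :: "nat \<Rightarrow> real^'n \<Rightarrow> real"
  assumes m: "m \<in> W2 \<Omega>" and h: "\<And>n. h n \<in> borel_measurable borel"
    and f: "f \<in> borel_measurable borel"
    and bd: "\<And>n x. \<bar>h n x\<bar> \<le> C * (1 + (norm x)\<^sup>2)"
    and lim: "\<And>x. (\<lambda>n. h n x) \<longlonglongrightarrow> f x"
  shows "(\<lambda>n. \<integral>x. h n x \<partial>m) \<longlonglongrightarrow> (\<integral>x. f x \<partial>m)"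
proof (rule integral_dominated_convergence)
  show "integrable m (\<lambda>x. C * (1 + (norm x)\<^sup>2))"
    by (intro W2_integrable[OF m] quad_growth_cmult quad_growth_add quad_growth_const quad_growth_norm_sq) measurable
qed (use assms in \<open>auto intro: borel_measurable_on[OF W2D(2)[OF m]]\<close>)

text \<open>Restricting the dual problem to countably many pairs makes its value a measurable function of
  the two measures.\<close>

definition dual_value :: "((real^'n \<Rightarrow> real) \<times> (real^'n \<Rightarrow> real)) set \<Rightarrow>
    (real^'n) measure \<Rightarrow> (real^'n) measure \<Rightarrow> ennreal" where
  "dual_value \<P> \<rho> \<nu> = (SUP (h, k)\<in>\<P>. ennreal ((\<integral>x. h x \<partial>\<rho>) + (\<integral>y. k y \<partial>\<nu>)))"

text \<open>Countability gives measurability of the dual value, admissibility keeps it below the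
  squared distance, and the last clause lets any continuous pair be used as if it were a
  member.\<close>

definition dual_family :: "((real^'n \<Rightarrow> real) \<times> (real^'n \<Rightarrow> real)) set \<Rightarrow> bool" where
  "dual_family \<P> \<longleftrightarrow> countable \<P> \<and>
    (\<forall>(h, k)\<in>\<P>. h \<in> borel_measurable borel \<and> quad_growth h \<and>
      k \<in> borel_measurable borel \<and> quad_growth k \<and> (\<forall>x y. h x + k y \<le> (norm (x - y))\<^sup>2)) \<and>
    (\<forall>\<Omega>. \<forall>\<rho>\<in>W2 \<Omega>. \<forall>\<nu>\<in>W2 \<Omega>. \<forall>f g. continuous_on UNIV f \<longrightarrow> quad_growth f \<longrightarrow>
      continuous_on UNIV g \<longrightarrow> quad_growth g \<longrightarrow> (\<forall>x y. f x + g y \<le> (norm (x - y))\<^sup>2) \<longrightarrow>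
      ennreal ((\<integral>x. f x \<partial>\<rho>) + (\<integral>y. g y \<partial>\<nu>)) \<le> dual_value \<P> \<rho> \<nu>)"

text \<open>The family consists of all admissible pairs of lower envelopes. A continuous admissible
  pair is reached by envelopes converging from below, and dominated convergence under both measures
  carries the bound to the limit.\<close>

lemma dual_family_exists: "\<exists>\<P> :: ((real^'n \<Rightarrow> real) \<times> (real^'n \<Rightarrow> real)) set. dual_family \<P>"
proof -
  obtain B :: "(real^'n) set set" where B: "countable B" "topological_basis B" using ex_countable_basis by blast
  define \<H> where "\<H> = (\<lambda>(C, us). lower_envelope C us) ` (UNIV \<times> lists (B \<times> \<rat>))"
  have "countable \<H>"
    unfolding \<H>_def using B(1) countable_rat by (intro countable_image countable_SIGMA countable_lists) auto
  have \<H>: "h \<in> borel_measurable borel" "quad_growth h" if "h \<in> \<H>" for h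
    using that topological_basis_open[OF B(2)]
    by (auto simp: \<H>_def quad_growth_lower_envelope intro!: borel_measurable_lower_envelope)
  have approx: "\<exists>h C. \<forall>n. h n \<in> \<H> \<and> (\<forall>x. h n x \<le> f x \<and> \<bar>h n x\<bar> \<le> C * (1 + (norm x)\<^sup>2)) \<and>
      (\<forall>x. (\<lambda>n. h n x) \<longlonglongrightarrow> f x)"
    if f: "continuous_on UNIV f" "quad_growth f" for f :: "real^'n \<Rightarrow> real"
  proof -
    obtain C' where C': "\<And>x. \<bar>f x\<bar> \<le> C' * (1 + (norm x)\<^sup>2)" using f(2) by (auto simp: quad_growth_def)
    \<comment> \<open>The growth constant is rounded up to a natural number because the floors of
      the envelopes must form a countable set.\<close>
    obtain C :: nat where "C' \<le> real C" using real_arch_simple by blast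
    then have C: "\<bar>f x\<bar> \<le> real C * (1 + (norm x)\<^sup>2)" for x
      by (intro order_trans[OF C'] mult_right_mono) auto
    obtain us where us: "\<And>n. us n \<in> lists (B \<times> \<rat>)"
      "\<And>n x. lower_envelope C (us n) x \<le> f x"
      "\<And>x. (\<lambda>n. lower_envelope C (us n) x) \<longlonglongrightarrow> f x"
      using lower_envelope_tendsto[OF B(2,1) f(1) C] by metis
    have "\<bar>lower_envelope C (us n) x\<bar> \<le> real C * (1 + (norm x)\<^sup>2)" for n x
      using us(2)[of n x] lower_envelope_lower[of C x "us n"] C[of x] by linarith
    moreover have "lower_envelope C (us n) \<in> \<H>" for n
      using us(1)[of n] by (force simp: \<H>_def)
    ultimately show ?thesis using us(2,3) by (intro exI[of _ "\<lambda>n. lower_envelope C (us n)"] exI[of _ "real C"]) simp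
  qed
  define \<P> where "\<P> = {(h, k). h \<in> \<H> \<and> k \<in> \<H> \<and> (\<forall>x y. h x + k y \<le> (norm (x - y))\<^sup>2)}"
  have "countable \<P>"
    by (rule countable_subset[of _ "\<H> \<times> \<H>"]) (auto simp: \<P>_def \<open>countable \<H>\<close>)
  moreover have "h \<in> borel_measurable borel \<and> quad_growth h \<and>
      k \<in> borel_measurable borel \<and> quad_growth k \<and> (\<forall>x y. h x + k y \<le> (norm (x - y))\<^sup>2)"
    if "(h, k) \<in> \<P>" for h k
    using that \<H> by (auto simp: \<P>_def)
  moreover have "ennreal ((\<integral>x. f x \<partial>\<rho>) + (\<integral>y. g y \<partial>\<nu>)) \<le> dual_value \<P> \<rho> \<nu>"
    if W: "\<rho> \<in> W2 \<Omega>" "\<nu> \<in> W2 \<Omega>" and f: "continuous_on UNIV f" "quad_growth f"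
      and g: "continuous_on UNIV g" "quad_growth g" and le: "\<forall>x y. f x + g y \<le> (norm (x - y))\<^sup>2"
    for \<Omega> :: "(real^'n) set" and \<rho> \<nu> and f g :: "real^'n \<Rightarrow> real"
  proof -
    obtain h C where h: "\<And>n. h n \<in> \<H>" "\<And>n x. h n x \<le> f x" "\<And>n x. \<bar>h n x\<bar> \<le> C * (1 + (norm x)\<^sup>2)"
      "\<And>x. (\<lambda>n. h n x) \<longlonglongrightarrow> f x" using approx[OF f] by metis
    obtain k D where k: "\<And>n. k n \<in> \<H>" "\<And>n x. k n x \<le> g x" "\<And>n x. \<bar>k n x\<bar> \<le> D * (1 + (norm x)\<^sup>2)"
      "\<And>x. (\<lambda>n. k n x) \<longlonglongrightarrow> g x" using approx[OF g] by metis
    have "(\<lambda>n. ennreal ((\<integral>x. h n x \<partial>\<rho>) + (\<integral>y. k n y \<partial>\<nu>))) \<longlonglongrightarrow> ennreal ((\<integral>x. f x \<partial>\<rho>) + (\<integral>y. g y \<partial>\<nu>))"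
      by (intro tendsto_ennrealI tendsto_add tendsto_integral_W2[OF W(1) _ _ h(3,4)]
          tendsto_integral_W2[OF W(2) _ _ k(3,4)] \<H> h k borel_measurable_continuous_onI f g)
    then show ?thesis
    proof (rule LIMSEQ_le_const2)
      \<comment> \<open>Approximation from below is what preserves the constraint.\<close>
      have "(h n, k n) \<in> \<P>" for n
        using h(1) k(1) order_trans[OF add_mono[OF h(2) k(2)] le[rule_format]] by (auto simp: \<P>_def)
      then show "\<exists>N. \<forall>n\<ge>N. ennreal ((\<integral>x. h n x \<partial>\<rho>) + (\<integral>y. k n y \<partial>\<nu>)) \<le> dual_value \<P> \<rho> \<nu>"
        unfolding dual_value_def by (fastforce intro: SUP_upper2)
    qed
  qed
  ultimately have "dual_family \<P>" unfolding dual_family_def by blast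
  then show ?thesis ..
qed

section \<open>The Borel structure of the Wasserstein space\<close>

lemma space_W2_borel [simp]: "space (W2_borel \<Omega>) = W2 \<Omega>"
  unfolding W2_borel_def by (intro space_measure_of) (auto simp: W2_open_def)

lemma W2_open_in_W2_borel: "W2_open \<Omega> U \<Longrightarrow> U \<in> sets (W2_borel \<Omega>)"
  unfolding W2_borel_def by (subst sets_measure_of) (auto simp: W2_open_def)

text \<open>Weak duality controls the integral of \<open>f\<close> near \<open>m\<close>: by Young's
  inequality the functions \<open>t * f x - t\<^sup>2 * K\<^sup>2 / 4\<close> and
  \<open>- t * f y\<close> form an admissible pair.\<close>

lemma W2_open_lipschitz_integral_gt:
  fixes f :: "real^'n \<Rightarrow> real"
  assumes lip: "\<And>x y. \<bar>f x - f y\<bar> \<le> K * norm (x - y)" and bd: "\<And>x. \<bar>f x\<bar> \<le> 1" and "0 < K"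
  shows "W2_open \<Omega> {m \<in> W2 \<Omega>. c < (\<integral>x. f x \<partial>m)}"
  unfolding W2_open_def
proof (intro conjI ballI)
  fix m assume "m \<in> {m \<in> W2 \<Omega>. c < (\<integral>x. f x \<partial>m)}"
  then have m: "m \<in> W2 \<Omega>" and "c < (\<integral>x. f x \<partial>m)" by auto
  define \<delta> where "\<delta> = (\<integral>x. f x \<partial>m) - c"
  \<comment> \<open>With this \<open>t\<close>, both the squared radius
    \<open>(\<delta> / K)\<^sup>2\<close> and the Young remainder
    \<open>t\<^sup>2 * K\<^sup>2 / 4\<close> equal \<open>t * \<delta> / 2\<close>, so together they
    amount to \<open>t * \<delta>\<close>.\<close>
  define t where "t = 2 * \<delta> / K\<^sup>2"
  have "0 < \<delta>" "0 < t" using \<open>c < _\<close> \<open>0 < K\<close> by (auto simp: \<delta>_def t_def)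
  have "K-lipschitz_on UNIV f" using lip \<open>0 < K\<close> by (auto simp: lipschitz_on_def dist_norm)
  then have "continuous_on UNIV f" by (rule lipschitz_on_continuous_on)
  then have [measurable]: "f \<in> borel_measurable borel" by (rule borel_measurable_continuous_onI)
  have qf: "quad_growth f" by (rule quad_growth_mono[OF quad_growth_const[of 1] bd])
  show "\<exists>r>0. \<forall>\<nu>\<in>W2 \<Omega>. wass_dist \<Omega> m \<nu> < r \<longrightarrow> \<nu> \<in> {m \<in> W2 \<Omega>. c < (\<integral>x. f x \<partial>m)}"
  proof (intro exI[of _ "\<delta> / K"] conjI ballI impI)
    show "0 < \<delta> / K" using \<open>0 < \<delta>\<close> \<open>0 < K\<close> by simp
    fix \<nu> assume \<nu>: "\<nu> \<in> W2 \<Omega>" and near: "wass_dist \<Omega> m \<nu> < \<delta> / K"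
    interpret m: prob_space m by (rule W2D[OF m])
    have "t * f x + - (t\<^sup>2 * K\<^sup>2 / 4) + - t * f y \<le> (norm (x - y))\<^sup>2" for x y
    proof -
      have "t * (f x - f y) \<le> t * (K * norm (x - y))"
        using \<open>0 < t\<close> lip[of x y] by (intro mult_left_mono) auto
      moreover have "t * (K * norm (x - y)) \<le> (norm (x - y))\<^sup>2 + t\<^sup>2 * K\<^sup>2 / 4"
        using zero_le_power2[of "norm (x - y) - t * K / 2"]
        by (simp add: power2_diff power_mult_distrib power_divide algebra_simps)
      ultimately show ?thesis by (simp add: algebra_simps)
    qed
    then have "ennreal ((\<integral>x. t * f x + - (t\<^sup>2 * K\<^sup>2 / 4) \<partial>m) + (\<integral>y. - t * f y \<partial>\<nu>)) \<le> ennreal ((wass_dist \<Omega> m \<nu>)\<^sup>2)"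
      by (intro dual_le_wass_dist_sq m \<nu> quad_growth_add quad_growth_cmult quad_growth_const qf) auto
    then have "(\<integral>x. t * f x + - (t\<^sup>2 * K\<^sup>2 / 4) \<partial>m) + (\<integral>y. - t * f y \<partial>\<nu>) \<le> (wass_dist \<Omega> m \<nu>)\<^sup>2"
      by (subst (asm) ennreal_le_iff) auto
    also have "(\<integral>x. t * f x + - (t\<^sup>2 * K\<^sup>2 / 4) \<partial>m) = t * (\<integral>x. f x \<partial>m) - t\<^sup>2 * K\<^sup>2 / 4"
      using W2_integrable[OF m _ qf] by (simp add: m.prob_space)
    also have "(wass_dist \<Omega> m \<nu>)\<^sup>2 < (\<delta> / K)\<^sup>2"
      using near by (intro power_strict_mono) (auto simp: wass_dist_def)
    also have "\<dots> = t * (\<delta> / 2)" using \<open>0 < K\<close> by (simp add: t_def power2_eq_square)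
    finally have "t * (\<integral>x. f x \<partial>m) - t\<^sup>2 * K\<^sup>2 / 4 - t * (\<integral>x. f x \<partial>\<nu>) < t * (\<delta> / 2)" by simp
    moreover have "t\<^sup>2 * K\<^sup>2 / 4 = t * (\<delta> / 2)" using \<open>0 < K\<close> by (simp add: t_def power2_eq_square)
    ultimately have "t * ((\<integral>x. f x \<partial>m) - (\<integral>x. f x \<partial>\<nu>)) < t * \<delta>" by (simp add: algebra_simps)
    then have "(\<integral>x. f x \<partial>m) - (\<integral>x. f x \<partial>\<nu>) < \<delta>" using \<open>0 < t\<close> by simp
    then show "\<nu> \<in> {m \<in> W2 \<Omega>. c < (\<integral>x. f x \<partial>m)}" using \<nu> by (simp add: \<delta>_def)
  qed
qed auto

text \<open>The whole space is excluded since \<open>infdist\<close> to the empty set is 0 by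
  convention. \<open>Suc n\<close> keeps the Lipschitz constants of the approximants
  positive.\<close>

lemma open_indicator_eq_SUP_infdist:
  fixes U :: "'a::metric_space set"
  assumes "open U" "U \<noteq> UNIV"
  shows "(SUP n. ennreal (min 1 (real (Suc n) * infdist x (- U)))) = indicator U x"
proof (cases "x \<in> U")
  case True
  with assms have pos: "0 < infdist x (- U)"
    by (metis ComplD closed_Compl in_closed_iff_infdist_zero infdist_nonneg Compl_empty_eq
        double_complement less_le)
  obtain n where n: "1 / infdist x (- U) \<le> real n" using real_arch_simple by blast
  have "1 \<le> real (Suc n) * infdist x (- U)"
  proof -
    have "1 \<le> real n * infdist x (- U)" using n pos by (simp add: field_simps)
    then show ?thesis using pos by (simp add: distrib_right)
  qed
  then have "1 \<le> (SUP n. ennreal (min 1 (real (Suc n) * infdist x (- U))))"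
    by (intro SUP_upper2[of n]) auto
  moreover have "(SUP n. ennreal (min 1 (real (Suc n) * infdist x (- U)))) \<le> 1"
    by (intro SUP_least) (auto simp: ennreal_le_1)
  ultimately show ?thesis using True by simp
next
  case False
  then show ?thesis by simp
qed

text \<open>The mass of an open set is the increasing limit of integrals of bounded Lipschitz
  functions, whose strict superlevel sets are Wasserstein open.\<close>

lemma emeasure_open_measurable_W2_borel:
  fixes U :: "(real^'n) set"
  assumes "open U"
  shows "(\<lambda>m. emeasure m (U \<inter> \<Omega>)) \<in> borel_measurable (W2_borel \<Omega>)"
proof (cases "U = UNIV")
  case True
  have "emeasure m (U \<inter> \<Omega>) = 1" if "m \<in> W2 \<Omega>" for m
    using prob_space.emeasure_space_1[OF W2D(1)[OF that]] W2D(3)[OF that] True by simp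
  then show ?thesis
    by (subst measurable_cong[where g="\<lambda>_. 1"]) auto
next
  case False
  define f where "f n x = min 1 (real (Suc n) * infdist x (- U))" for n x
  have f0: "0 \<le> f n x" "f n x \<le> 1" for n x by (auto simp: f_def infdist_nonneg)
  have lip: "\<bar>f n x - f n y\<bar> \<le> real (Suc n) * norm (x - y)" for n x y
  proof -
    have "\<bar>infdist x (- U) - infdist y (- U)\<bar> \<le> norm (x - y)"
      using infdist_triangle_abs[of x "- U" y] by (simp add: dist_norm)
    then have "\<bar>real (Suc n) * infdist x (- U) - real (Suc n) * infdist y (- U)\<bar> \<le> real (Suc n) * norm (x - y)"
      unfolding right_diff_distrib[symmetric] abs_mult by (intro mult_mono) auto
    then show ?thesis unfolding f_def by linarith
  qed
  have meas: "f n \<in> borel_measurable borel" for n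
    unfolding f_def[abs_def]
    by (intro borel_measurable_continuous_onI continuous_intros)
  have "{m \<in> space (W2_borel \<Omega>). c < (\<integral>x. f n x \<partial>m)} \<in> sets (W2_borel \<Omega>)" for n c
    using W2_open_in_W2_borel[OF W2_open_lipschitz_integral_gt[OF lip]] f0 by simp
  then have [measurable]: "(\<lambda>m. \<integral>x. f n x \<partial>m) \<in> borel_measurable (W2_borel \<Omega>)" for n
    by (simp add: borel_measurable_iff_greater)
  have "emeasure m (U \<inter> \<Omega>) = (SUP n. ennreal (\<integral>x. f n x \<partial>m))" if m: "m \<in> W2 \<Omega>" for m
  proof -
    have mm: "f n \<in> borel_measurable m" for n by (rule borel_measurable_on[OF W2D(2)[OF m] meas])
    have "integrable m (f n)" for n
      by (intro W2_integrable[OF m meas] quad_growth_mono[OF quad_growth_const[of 1]]) (use f0 in auto)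
    then have "(SUP n. ennreal (\<integral>x. f n x \<partial>m)) = (SUP n. \<integral>\<^sup>+x. ennreal (f n x) \<partial>m)"
      using f0 by (simp add: nn_integral_eq_integral)
    also have "\<dots> = (\<integral>\<^sup>+x. (SUP n. ennreal (f n x)) \<partial>m)"
    proof (rule nn_integral_monotone_convergence_SUP[symmetric])
      show "incseq (\<lambda>n x. ennreal (f n x))"
        unfolding f_def incseq_def le_fun_def
        by (intro allI impI ennreal_leI min.mono mult_right_mono) (auto simp: infdist_nonneg)
    qed (use mm in measurable)
    also have "\<dots> = (\<integral>\<^sup>+x. indicator (U \<inter> \<Omega>) x \<partial>m)"
      unfolding f_def open_indicator_eq_SUP_infdist[OF assms False]
      by (intro nn_integral_cong) (auto simp: indicator_def W2D(3)[OF m])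
    also have "\<dots> = emeasure m (U \<inter> \<Omega>)"
      using assms by (intro nn_integral_indicator) (auto simp: W2D(2)[OF m] sets_restrict_space)
    finally show ?thesis by simp
  qed
  then show ?thesis
    by (subst measurable_cong[where g="\<lambda>m. SUP n. ennreal (\<integral>x. f n x \<partial>m)"]) (simp_all, measurable)
qed

text \<open>Turns a random measure into a kernel, so that integrals against it are measurable and
  can be iterated. The open sets generate the Borel sets and are stable under intersection; the
  detour through the image on the whole space makes this generator available even if
  \<open>\<Omega>\<close> is not Borel.\<close>

lemma measurable_W2_borel_subprob_algebra:
  "(\<lambda>m. m) \<in> W2_borel \<Omega> \<rightarrow>\<^sub>M subprob_algebra (borel_on \<Omega>)"
proof (rule measurable_subprob_algebra)
  have d: "(\<lambda>m. distr m borel (\<lambda>x. x)) \<in> W2_borel \<Omega> \<rightarrow>\<^sub>M subprob_algebra borel"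
  proof (rule measurable_subprob_algebra_generated[where \<Omega>=UNIV and G="{S. open S}"])
    fix m assume m: "m \<in> space (W2_borel \<Omega>)"
    then have W: "m \<in> W2 \<Omega>" by simp
    interpret prob_space m by (rule W2D[OF W])
    have "prob_space (distr m borel (\<lambda>x. x))"
      by (rule prob_space_distr, rule borel_measurable_on[OF W2D(2)[OF W]]) simp
    then show "subprob_space (distr m borel (\<lambda>x. x))" by (rule prob_space_imp_subprob_space)
  next
    have eq: "emeasure (distr m borel (\<lambda>x. x)) A = emeasure m (A \<inter> \<Omega>)"
      if "m \<in> space (W2_borel \<Omega>)" "open A" for m A
      using that W2D(3)[of m \<Omega>] borel_measurable_on[OF W2D(2), of m \<Omega> "\<lambda>x. x"]
      by (subst emeasure_distr) auto
    show "(\<lambda>m. emeasure (distr m borel (\<lambda>x. x)) A) \<in> borel_measurable (W2_borel \<Omega>)"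
      if "A \<in> {S. open S}" for A
      using that emeasure_open_measurable_W2_borel[of A \<Omega>]
      by (subst measurable_cong[OF eq]) auto
    from this[of UNIV] show "(\<lambda>m. emeasure (distr m borel (\<lambda>x. x)) UNIV) \<in> borel_measurable (W2_borel \<Omega>)"
      by simp
  qed (auto simp: sets_borel Int_stable_def)
  fix A assume "A \<in> sets (borel_on \<Omega>)"
  then obtain B where B: "B \<in> sets borel" "A = B \<inter> \<Omega>" by (auto simp: sets_restrict_space)
  have "emeasure (distr m borel (\<lambda>x. x)) B = emeasure m A" if "m \<in> space (W2_borel \<Omega>)" for m
    using that W2D(3)[of m \<Omega>] borel_measurable_on[OF W2D(2), of m \<Omega> "\<lambda>x. x"] B
    by (subst emeasure_distr) auto
  then show "(\<lambda>m. emeasure m A) \<in> borel_measurable (W2_borel \<Omega>)"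
    using measurable_compose[OF d measurable_emeasure_subprob_algebra[OF B(1)]]
    by (rule measurable_cong[THEN iffD1])
qed (simp_all add: W2D prob_space_imp_subprob_space)

section \<open>Regression maps\<close>

lemma GDERIV_unique:
  assumes "GDERIV f x :> a" "GDERIV f x :> b" shows "a = b"
proof -
  have "(\<lambda>h. h \<bullet> a) = (\<lambda>h. h \<bullet> b)"
    using assms unfolding gderiv_def by (rule has_derivative_unique)
  then show ?thesis by (metis vector_eq_ldot)
qed

lemma reg_mapsE:
  assumes "T \<in> reg_maps L \<Omega>"
  obtains \<phi> G S \<alpha> where "convex_potential \<phi> G S \<alpha> L" "\<And>x. x \<in> \<Omega> \<Longrightarrow> T x = G x"
proof -
  obtain \<phi> where \<phi>: "\<phi> \<in> Phi L" "\<forall>x\<in>\<Omega>. GDERIV \<phi> x :> T x" using assms by (auto simp: reg_maps_def)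
  obtain G S \<alpha> where P: "convex_potential \<phi> G S \<alpha> L" using Phi_imp_convex_potential[OF \<phi>(1)] .
  then show ?thesis using \<phi>(2) by (intro that[OF P]) (auto intro: GDERIV_unique convex_potential.grad)
qed

lemma reg_maps_continuous:
  assumes "T \<in> reg_maps L \<Omega>"
  shows "continuous_on \<Omega> T"
proof -
  obtain \<phi> G S \<alpha> where P: "convex_potential \<phi> G S \<alpha> L" "\<And>x. x \<in> \<Omega> \<Longrightarrow> T x = G x"
    using reg_mapsE[OF assms] by blast
  have "continuous_on \<Omega> G"
    using convex_potential.continuous_G[OF P(1)] by (rule continuous_on_subset) auto
  then show ?thesis using P(2) by (simp cong: continuous_on_cong)
qed

lemma reg_maps_measurable:
  assumes "T \<in> reg_maps L \<Omega>" "sets m = sets (borel_on \<Omega>)"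
  shows "T \<in> m \<rightarrow>\<^sub>M borel_on \<Omega>"
  unfolding measurable_on_cong[OF assms(2)] using assms(1) reg_maps_continuous[OF assms(1)]
  by (intro measurable_restrict_space2 borel_measurable_continuous_on_restrict)
    (auto simp: reg_maps_def space_restrict_space)

lemma borel_measurable_compose_on:
  assumes "A \<in> m \<rightarrow>\<^sub>M borel_on \<Omega>" "f \<in> borel_measurable borel"
  shows "(\<lambda>x. f (A x)) \<in> borel_measurable m"
  using assms(1) borel_measurable_on[OF refl assms(2)] by (rule measurable_compose)

lemma integral_pushforward:
  fixes f :: "real^'n \<Rightarrow> real"
  assumes "A \<in> m \<rightarrow>\<^sub>M borel_on \<Omega>" "f \<in> borel_measurable borel"
  shows "(\<integral>x. f x \<partial>pushforward \<Omega> A m) = (\<integral>x. f (A x) \<partial>m)"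
  unfolding pushforward_def using assms by (simp add: integral_distr borel_measurable_on)

lemma integrable_pushforward:
  fixes f :: "real^'n \<Rightarrow> real"
  assumes A: "A \<in> m \<rightarrow>\<^sub>M borel_on \<Omega>" and W: "pushforward \<Omega> A m \<in> W2 \<Omega>"
    and f: "f \<in> borel_measurable borel" "quad_growth f"
  shows "integrable m (\<lambda>x. f (A x))"
  using W2_integrable[OF W f] A borel_measurable_on[OF refl f(1)]
  unfolding pushforward_def by (simp add: integrable_distr_eq)

lemma pushforward_W2:
  fixes m :: "(real^'n) measure"
  assumes m: "m \<in> W2 \<Omega>" and T: "T \<in> reg_maps L \<Omega>"
  shows "pushforward \<Omega> T m \<in> W2 \<Omega>"
proof -
  interpret prob_space m by (rule W2D[OF m])
  obtain \<phi> G S \<alpha> where P: "convex_potential \<phi> G S \<alpha> L" and G: "\<And>x. x \<in> \<Omega> \<Longrightarrow> T x = G x"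
    using reg_mapsE[OF T] by blast
  interpret convex_potential \<phi> G S \<alpha> L by (rule P)
  note meas = reg_maps_measurable[OF T W2D(2)[OF m]]
  have "(\<lambda>x. (norm (G x))\<^sup>2) \<in> borel_measurable borel"
    using continuous_G by (intro borel_measurable_continuous_onI continuous_intros)
  then have "integrable m (\<lambda>x. (norm (G x))\<^sup>2)"
    using quad_growth_G by (rule W2_integrable[OF m])
  then have "(\<integral>\<^sup>+ x. ennreal ((norm (G x))\<^sup>2) \<partial>m) < \<infinity>"
    by (simp add: nn_integral_eq_integral)
  also have "(\<integral>\<^sup>+ x. ennreal ((norm (G x))\<^sup>2) \<partial>m) = (\<integral>\<^sup>+ x. ennreal ((norm (T x))\<^sup>2) \<partial>m)"
    by (intro nn_integral_cong) (simp add: G W2D(3)[OF m])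
  also have "\<dots> = (\<integral>\<^sup>+ x. ennreal ((norm x)\<^sup>2) \<partial>pushforward \<Omega> T m)"
  proof -
    have "(\<lambda>x::real^'n. ennreal ((norm x)\<^sup>2)) \<in> borel_measurable (borel_on \<Omega>)"
      by (rule measurable_restrict_space1) measurable
    then show ?thesis unfolding pushforward_def by (simp add: nn_integral_distr[OF meas])
  qed
  finally show ?thesis
    using prob_space_distr[OF meas] by (simp add: W2_def pushforward_def)
qed

text \<open>With \<open>z = S y\<close>, the unperturbed pair leaves the slack
  \<open>\<alpha> * (norm (x - z))\<^sup>2\<close>, twice the Fenchel--Young surplus. Half of it
  pays the quadratic error of \<open>t * b\<close>, hence \<open>t * K \<le> \<alpha> / 2\<close>;
  the other half pays the linear error by Young's inequality. The gain is of first order in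
  \<open>t\<close>, the loss of second order. The value is exact because Fenchel--Young is an
  equality at \<open>y = G z\<close>.\<close>

lemma (in convex_potential) dual_pair:
  assumes \<rho>: "\<rho> \<in> W2 \<Omega>" and \<sigma>: "\<sigma> \<in> W2 \<Omega>" and T: "T \<in> reg_maps L \<Omega>" "\<And>x. x \<in> \<Omega> \<Longrightarrow> T x = G x"
    and b: "continuous_on UNIV b" "quad_growth b"
    and w: "continuous_on UNIV w" "quad_growth (\<lambda>x. (norm (w x))\<^sup>2)"
    and bw: "\<And>x z. b x \<le> b z + w z \<bullet> (x - z) + K * (norm (x - z))\<^sup>2"
    and t: "0 \<le> t" "t * K \<le> \<alpha> / 2"
  obtains f g where "continuous_on UNIV f" "quad_growth f" "continuous_on UNIV g" "quad_growth g"
    "\<And>x y. f x + g y \<le> (norm (x - y))\<^sup>2"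
    "(\<integral>x. f x \<partial>\<rho>) + (\<integral>y. g y \<partial>pushforward \<Omega> T \<sigma>) =
      (\<integral>x. (norm x)\<^sup>2 - 2 * \<phi> x \<partial>\<rho>) - (\<integral>x. (norm x)\<^sup>2 - 2 * \<phi> x \<partial>\<sigma>) + (\<integral>z. (norm (T z - z))\<^sup>2 \<partial>\<sigma>)
      + t * ((\<integral>x. b x \<partial>\<rho>) - (\<integral>x. b x \<partial>\<sigma>)) - t\<^sup>2 / (2 * \<alpha>) * (\<integral>x. (norm (w x))\<^sup>2 \<partial>\<sigma>)"
proof -
  define u where "u x = (norm x)\<^sup>2 - 2 * \<phi> x" for x
  \<comment> \<open>What the second function of the pair must give back at \<open>z = S y\<close>:
    the perturbation itself and the Young remainder.\<close>
  define v where "v z = t * b z + t\<^sup>2 / (2 * \<alpha>) * (norm (w z))\<^sup>2" for z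
  define f where "f x = u x + t * b x" for x
  define g where "g y = (norm y)\<^sup>2 - 2 * legendre y - v (S y)" for y
  have cu: "continuous_on UNIV u" unfolding u_def by (intro continuous_intros continuous_\<phi>)
  have cv: "continuous_on UNIV v" unfolding v_def by (intro continuous_intros b w)
  have cf: "continuous_on UNIV f" unfolding f_def by (intro continuous_intros cu b)
  have cg: "continuous_on UNIV g"
    unfolding g_def
    by (intro continuous_intros continuous_legendre continuous_on_compose2[OF cv continuous_S]) auto
  have qu: "quad_growth u"
    unfolding u_def[abs_def] by (intro quad_growth_diff quad_growth_cmult quad_growth_\<phi> quad_growth_norm_sq)
  have qv: "quad_growth v"
    unfolding v_def[abs_def] by (intro quad_growth_add quad_growth_cmult b w)
  have qf: "quad_growth f" unfolding f_def[abs_def] by (intro quad_growth_add quad_growth_cmult qu b)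
  have qg: "quad_growth g"
    unfolding g_def[abs_def]
    by (intro quad_growth_diff quad_growth_cmult quad_growth_legendre quad_growth_norm_sq
        quad_growth_compose[OF qv quad_growth_S])
  have le: "f x + g y \<le> (norm (x - y))\<^sup>2" for x y
  proof -
    define z where "z = S y"
    have "t * (b x - b z) \<le> t * (w z \<bullet> (x - z) + K * (norm (x - z))\<^sup>2)"
      using bw[of x z] t(1) by (intro mult_left_mono) auto
    also have "\<dots> = t * (w z \<bullet> (x - z)) + t * K * (norm (x - z))\<^sup>2" by (simp add: algebra_simps)
    also have "t * K * (norm (x - z))\<^sup>2 \<le> \<alpha> / 2 * (norm (x - z))\<^sup>2"
      using t(2) by (intro mult_right_mono) auto
    finally have 1: "t * (b x - b z) \<le> t * (w z \<bullet> (x - z)) + \<alpha> / 2 * (norm (x - z))\<^sup>2" by simp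
    \<comment> \<open>Young's inequality for \<open>t * (w z \<bullet> (x - z))\<close>, weighted so
      that exactly the second half of the slack is spent.\<close>
    have "0 \<le> (norm (\<alpha> *\<^sub>R (x - z) - t *\<^sub>R w z))\<^sup>2" by simp
    also have "\<dots> = \<alpha>\<^sup>2 * (norm (x - z))\<^sup>2 - 2 * \<alpha> * t * (w z \<bullet> (x - z)) + t\<^sup>2 * (norm (w z))\<^sup>2"
      unfolding power2_norm_eq_inner
      by (simp add: inner_diff_left inner_diff_right inner_commute power2_eq_square algebra_simps)
    finally have "t * (w z \<bullet> (x - z)) \<le> \<alpha> / 2 * (norm (x - z))\<^sup>2 + t\<^sup>2 / (2 * \<alpha>) * (norm (w z))\<^sup>2"
      using \<alpha>_pos by (simp add: field_simps power2_eq_square)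
    with 1 have "t * b x - v z \<le> \<alpha> * (norm (x - z))\<^sup>2" by (simp add: v_def algebra_simps)
    moreover have "(norm (x - y))\<^sup>2 = (norm x)\<^sup>2 + (norm y)\<^sup>2 - 2 * (x \<bullet> y)"
      unfolding power2_norm_eq_inner by (simp add: inner_diff_left inner_diff_right inner_commute)
    ultimately show ?thesis
      using fenchel_young[of x y] by (simp add: f_def g_def u_def z_def)
  qed
  have bm: "u \<in> borel_measurable borel" "v \<in> borel_measurable borel" "f \<in> borel_measurable borel"
      "g \<in> borel_measurable borel" "b \<in> borel_measurable borel"
    using cu cv cf cg b(1) by (simp_all add: borel_measurable_continuous_onI)
  have "(\<integral>y. g y \<partial>pushforward \<Omega> T \<sigma>) = (\<integral>z. g (T z) \<partial>\<sigma>)"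
    by (rule integral_pushforward[OF reg_maps_measurable[OF T(1) W2D(2)[OF \<sigma>]] bm(4)])
  also have "\<dots> = (\<integral>z. (norm (G z - z))\<^sup>2 - u z - v z \<partial>\<sigma>)"
  proof (rule Bochner_Integration.integral_cong[OF refl])
    fix z assume "z \<in> space \<sigma>"
    then have "T z = G z" using T(2) W2D(3)[OF \<sigma>] by simp
    moreover have "(norm (G z - z))\<^sup>2 = (norm (G z))\<^sup>2 + (norm z)\<^sup>2 - 2 * (G z \<bullet> z)"
      unfolding power2_norm_eq_inner by (simp add: inner_diff_left inner_diff_right inner_commute)
    ultimately show "g (T z) = (norm (G z - z))\<^sup>2 - u z - v z"
      by (simp add: g_def u_def legendre_G)
  qed
  also have "\<dots> = (\<integral>z. (norm (G z - z))\<^sup>2 \<partial>\<sigma>) - (\<integral>z. u z \<partial>\<sigma>) - (\<integral>z. v z \<partial>\<sigma>)"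
  proof -
    have "norm ((G x - x) - (G y - y)) \<le> (L + 1) * norm (x - y)" for x y
      using lipschitz[of x y] norm_triangle_ineq4[of "G x - G y" "x - y"]
      by (simp add: algebra_simps)
    then have "quad_growth (\<lambda>z. (norm (G z - z))\<^sup>2)" by (rule quad_growth_lipschitz)
    then have "integrable \<sigma> (\<lambda>z. (norm (G z - z))\<^sup>2)"
      by (intro W2_integrable[OF \<sigma>] borel_measurable_continuous_onI continuous_intros continuous_G)
    then show ?thesis using W2_integrable[OF \<sigma> bm(1) qu] W2_integrable[OF \<sigma> bm(2) qv] by simp
  qed
  also have "(\<integral>z. (norm (G z - z))\<^sup>2 \<partial>\<sigma>) = (\<integral>z. (norm (T z - z))\<^sup>2 \<partial>\<sigma>)"
    by (rule Bochner_Integration.integral_cong) (auto simp: T(2) W2D(3)[OF \<sigma>])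
  also have "(\<integral>z. v z \<partial>\<sigma>) = t * (\<integral>z. b z \<partial>\<sigma>) + t\<^sup>2 / (2 * \<alpha>) * (\<integral>z. (norm (w z))\<^sup>2 \<partial>\<sigma>)"
  proof -
    have "(\<lambda>z. (norm (w z))\<^sup>2) \<in> borel_measurable borel"
      by (intro borel_measurable_continuous_onI continuous_intros w)
    from W2_integrable[OF \<sigma> bm(5) b(2)] W2_integrable[OF \<sigma> this w(2)] show ?thesis
      unfolding v_def by simp
  qed
  finally have "(\<integral>y. g y \<partial>pushforward \<Omega> T \<sigma>) = (\<integral>z. (norm (T z - z))\<^sup>2 \<partial>\<sigma>) - (\<integral>z. u z \<partial>\<sigma>)
      - (t * (\<integral>z. b z \<partial>\<sigma>) + t\<^sup>2 / (2 * \<alpha>) * (\<integral>z. (norm (w z))\<^sup>2 \<partial>\<sigma>))" .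
  moreover have "(\<integral>x. f x \<partial>\<rho>) = (\<integral>x. u x \<partial>\<rho>) + t * (\<integral>x. b x \<partial>\<rho>)"
    unfolding f_def using W2_integrable[OF \<rho> bm(1) qu] W2_integrable[OF \<rho> bm(5) b(2)] by simp
  ultimately show ?thesis
    by (intro that[of f g, OF cf qf cg qg le]) (simp add: u_def algebra_simps)
qed

text \<open>The difference of the Legendre conjugates of two potentials separates the push-forwards
  under the corresponding gradients, because Fenchel--Young is strict off the graph of the gradient.\<close>

lemma separating_function:
  assumes m: "m \<in> W2 \<Omega>" and T0: "T0 \<in> reg_maps L \<Omega>" and T: "T \<in> reg_maps L \<Omega>"
  obtains b w K where "continuous_on UNIV b" "quad_growth b"
    "continuous_on UNIV w" "quad_growth (\<lambda>x. (norm (w x))\<^sup>2)"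
    "\<And>x z. b x \<le> b z + w z \<bullet> (x - z) + K * (norm (x - z))\<^sup>2"
    "\<not> (AE x in m. T x = T0 x) \<Longrightarrow> (\<integral>x. b x \<partial>pushforward \<Omega> T0 m) < (\<integral>x. b x \<partial>pushforward \<Omega> T m)"
proof -
  obtain \<phi>0 G0 S0 \<alpha>0 where P0: "convex_potential \<phi>0 G0 S0 \<alpha>0 L" and G0: "\<And>x. x \<in> \<Omega> \<Longrightarrow> T0 x = G0 x"
    using reg_mapsE[OF T0] by blast
  obtain \<phi>1 G1 S1 \<alpha>1 where P1: "convex_potential \<phi>1 G1 S1 \<alpha>1 L" and G1: "\<And>x. x \<in> \<Omega> \<Longrightarrow> T x = G1 x"
    using reg_mapsE[OF T] by blast
  interpret p0: convex_potential \<phi>0 G0 S0 \<alpha>0 L by (rule P0)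
  interpret p1: convex_potential \<phi>1 G1 S1 \<alpha>1 L by (rule P1)
  define b where "b x = p0.legendre x - p1.legendre x" for x
  define w where "w x = S0 x - S1 x" for x
  have cb: "continuous_on UNIV b"
    unfolding b_def by (intro continuous_intros p0.continuous_legendre p1.continuous_legendre)
  have qb: "quad_growth b"
    unfolding b_def[abs_def] by (intro quad_growth_diff p0.quad_growth_legendre p1.quad_growth_legendre)
  have cw: "continuous_on UNIV w"
    unfolding w_def by (intro continuous_intros p0.continuous_S p1.continuous_S)
  have qw: "quad_growth (\<lambda>x. (norm (w x))\<^sup>2)"
  proof (rule quad_growth_lipschitz)
    show "norm (w x - w y) \<le> (1 / \<alpha>0 + 1 / \<alpha>1) * norm (x - y)" for x y
      using p0.S_lipschitz[of x y] p1.S_lipschitz[of x y] norm_triangle_ineq4[of "S0 x - S0 y" "S1 x - S1 y"]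
      by (simp add: w_def algebra_simps)
  qed
  \<comment> \<open>The conjugate of \<open>\<phi>0\<close> has a quadratic upper bound at
    \<open>z\<close>, and the subtracted conjugate of \<open>\<phi>1\<close> lies above its tangent
    there.\<close>
  have up: "b x \<le> b z + w z \<bullet> (x - z) + (1 / \<alpha>0) * (norm (x - z))\<^sup>2" for x z
    using p0.legendre_upper[of x z] p1.legendre_subgradient[of z x]
    by (simp add: b_def w_def inner_diff_left)
  have sep: "(\<integral>x. b x \<partial>pushforward \<Omega> T0 m) < (\<integral>x. b x \<partial>pushforward \<Omega> T m)" if ne: "\<not> (AE x in m. T x = T0 x)"
  proof -
    have bm: "b \<in> borel_measurable borel" using cb by (rule borel_measurable_continuous_onI)
    note meas = reg_maps_measurable[OF T0 W2D(2)[OF m]] reg_maps_measurable[OF T W2D(2)[OF m]]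
    note int = integrable_pushforward[OF meas(1) pushforward_W2[OF m T0] bm qb]
      integrable_pushforward[OF meas(2) pushforward_W2[OF m T] bm qb]
    \<comment> \<open>Fenchel--Young for \<open>\<phi>0\<close> at \<open>(x, T x)\<close> and for
      \<open>\<phi>1\<close> at \<open>(x, T0 x)\<close>, combined with the equalities on the two
      graphs: all terms cancel except the surplus of the first.\<close>
    have gap: "\<alpha>0 / 2 * (norm (x - S0 (T x)))\<^sup>2 \<le> b (T x) - b (T0 x)" if "x \<in> space m" for x
    proof -
      have x: "T0 x = G0 x" "T x = G1 x" using that G0 G1 by (auto simp: W2D(3)[OF m])
      have "0 \<le> \<alpha>1 / 2 * (norm (x - S1 (T0 x)))\<^sup>2" using p1.\<alpha>_pos by simp
      then show ?thesis
        using p0.fenchel_young[of x "T x"] p1.fenchel_young[of x "T0 x"]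
        by (simp add: b_def x p0.legendre_G p1.legendre_G inner_commute)
    qed
    have nn: "0 \<le> b (T x) - b (T0 x)" if "x \<in> space m" for x
      using p0.\<alpha>_pos by (intro order_trans[OF _ gap[OF that]]) simp
    have "0 \<le> (\<integral>x. b (T x) - b (T0 x) \<partial>m)" using nn by (intro Bochner_Integration.integral_nonneg_AE AE_I2)
    moreover have "(\<integral>x. b (T x) - b (T0 x) \<partial>m) \<noteq> 0"
    proof
      assume "(\<integral>x. b (T x) - b (T0 x) \<partial>m) = 0"
      then have "AE x in m. b (T x) - b (T0 x) = 0"
        using int nn by (subst (asm) integral_nonneg_eq_0_iff_AE) auto
      then have "AE x in m. T x = T0 x"
      proof (rule AE_mp, intro AE_I2 impI)
        fix x assume x: "x \<in> space m" and "b (T x) - b (T0 x) = 0"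
        with gap[OF x] have "(norm (x - S0 (T x)))\<^sup>2 \<le> 0"
          using p0.\<alpha>_pos by (simp add: mult_le_0_iff)
        then have "x = S0 (T x)" by simp
        then have "G0 x = T x" by (metis p0.G_S)
        then show "T x = T0 x" using x G0 W2D(3)[OF m] by simp
      qed
      with ne show False ..
    qed
    ultimately show ?thesis
      using int by (simp add: integral_pushforward[OF meas(1) bm] integral_pushforward[OF meas(2) bm])
  qed
  show ?thesis by (rule that[of b w "1 / \<alpha>0", OF cb qb cw qw up sep])
qed

section \<open>Random maps with mean the identity\<close>

lemma dense_sequence_in:
  fixes \<Omega> :: "'a::{metric_space, second_countable_topology} set"
  assumes "\<Omega> \<noteq> {}"
  obtains d :: "nat \<Rightarrow> 'a" where "\<And>n. d n \<in> \<Omega>" "\<And>x e. x \<in> \<Omega> \<Longrightarrow> 0 < e \<Longrightarrow> \<exists>n. dist x (d n) < e"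
proof -
  obtain B :: "'a set set" where B: "countable B" "topological_basis B" using ex_countable_basis by blast
  define D where "D = (\<lambda>U. SOME x. x \<in> U \<inter> \<Omega>) ` {U \<in> B. U \<inter> \<Omega> \<noteq> {}}"
  have D: "D \<subseteq> \<Omega>"
  proof
    fix y assume "y \<in> D"
    then obtain U where U: "U \<inter> \<Omega> \<noteq> {}" "y = (SOME x. x \<in> U \<inter> \<Omega>)" by (auto simp: D_def)
    have "y \<in> U \<inter> \<Omega>" unfolding U(2) by (rule someI_ex) (use U(1) in auto)
    then show "y \<in> \<Omega>" by simp
  qed
  have dense: "\<exists>y\<in>D. dist x y < e" if x: "x \<in> \<Omega>" and e: "0 < e" for x e
  proof -
    obtain U where U: "U \<in> B" "x \<in> U" "U \<subseteq> ball x e"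
      using topological_basisE[OF B(2) open_ball, of x x e] e by auto
    then have "(SOME y. y \<in> U \<inter> \<Omega>) \<in> U \<inter> \<Omega>" 
      using x by (intro someI[of "\<lambda>y. y \<in> U \<inter> \<Omega>" x]) auto
    then show ?thesis using U that by (intro bexI[of _ "SOME y. y \<in> U \<inter> \<Omega>"]) (auto simp: D_def)
  qed
  have "countable D" unfolding D_def using B(1) by simp
  moreover have "D \<noteq> {}" using assms dense[of _ 1] by auto
  ultimately have r: "range (from_nat_into D) = D" by (rule range_from_nat_into[rotated])
  show ?thesis
  proof (rule that)
    show "from_nat_into D n \<in> \<Omega>" for n using r D by blast
    show "\<exists>n. dist x (from_nat_into D n) < e" if "x \<in> \<Omega>" "0 < e" for x e
      using dense[OF that] r by (metis imageE)
  qed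
qed

text \<open>Separate measurability in \<open>\<omega>\<close> and continuity in \<open>x\<close>
  suffice: \<open>x\<close> is replaced by the first point of a dense sequence within distance
  \<open>1 / (i + 1)\<close>, a measurable map with countably many values, and \<open>i\<close>
  tends to infinity. The sequence lies in \<open>\<Omega>\<close>, the only place where
  \<open>F\<close> is controlled.\<close>

lemma borel_measurable_caratheodory:
  fixes F :: "'w \<Rightarrow> real^'n \<Rightarrow> real^'n"
  assumes cont: "\<And>\<omega>. \<omega> \<in> space N \<Longrightarrow> continuous_on \<Omega> (F \<omega>)"
    and meas: "\<And>x. x \<in> \<Omega> \<Longrightarrow> (\<lambda>\<omega>. F \<omega> x) \<in> borel_measurable N"
  shows "(\<lambda>(\<omega>, x). F \<omega> x) \<in> borel_measurable (N \<Otimes>\<^sub>M borel_on \<Omega>)"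
proof (cases "\<Omega> = {}")
  case True
  then show ?thesis by (simp add: measurable_def space_pair_measure space_restrict_space)
next
  case False
  obtain d :: "nat \<Rightarrow> real^'n" where d: "\<And>n. d n \<in> \<Omega>" "\<And>x e. x \<in> \<Omega> \<Longrightarrow> 0 < e \<Longrightarrow> \<exists>n. dist x (d n) < e"
    using dense_sequence_in[OF False] by blast
  define k where "k i x = (LEAST n. dist x (d n) < inverse (real (Suc i)))" for i x
  have k: "dist x (d (k i x)) < inverse (real (Suc i))" if "x \<in> \<Omega>" for i x
    unfolding k_def by (rule LeastI_ex) (use d(2) that in auto)
  have [measurable]: "(\<lambda>x. x) \<in> borel_measurable (borel_on \<Omega>)" by (simp add: measurable_restrict_space1)
  have km: "(\<lambda>z. k i (snd z)) \<in> N \<Otimes>\<^sub>M borel_on \<Omega> \<rightarrow>\<^sub>M count_space UNIV" for i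
  proof (rule measurable_compose[OF measurable_snd])
    show "k i \<in> borel_on \<Omega> \<rightarrow>\<^sub>M count_space UNIV" unfolding k_def[abs_def] by measurable
  qed
  show ?thesis
  proof (rule borel_measurable_LIMSEQ_metric)
    fix i
    have "(\<lambda>z. F (fst z) (d n)) \<in> borel_measurable (N \<Otimes>\<^sub>M borel_on \<Omega>)" for n
      by (rule measurable_compose[OF measurable_fst meas[OF d(1)]])
    then show "(\<lambda>z. F (fst z) (d (k i (snd z)))) \<in> borel_measurable (N \<Otimes>\<^sub>M borel_on \<Omega>)"
      using km by (rule measurable_compose_countable)
  next
    fix z assume "z \<in> space (N \<Otimes>\<^sub>M borel_on \<Omega>)"
    then obtain \<omega> x where z: "z = (\<omega>, x)" "\<omega> \<in> space N" "x \<in> \<Omega>"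
      by (auto simp: space_pair_measure space_restrict_space)
    have "(\<lambda>i. d (k i x)) \<longlonglongrightarrow> x"
    proof (rule metric_LIMSEQ_I)
      fix e :: real assume "0 < e"
      then obtain j where j: "inverse (real (Suc j)) < e" using reals_Archimedean by blast
      have "dist (d (k i x)) x < e" if "i \<ge> j" for i
      proof -
        have "inverse (real (Suc i)) \<le> inverse (real (Suc j))" using that by (simp add: field_simps)
        with k[OF z(3), of i] j show ?thesis unfolding dist_commute[of _ x] by linarith
      qed
      then show "\<exists>no. \<forall>i\<ge>no. dist (d (k i x)) x < e" by blast
    qed
    then have "(\<lambda>i. F \<omega> (d (k i x))) \<longlonglongrightarrow> F \<omega> x"
      using cont[OF z(2)] d(1) z(3) by (auto simp: continuous_on_sequentially o_def)
    then show "(\<lambda>i. F (fst z) (d (k i (snd z)))) \<longlonglongrightarrow> (case z of (\<omega>, x) \<Rightarrow> F \<omega> x)"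
      by (simp add: z)
  qed
qed

text \<open>Expresses a difference of potentials through values of the gradient alone, which for the
  noise are measurable in the outcome.\<close>

lemma (in convex_potential) integral_gradient_segment:
  "(\<integral>t. (G (b + t *\<^sub>R v) - (b + t *\<^sub>R v)) \<bullet> v \<partial>restrict_space lborel {0..1}) =
    (\<phi> (b + v) - (norm (b + v))\<^sup>2 / 2) - (\<phi> b - (norm b)\<^sup>2 / 2)"
proof -
  let ?f = "\<lambda>t. (G (b + t *\<^sub>R v) - (b + t *\<^sub>R v)) \<bullet> v"
  let ?F = "\<lambda>t. \<phi> (b + t *\<^sub>R v) - (norm (b + t *\<^sub>R v))\<^sup>2 / 2"
  have "(\<integral>t. ?f t * indicator {0..1} t \<partial>lborel) = ?F 1 - ?F 0"
  proof (rule integral_FTC_Icc_real)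
    fix t :: real
    have "((\<lambda>t. (norm (b + t *\<^sub>R v))\<^sup>2 / 2) has_real_derivative (b + t *\<^sub>R v) \<bullet> v) (at t)"
    proof -
      have "((\<lambda>t. (norm b)\<^sup>2 / 2 + t * (b \<bullet> v) + t\<^sup>2 * (v \<bullet> v) / 2) has_real_derivative
          (b + t *\<^sub>R v) \<bullet> v) (at t)"
        by (auto intro!: derivative_eq_intros simp: inner_add_left)
      moreover have "(norm (b + t *\<^sub>R v))\<^sup>2 / 2 = (norm b)\<^sup>2 / 2 + t * (b \<bullet> v) + t\<^sup>2 * (v \<bullet> v) / 2" for t
        unfolding power2_norm_eq_inner
        by (simp add: inner_add_left inner_add_right inner_commute power2_eq_square add_divide_distrib algebra_simps)
      ultimately show ?thesis by (simp only:)
    qed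
    then show "(?F has_real_derivative ?f t) (at t)"
      unfolding inner_diff_left by (intro DERIV_diff DERIV_GDERIV_along_line[OF grad])
    have "continuous_on UNIV ?f"
      by (intro continuous_intros continuous_on_compose2[OF continuous_G]) auto
    then show "isCont ?f t" by (simp add: continuous_on_eq_continuous_at)
  qed simp
  then show ?thesis
    by (subst integral_restrict_space) (simp_all add: mult.commute)
qed

text \<open>\<open>E \<omega>\<close> is a double integral of
  \<open>F \<omega> (z \<kappa>) - z \<kappa>\<close> against the displacement
  \<open>v \<kappa>\<close>, over \<open>x\<close> and over the position \<open>t\<close> on the
  segment from \<open>T0 x\<close> to \<open>T x\<close>. The point \<open>z \<kappa>\<close> is in
  \<open>\<Omega>\<close> and independent of \<open>\<omega>\<close>, so averaging over the noise
  first annihilates the integrand. The last clause holds for every potential of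
  \<open>F \<omega>\<close>, so no measurable choice of one is made.\<close>

lemma expected_potential_gap_zero:
  fixes F :: "'w \<Rightarrow> real^'n \<Rightarrow> real^'n"
  assumes N: "prob_space N" and F: "\<And>\<omega>. \<omega> \<in> space N \<Longrightarrow> F \<omega> \<in> reg_maps L \<Omega>"
    and meas: "\<And>x. x \<in> \<Omega> \<Longrightarrow> (\<lambda>\<omega>. F \<omega> x) \<in> borel_measurable N"
    and mean: "has_bochner_mean N \<Omega> F (\<lambda>x. x)"
    and convex: "convex \<Omega>" and m: "m \<in> W2 \<Omega>"
    and T: "T \<in> reg_maps L \<Omega>" and T0: "T0 \<in> reg_maps L \<Omega>"
  obtains E where "integrable N E" "(\<integral>\<omega>. E \<omega> \<partial>N) = 0"
    "\<And>\<omega> \<phi> G S \<alpha>. \<omega> \<in> space N \<Longrightarrow> convex_potential \<phi> G S \<alpha> L \<Longrightarrow> (\<And>x. x \<in> \<Omega> \<Longrightarrow> F \<omega> x = G x) \<Longrightarrow>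
      E \<omega> = (\<integral>x. (norm x)\<^sup>2 - 2 * \<phi> x \<partial>pushforward \<Omega> T m) - (\<integral>x. (norm x)\<^sup>2 - 2 * \<phi> x \<partial>pushforward \<Omega> T0 m)"
proof -
  interpret N: prob_space N by (rule N)
  interpret m: prob_space m by (rule W2D[OF m])
  \<comment> \<open>The uniform law of the position on the segment.\<close>
  define U :: "real measure" where "U = restrict_space lborel {0..1}"
  have "prob_space U"
    by (rule prob_spaceI) (simp add: U_def space_restrict_space emeasure_restrict_space)
  then interpret U: prob_space U .
  interpret K: pair_prob_space m U ..
  define K where "K = m \<Otimes>\<^sub>M U"
  interpret K': prob_space K unfolding K_def by (rule K.prob_space_axioms)
  interpret NK: pair_prob_space N K ..
  note tm = reg_maps_measurable[OF T W2D(2)[OF m]] reg_maps_measurable[OF T0 W2D(2)[OF m]]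
  have [measurable]: "T \<in> borel_measurable m" "T0 \<in> borel_measurable m"
    using borel_measurable_compose_on[OF tm(1), of "\<lambda>x. x"] borel_measurable_compose_on[OF tm(2), of "\<lambda>x. x"]
    by simp_all
  have spm: "space m = \<Omega>" by (rule W2D[OF m])
  have spU: "space U = {0..1}" by (simp add: U_def space_restrict_space)
  have spK: "space K = \<Omega> \<times> {0..1}" by (simp add: K_def space_pair_measure spm spU)
  have TT: "T x \<in> \<Omega>" "T0 x \<in> \<Omega>" if "x \<in> \<Omega>" for x using T T0 that by (auto simp: reg_maps_def)
  obtain z0 where z0: "z0 \<in> \<Omega>" using m.not_empty spm by auto
  define v where "v \<kappa> = T (fst \<kappa>) - T0 (fst \<kappa>)" for \<kappa> :: "(real^'n) \<times> real"
  define z where "z \<kappa> = T0 (fst \<kappa>) + snd \<kappa> *\<^sub>R v \<kappa>" for \<kappa>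
  define p where "p \<kappa> = norm (T (fst \<kappa>)) + norm (T0 (fst \<kappa>))" for \<kappa> :: "(real^'n) \<times> real"
  define h where "h \<omega> \<kappa> = (F \<omega> (z \<kappa>) - z \<kappa>) \<bullet> v \<kappa>" for \<omega> \<kappa>
  \<comment> \<open>The Lipschitz bound reduces the noise to its value at the single point
    \<open>z0\<close>, which is integrable since the mean there exists; \<open>p\<close> is square
    integrable, so \<open>g \<omega> * p \<kappa> + (L + 1) * (p \<kappa>)\<^sup>2\<close> is an
    integrable majorant of \<open>h\<close>.\<close>
  define g where "g \<omega> = norm (F \<omega> z0) + L * norm z0" for \<omega>
  have z_eq: "z \<kappa> = (1 - snd \<kappa>) *\<^sub>R T0 (fst \<kappa>) + snd \<kappa> *\<^sub>R T (fst \<kappa>)" for \<kappa>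
    by (simp add: z_def v_def algebra_simps)
  have z_in: "z \<kappa> \<in> \<Omega>" if "\<kappa> \<in> space K" for \<kappa>
    using that convex TT unfolding z_eq spK by (intro convexD) auto
  have z_norm: "norm (z \<kappa>) \<le> p \<kappa>" if "\<kappa> \<in> space K" for \<kappa>
  proof -
    have t: "0 \<le> snd \<kappa>" "snd \<kappa> \<le> 1" using that by (auto simp: spK)
    have "norm (z \<kappa>) \<le> (1 - snd \<kappa>) * norm (T0 (fst \<kappa>)) + snd \<kappa> * norm (T (fst \<kappa>))"
      unfolding z_eq by (rule order_trans[OF norm_triangle_ineq]) (use t in simp)
    also have "\<dots> \<le> 1 * norm (T0 (fst \<kappa>)) + 1 * norm (T (fst \<kappa>))"
      using t by (intro add_mono mult_right_mono) auto
    finally show ?thesis by (simp add: p_def)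
  qed
  have v_norm: "norm (v \<kappa>) \<le> p \<kappa>" for \<kappa>
    unfolding v_def p_def by (rule norm_triangle_ineq4)
  have [measurable]: "(\<lambda>\<kappa>. T (fst \<kappa>)) \<in> borel_measurable K" "(\<lambda>\<kappa>. T0 (fst \<kappa>)) \<in> borel_measurable K"
    unfolding K_def by measurable
  have [measurable]: "snd \<in> borel_measurable K"
  proof -
    have "(\<lambda>x. x) \<in> borel_measurable U" unfolding U_def by (simp add: measurable_restrict_space1)
    then show ?thesis unfolding K_def by (rule measurable_compose[OF measurable_snd])
  qed
  have [measurable]: "v \<in> borel_measurable K" unfolding v_def[abs_def] by measurable
  have zb [measurable]: "z \<in> borel_measurable K" unfolding z_def[abs_def] by measurable
  have zm: "z \<in> K \<rightarrow>\<^sub>M borel_on \<Omega>" using z_in zb by (intro measurable_restrict_space2) auto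
  have [measurable]: "p \<in> borel_measurable K" unfolding p_def[abs_def] by measurable
  have joint: "(\<lambda>(\<omega>, x). F \<omega> x) \<in> borel_measurable (N \<Otimes>\<^sub>M borel_on \<Omega>)"
    by (intro borel_measurable_caratheodory meas reg_maps_continuous[OF F])
  have [measurable]: "(\<lambda>(\<omega>, \<kappa>). F \<omega> (z \<kappa>)) \<in> borel_measurable (N \<Otimes>\<^sub>M K)"
  proof -
    have "(\<lambda>y. (fst y, z (snd y))) \<in> N \<Otimes>\<^sub>M K \<rightarrow>\<^sub>M N \<Otimes>\<^sub>M borel_on \<Omega>"
      using zm by measurable
    from measurable_compose[OF this joint] show ?thesis by (simp add: case_prod_beta)
  qed
  have hm: "(\<lambda>(\<omega>, \<kappa>). h \<omega> \<kappa>) \<in> borel_measurable (N \<Otimes>\<^sub>M K)"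
    unfolding h_def by measurable
  have sq: "integrable m (\<lambda>x. (norm (T x))\<^sup>2)" "integrable m (\<lambda>x. (norm (T0 x))\<^sup>2)"
    by (intro integrable_pushforward[OF tm(1) pushforward_W2[OF m T]] quad_growth_norm_sq, measurable)
      (intro integrable_pushforward[OF tm(2) pushforward_W2[OF m T0]] quad_growth_norm_sq, measurable)
  have fst_int: "integrable K (\<lambda>\<kappa>. f (fst \<kappa>))" if "integrable m f" for f :: "real^'n \<Rightarrow> real"
  proof -
    have "integrable (distr K m fst) f" using that by (simp add: K_def U.distr_pair_fst)
    then show ?thesis
      by (subst (asm) integrable_distr_eq) (use that in \<open>simp_all add: K_def borel_measurable_integrable\<close>)
  qed
  have p2: "integrable K (\<lambda>\<kappa>. (p \<kappa>)\<^sup>2)"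
  proof (rule Bochner_Integration.integrable_bound)
    show "integrable K (\<lambda>\<kappa>. 2 * (norm (T (fst \<kappa>)))\<^sup>2 + 2 * (norm (T0 (fst \<kappa>)))\<^sup>2)"
      using fst_int[OF sq(1)] fst_int[OF sq(2)] by simp
    show "AE \<kappa> in K. norm ((p \<kappa>)\<^sup>2) \<le> norm (2 * (norm (T (fst \<kappa>)))\<^sup>2 + 2 * (norm (T0 (fst \<kappa>)))\<^sup>2)"
    proof (rule AE_I2)
      fix \<kappa> :: "(real^'n) \<times> real"
      show "norm ((p \<kappa>)\<^sup>2) \<le> norm (2 * (norm (T (fst \<kappa>)))\<^sup>2 + 2 * (norm (T0 (fst \<kappa>)))\<^sup>2)"
        using sum_squares_bound[of "norm (T (fst \<kappa>))" "norm (T0 (fst \<kappa>))"]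
        by (simp add: p_def power2_sum)
    qed
  qed measurable
  have p1: "integrable K p"
    by (rule K'.square_integrable_imp_integrable[OF _ p2]) measurable
  have bound: "\<bar>h \<omega> \<kappa>\<bar> \<le> g \<omega> * p \<kappa> + (L + 1) * (p \<kappa>)\<^sup>2" if "\<omega> \<in> space N" "\<kappa> \<in> space K" for \<omega> \<kappa>
  proof -
    have "F \<omega> \<in> reg_maps L \<Omega>" by (rule F[OF that(1)])
    from reg_mapsE[OF this] obtain \<phi> G S \<alpha>
      where P: "convex_potential \<phi> G S \<alpha> L" and G: "\<And>x. x \<in> \<Omega> \<Longrightarrow> F \<omega> x = G x" by blast
    interpret convex_potential \<phi> G S \<alpha> L by (rule P)
    have "norm (G (z \<kappa>) - z \<kappa>) \<le> norm (G z0) + norm (G (z \<kappa>) - G z0) + norm (z \<kappa>)"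
      using norm_triangle_ineq4[of "G (z \<kappa>)" "z \<kappa>"] norm_triangle_sub[of "G (z \<kappa>)" "G z0"] by simp
    also have "\<dots> \<le> norm (G z0) + L * norm (z \<kappa> - z0) + norm (z \<kappa>)"
      using lipschitz by simp
    also have "\<dots> \<le> norm (G z0) + L * (norm (z \<kappa>) + norm z0) + norm (z \<kappa>)"
      using L_nonneg by (intro add_mono mult_left_mono norm_triangle_ineq4) auto
    also have "\<dots> = g \<omega> + (L + 1) * norm (z \<kappa>)" using G[OF z0] by (simp add: g_def algebra_simps)
    also have "\<dots> \<le> g \<omega> + (L + 1) * p \<kappa>"
      using z_norm[OF that(2)] L_nonneg by (intro add_mono mult_left_mono) auto
    finally have "norm (F \<omega> (z \<kappa>) - z \<kappa>) \<le> g \<omega> + (L + 1) * p \<kappa>" using G[OF z_in[OF that(2)]] by simp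
    then have "norm (F \<omega> (z \<kappa>) - z \<kappa>) * norm (v \<kappa>) \<le> (g \<omega> + (L + 1) * p \<kappa>) * p \<kappa>"
      using v_norm[of \<kappa>] by (intro mult_mono) (auto intro: order_trans[OF norm_ge_zero])
    then show ?thesis
      using Cauchy_Schwarz_ineq2[of "F \<omega> (z \<kappa>) - z \<kappa>" "v \<kappa>"]
      by (simp add: h_def algebra_simps power2_eq_square)
  qed
  have hK: "integrable K (h \<omega>)" if "\<omega> \<in> space N" for \<omega>
  proof (rule Bochner_Integration.integrable_bound)
    show "integrable K (\<lambda>\<kappa>. g \<omega> * p \<kappa> + (L + 1) * (p \<kappa>)\<^sup>2)" using p1 p2 by simp
    show "h \<omega> \<in> borel_measurable K" using measurable_Pair2[OF hm that] by simp
  qed (use bound[OF that] in \<open>auto intro!: AE_I2 order_trans[OF _ abs_ge_self]\<close>)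
  have gint: "integrable N g"
  proof -
    have "integrable N (\<lambda>\<omega>. F \<omega> z0)"
      using mean z0 by (auto simp: has_bochner_mean_def has_bochner_integral_iff)
    then show ?thesis unfolding g_def by simp
  qed
  have hNK: "integrable (N \<Otimes>\<^sub>M K) (\<lambda>(\<omega>, \<kappa>). h \<omega> \<kappa>)"
  proof (rule NK.Fubini_integrable[OF hm])
    have nh: "(\<lambda>(\<omega>, \<kappa>). norm (h \<omega> \<kappa>)) \<in> borel_measurable (N \<Otimes>\<^sub>M K)"
      using hm by (simp add: case_prod_beta)
    show "integrable N (\<lambda>\<omega>. \<integral>\<kappa>. norm (case (\<omega>, \<kappa>) of (\<omega>, \<kappa>) \<Rightarrow> h \<omega> \<kappa>) \<partial>K)"
    proof (rule Bochner_Integration.integrable_bound)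
      show "integrable N (\<lambda>\<omega>. g \<omega> * (\<integral>\<kappa>. p \<kappa> \<partial>K) + (L + 1) * (\<integral>\<kappa>. (p \<kappa>)\<^sup>2 \<partial>K))" using gint by simp
      show "(\<lambda>\<omega>. \<integral>\<kappa>. norm (case (\<omega>, \<kappa>) of (\<omega>, \<kappa>) \<Rightarrow> h \<omega> \<kappa>) \<partial>K) \<in> borel_measurable N"
        using K'.borel_measurable_lebesgue_integral[OF nh] by simp
      show "AE \<omega> in N. norm (\<integral>\<kappa>. norm (case (\<omega>, \<kappa>) of (\<omega>, \<kappa>) \<Rightarrow> h \<omega> \<kappa>) \<partial>K)
        \<le> norm (g \<omega> * (\<integral>\<kappa>. p \<kappa> \<partial>K) + (L + 1) * (\<integral>\<kappa>. (p \<kappa>)\<^sup>2 \<partial>K))"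
      proof (rule AE_I2)
        fix \<omega> assume \<omega>: "\<omega> \<in> space N"
        have "(\<integral>\<kappa>. norm (h \<omega> \<kappa>) \<partial>K) \<le> (\<integral>\<kappa>. g \<omega> * p \<kappa> + (L + 1) * (p \<kappa>)\<^sup>2 \<partial>K)"
          using hK[OF \<omega>] p1 p2 bound[OF \<omega>] by (intro integral_mono) auto
        also have "\<dots> = g \<omega> * (\<integral>\<kappa>. p \<kappa> \<partial>K) + (L + 1) * (\<integral>\<kappa>. (p \<kappa>)\<^sup>2 \<partial>K)" using p1 p2 by simp
        finally show "norm (\<integral>\<kappa>. norm (case (\<omega>, \<kappa>) of (\<omega>, \<kappa>) \<Rightarrow> h \<omega> \<kappa>) \<partial>K)
          \<le> norm (g \<omega> * (\<integral>\<kappa>. p \<kappa> \<partial>K) + (L + 1) * (\<integral>\<kappa>. (p \<kappa>)\<^sup>2 \<partial>K))" by simp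
      qed
    qed
    show "AE \<omega> in N. integrable K (\<lambda>\<kappa>. case (\<omega>, \<kappa>) of (\<omega>, \<kappa>) \<Rightarrow> h \<omega> \<kappa>)"
      using hK by (intro AE_I2) simp
  qed
  \<comment> \<open>The segment integral yields increments of
    \<open>\<phi> x - (norm x)\<^sup>2 / 2\<close>; the factor \<open>- 2\<close> converts them to
    increments of \<open>(norm x)\<^sup>2 - 2 * \<phi> x\<close>.\<close>
  define E where "E \<omega> = - 2 * (\<integral>\<kappa>. h \<omega> \<kappa> \<partial>K)" for \<omega>
  show ?thesis
  proof (rule that)
    show "integrable N E" unfolding E_def using NK.integrable_fst'[OF hNK] by simp
    have "(\<integral>\<omega>. h \<omega> \<kappa> \<partial>N) = 0" if "\<kappa> \<in> space K" for \<kappa>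
    proof -
      have "has_bochner_integral N (\<lambda>\<omega>. F \<omega> (z \<kappa>)) (z \<kappa>)"
        using mean z_in[OF that] by (auto simp: has_bochner_mean_def)
      then show ?thesis unfolding h_def
        by (auto simp: has_bochner_integral_iff N.prob_space)
    qed
    then have "(\<integral>\<kappa>. (\<integral>\<omega>. h \<omega> \<kappa> \<partial>N) \<partial>K) = 0"
      using Bochner_Integration.integral_cong[OF refl, of K "\<lambda>\<kappa>. \<integral>\<omega>. h \<omega> \<kappa> \<partial>N" "\<lambda>_. 0"] by simp
    then show "(\<integral>\<omega>. E \<omega> \<partial>N) = 0" unfolding E_def using NK.Fubini_integral[OF hNK] by simp
    fix \<omega> \<phi> G S \<alpha> assume \<omega>: "\<omega> \<in> space N" and P: "convex_potential \<phi> G S \<alpha> L"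
      and G: "\<And>x. x \<in> \<Omega> \<Longrightarrow> F \<omega> x = G x"
    interpret convex_potential \<phi> G S \<alpha> L by (rule P)
    define u where "u x = (norm x)\<^sup>2 - 2 * \<phi> x" for x
    have qu: "quad_growth u"
      unfolding u_def[abs_def] by (intro quad_growth_diff quad_growth_cmult quad_growth_\<phi> quad_growth_norm_sq)
    have bu: "u \<in> borel_measurable borel"
      unfolding u_def[abs_def] by (intro borel_measurable_continuous_onI continuous_intros continuous_\<phi>)
    note iu = integrable_pushforward[OF tm(1) pushforward_W2[OF m T] bu qu]
      integrable_pushforward[OF tm(2) pushforward_W2[OF m T0] bu qu]
    have "(\<integral>\<kappa>. h \<omega> \<kappa> \<partial>K) = (\<integral>x. (\<integral>t. h \<omega> (x, t) \<partial>U) \<partial>m)"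
      using K.integral_fst'[of "h \<omega>"] hK[OF \<omega>] by (simp add: K_def)
    also have "\<dots> = (\<integral>x. - (u (T x) - u (T0 x)) / 2 \<partial>m)"
    proof (rule Bochner_Integration.integral_cong[OF refl])
      fix x assume "x \<in> space m"
      have "(\<integral>t. h \<omega> (x, t) \<partial>U) = (\<integral>t. (G (T0 x + t *\<^sub>R (T x - T0 x)) - (T0 x + t *\<^sub>R (T x - T0 x))) \<bullet> (T x - T0 x) \<partial>U)"
      proof (rule Bochner_Integration.integral_cong[OF refl])
        fix t assume "t \<in> space U"
        then have "(x, t) \<in> space K" using \<open>x \<in> space m\<close> by (simp add: K_def space_pair_measure)
        from G[OF z_in[OF this]]
        show "h \<omega> (x, t) = (G (T0 x + t *\<^sub>R (T x - T0 x)) - (T0 x + t *\<^sub>R (T x - T0 x))) \<bullet> (T x - T0 x)"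
          by (simp add: h_def z_def v_def)
      qed
      also have "\<dots> = - (u (T x) - u (T0 x)) / 2"
        unfolding U_def integral_gradient_segment by (simp add: u_def field_simps)
      finally show "(\<integral>t. h \<omega> (x, t) \<partial>U) = - (u (T x) - u (T0 x)) / 2" .
    qed
    also have "\<dots> = - ((\<integral>x. u (T x) \<partial>m) - (\<integral>x. u (T0 x) \<partial>m)) / 2" using iu by simp
    finally show "E \<omega> = (\<integral>x. (norm x)\<^sup>2 - 2 * \<phi> x \<partial>pushforward \<Omega> T m)
        - (\<integral>x. (norm x)\<^sup>2 - 2 * \<phi> x \<partial>pushforward \<Omega> T0 m)"
      using integral_pushforward[OF tm(1) bu] integral_pushforward[OF tm(2) bu]
      by (simp add: E_def u_def)
  qed
qed

section \<open>Comparison of the mean costs\<close>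

text \<open>For an arbitrary \<open>f\<close>, every simple minorant on the image pulls back to a
  minorant of \<open>f (g x)\<close>, whereas a minorant upstairs need not factor through
  \<open>g\<close>; hence an inequality. It serves for the squared distance to \<open>\<nu>\<close>
  under \<open>P\<close>.\<close>

lemma nn_integral_distr_le:
  assumes "g \<in> M \<rightarrow>\<^sub>M N"
  shows "(\<integral>\<^sup>+ y. f y \<partial>distr M N g) \<le> (\<integral>\<^sup>+ x. f (g x) \<partial>M)"
  unfolding nn_integral_def[of "distr M N g"]
proof (rule SUP_least)
  fix s assume "s \<in> {s. simple_function (distr M N g) s \<and> s \<le> f}"
  then have s: "simple_function (distr M N g) s" "s \<le> f" by auto
  then have "s \<in> borel_measurable N" using borel_measurable_simple_function[OF s(1)] by simp
  then have "integral\<^sup>S (distr M N g) s = (\<integral>\<^sup>+ x. s (g x) \<partial>M)"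
    using assms by (simp add: nn_integral_eq_simple_integral[OF s(1), symmetric] nn_integral_distr)
  also have "\<dots> \<le> (\<integral>\<^sup>+ x. f (g x) \<partial>M)" using s(2) by (intro nn_integral_mono) (auto simp: le_fun_def)
  finally show "integral\<^sup>S (distr M N g) s \<le> (\<integral>\<^sup>+ x. f (g x) \<partial>M)" .
qed

text \<open>Moving the kernel to the product space by \<open>y \<mapsto> (x, y)\<close> makes the
  integrand independent of the parameter.\<close>

lemma integral_measurable_subprob_algebra2:
  fixes f :: "'a \<Rightarrow> 'b \<Rightarrow> real"
  assumes f [measurable]: "(\<lambda>(x, y). f x y) \<in> borel_measurable (M \<Otimes>\<^sub>M N)"
    and L [measurable]: "L \<in> M \<rightarrow>\<^sub>M subprob_algebra N"
  shows "(\<lambda>x. integral\<^sup>L (L x) (f x)) \<in> borel_measurable M"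
proof -
  note measurable_distr2 [measurable]
  have "(\<lambda>x. integral\<^sup>L (distr (L x) (M \<Otimes>\<^sub>M N) (\<lambda>y. (x, y))) (\<lambda>(x, y). f x y)) \<in> borel_measurable M"
    by measurable
  then show ?thesis
    by (rule measurable_cong[THEN iffD1, rotated]) (simp add: integral_distr)
qed

text \<open>Identifies \<open>Q\<close> as a monadic bind, so that integrals against it become
  iterated integrals.\<close>

lemma linear_average_eq_bind:
  assumes PM: "sets PM = sets (W2_borel \<Omega>)" "space PM \<noteq> {}"
  shows "linear_average \<Omega> PM = PM \<bind> (\<lambda>m. m)"
proof -
  have k: "(\<lambda>m. m) \<in> PM \<rightarrow>\<^sub>M subprob_algebra (borel_on \<Omega>)"
    using measurable_W2_borel_subprob_algebra by (simp cong: measurable_cong_sets add: PM)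
  have s: "sets (PM \<bind> (\<lambda>m. m)) = sets (borel_on \<Omega>)"
    using sets_bind[OF sets_kernel[OF k] PM(2)] by simp
  then have sp: "space (PM \<bind> (\<lambda>m. m)) = \<Omega>"
    by (simp add: sets_eq_imp_space_eq[OF s] space_restrict_space)
  have "linear_average \<Omega> PM = measure_of \<Omega> (sets (borel_on \<Omega>)) (emeasure (PM \<bind> (\<lambda>m. m)))"
    unfolding linear_average_def
  proof (rule measure_of_eq)
    show p: "sets (borel_on \<Omega>) \<subseteq> Pow \<Omega>" by (auto simp: sets_restrict_space)
    fix X assume "X \<in> sigma_sets \<Omega> (sets (borel_on \<Omega>))"
    moreover have "sigma_sets \<Omega> (sets (borel_on \<Omega>)) = sets (borel_on \<Omega>)"
      using sets.sigma_sets_eq[of "borel_on \<Omega>"] by (simp add: space_restrict_space)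
    ultimately show "(\<integral>\<^sup>+ \<mu>. emeasure \<mu> X \<partial>PM) = emeasure (PM \<bind> (\<lambda>m. m)) X"
      using emeasure_bind[OF PM(2) k] by simp
  qed
  also have "\<dots> = PM \<bind> (\<lambda>m. m)"
    using measure_of_of_measure[of "PM \<bind> (\<lambda>m. m)"] s sp by simp
  finally show ?thesis .
qed

text \<open>\<open>c + E\<close> and \<open>c\<close> have the same mean. Where \<open>c + E\<close>
  is negative \<open>ennreal\<close> hides its size, and
  \<open>ennreal (c \<omega> + E \<omega>) < D \<omega>\<close> could fail with
  \<open>D \<omega> = 0\<close>; asking for a real \<open>r\<close> above
  \<open>c \<omega> + E \<omega>\<close> expresses strictness on the reals. An infinite integral of
  \<open>D\<close> is treated apart.\<close>

lemma (in prob_space) nn_integral_less_of_mean_zero: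
  assumes D: "D \<in> borel_measurable M"
    and c: "c \<in> borel_measurable M" "\<And>\<omega>. \<omega> \<in> space M \<Longrightarrow> 0 \<le> c \<omega>" "(\<integral>\<^sup>+ \<omega>. ennreal (c \<omega>) \<partial>M) < \<infinity>"
    and E: "integrable M E" "(\<integral>\<omega>. E \<omega> \<partial>M) = 0"
  shows "(\<And>\<omega>. \<omega> \<in> space M \<Longrightarrow> ennreal (c \<omega> + E \<omega>) \<le> D \<omega>) \<Longrightarrow>
      (\<integral>\<^sup>+ \<omega>. ennreal (c \<omega>) \<partial>M) \<le> (\<integral>\<^sup>+ \<omega>. D \<omega> \<partial>M)" (is "PROP ?A")
    and "(\<And>\<omega>. \<omega> \<in> space M \<Longrightarrow> \<exists>r>c \<omega> + E \<omega>. ennreal r \<le> D \<omega>) \<Longrightarrow>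
      (\<integral>\<^sup>+ \<omega>. ennreal (c \<omega>) \<partial>M) < (\<integral>\<^sup>+ \<omega>. D \<omega> \<partial>M)" (is "PROP ?B")
proof -
  have ci: "integrable M c" using c by (intro integrableI_nonneg AE_I2) auto
  have cE: "integrable M (\<lambda>\<omega>. c \<omega> + E \<omega>)" "(\<integral>\<omega>. c \<omega> + E \<omega> \<partial>M) = (\<integral>\<omega>. c \<omega> \<partial>M)"
    using ci E by auto
  have cn: "(\<integral>\<^sup>+ \<omega>. ennreal (c \<omega>) \<partial>M) = ennreal (\<integral>\<omega>. c \<omega> \<partial>M)"
    using ci c(2) by (intro nn_integral_eq_integral) auto
  define d where "d \<omega> = enn2real (D \<omega>)" for \<omega>
  have d0: "0 \<le> d \<omega>" for \<omega> by (simp add: d_def)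
  have dm: "d \<in> borel_measurable M" unfolding d_def[abs_def] using D by measurable
  have d: "AE \<omega> in M. D \<omega> = ennreal (d \<omega>)" "integrable M d" "(\<integral>\<^sup>+ \<omega>. D \<omega> \<partial>M) = ennreal (\<integral>\<omega>. d \<omega> \<partial>M)"
    if fin: "(\<integral>\<^sup>+ \<omega>. D \<omega> \<partial>M) \<noteq> \<infinity>"
  proof -
    have "AE \<omega> in M. D \<omega> \<noteq> \<infinity>" using nn_integral_PInf_AE[OF D] fin by simp
    then show 1: "AE \<omega> in M. D \<omega> = ennreal (d \<omega>)"
      by eventually_elim (simp add: d_def less_top)
    have 2: "(\<integral>\<^sup>+ \<omega>. D \<omega> \<partial>M) = (\<integral>\<^sup>+ \<omega>. ennreal (d \<omega>) \<partial>M)" by (rule nn_integral_cong_AE[OF 1])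
    then show 3: "integrable M d"
      using fin by (intro integrableI_nonneg dm) (auto simp: d_def less_top)
    show "(\<integral>\<^sup>+ \<omega>. D \<omega> \<partial>M) = ennreal (\<integral>\<omega>. d \<omega> \<partial>M)"
      unfolding 2 using 3 by (intro nn_integral_eq_integral AE_I2 d0)
  qed
  show "PROP ?A"
  proof (cases "(\<integral>\<^sup>+ \<omega>. D \<omega> \<partial>M) = \<infinity>")
    case False
    assume *: "\<And>\<omega>. \<omega> \<in> space M \<Longrightarrow> ennreal (c \<omega> + E \<omega>) \<le> D \<omega>"
    have "AE \<omega> in M. c \<omega> + E \<omega> \<le> d \<omega>"
      using d(1)[OF False]
    proof (rule AE_mp, intro AE_I2 impI)
      fix \<omega> assume "\<omega> \<in> space M" "D \<omega> = ennreal (d \<omega>)"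
      with * show "c \<omega> + E \<omega> \<le> d \<omega>" by (metis ennreal_le_iff[OF d0])
    qed
    then have "(\<integral>\<omega>. c \<omega> + E \<omega> \<partial>M) \<le> (\<integral>\<omega>. d \<omega> \<partial>M)"
      using cE d(2)[OF False] by (intro integral_mono_AE)
    then show ?thesis unfolding cn d(3)[OF False] cE(2) by (rule ennreal_leI)
  qed simp
  show "PROP ?B"
  proof (cases "(\<integral>\<^sup>+ \<omega>. D \<omega> \<partial>M) = \<infinity>")
    case False
    assume *: "\<And>\<omega>. \<omega> \<in> space M \<Longrightarrow> \<exists>r>c \<omega> + E \<omega>. ennreal r \<le> D \<omega>"
    have "AE \<omega> in M. c \<omega> + E \<omega> < d \<omega>"
      using d(1)[OF False]
    proof (rule AE_mp, intro AE_I2 impI)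
      fix \<omega> assume "\<omega> \<in> space M" "D \<omega> = ennreal (d \<omega>)"
      with * show "c \<omega> + E \<omega> < d \<omega>" by (metis ennreal_le_iff[OF d0] less_le_trans)
    qed
    then have "(\<integral>\<omega>. c \<omega> + E \<omega> \<partial>M) < (\<integral>\<omega>. d \<omega> \<partial>M)"
      using cE d(2)[OF False] by (intro integral_less_AE_space) (auto simp: emeasure_space_1)
    moreover have "0 \<le> (\<integral>\<omega>. c \<omega> \<partial>M)" using c(2) by (intro integral_nonneg_AE AE_I2)
    ultimately show ?thesis unfolding cn d(3)[OF False] cE(2) by (simp add: ennreal_lessI)
  qed (use c(3) in simp)
qed

context
  fixes \<P> :: "((real^'n \<Rightarrow> real) \<times> (real^'n \<Rightarrow> real)) set"
  assumes \<P>: "dual_family \<P>"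
begin

lemma dual_familyD:
  assumes "(h, k) \<in> \<P>"
  shows "h \<in> borel_measurable borel" "quad_growth h" "k \<in> borel_measurable borel" "quad_growth k"
    "h x + k y \<le> (norm (x - y))\<^sup>2"
  using \<P> assms by (auto simp: dual_family_def)

lemma dual_value_le_wass_dist_sq:
  assumes "\<rho> \<in> W2 \<Omega>" "\<nu> \<in> W2 \<Omega>"
  shows "dual_value \<P> \<rho> \<nu> \<le> ennreal ((wass_dist \<Omega> \<rho> \<nu>)\<^sup>2)"
  unfolding dual_value_def
proof (rule SUP_least, clarify)
  fix h k assume "(h, k) \<in> \<P>"
  note d = dual_familyD[OF this]
  show "ennreal ((\<integral>x. h x \<partial>\<rho>) + (\<integral>y. k y \<partial>\<nu>)) \<le> ennreal ((wass_dist \<Omega> \<rho> \<nu>)\<^sup>2)"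
    by (rule dual_le_wass_dist_sq[OF assms d(1-5)])
qed

lemma dual_value_ge:
  assumes "\<rho> \<in> W2 \<Omega>" "\<nu> \<in> W2 \<Omega>" "continuous_on UNIV f" "quad_growth f"
    "continuous_on UNIV g" "quad_growth g" "\<And>x y. f x + g y \<le> (norm (x - y))\<^sup>2"
  shows "ennreal ((\<integral>x. f x \<partial>\<rho>) + (\<integral>y. g y \<partial>\<nu>)) \<le> dual_value \<P> \<rho> \<nu>"
  using \<P> assms unfolding dual_family_def by blast

text \<open>A countable supremum of measurable functions. Separate kernels and a parameter in
  \<open>F\<close> allow two uses: pairs of measures with \<open>F\<close> the identity, and
  independent outcomes for \<open>\<mu>\<close> and for the noise.\<close>

lemma measurable_dual_value:
  assumes T: "T \<in> borel_on \<Omega> \<rightarrow>\<^sub>M borel_on \<Omega>"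
    and F: "(\<lambda>(\<omega>, x). F \<omega> x) \<in> N \<Otimes>\<^sub>M borel_on \<Omega> \<rightarrow>\<^sub>M borel_on \<Omega>"
    and k: "\<kappa> \<in> N \<rightarrow>\<^sub>M subprob_algebra (borel_on \<Omega>)" "\<kappa>' \<in> N \<rightarrow>\<^sub>M subprob_algebra (borel_on \<Omega>)"
  shows "(\<lambda>\<omega>. dual_value \<P> (pushforward \<Omega> T (\<kappa> \<omega>)) (pushforward \<Omega> (F \<omega>) (\<kappa>' \<omega>))) \<in> borel_measurable N"
proof -
  have sets: "sets (\<kappa> \<omega>) = sets (borel_on \<Omega>)" "sets (\<kappa>' \<omega>) = sets (borel_on \<Omega>)" if "\<omega> \<in> space N" for \<omega>
    using sets_kernel[OF k(1) that] sets_kernel[OF k(2) that] by auto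
  have Fm: "F \<omega> \<in> borel_on \<Omega> \<rightarrow>\<^sub>M borel_on \<Omega>" if "\<omega> \<in> space N" for \<omega>
    using measurable_Pair2[OF F that] by simp
  have "(\<lambda>\<omega>. SUP (h, k)\<in>\<P>. ennreal ((\<integral>x. h (T x) \<partial>\<kappa> \<omega>) + (\<integral>x. k (F \<omega> x) \<partial>\<kappa>' \<omega>))) \<in> borel_measurable N"
  proof (rule borel_measurable_SUP)
    show "countable \<P>" using \<P> by (simp add: dual_family_def)
    fix hk assume "hk \<in> \<P>"
    then obtain h k' where hk: "hk = (h, k')" "(h, k') \<in> \<P>" by (cases hk) auto
    note d = dual_familyD[OF hk(2)]
    have 1: "(\<lambda>\<omega>. \<integral>x. h (T x) \<partial>\<kappa> \<omega>) \<in> borel_measurable N"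
      by (rule measurable_compose[OF k(1) integral_measurable_subprob_algebra])
        (rule borel_measurable_compose_on[OF T d(1)])
    have "(\<lambda>(\<omega>, x). k' (F \<omega> x)) \<in> borel_measurable (N \<Otimes>\<^sub>M borel_on \<Omega>)"
      using borel_measurable_compose_on[OF F d(3)] by (simp add: case_prod_beta)
    then have 2: "(\<lambda>\<omega>. \<integral>x. k' (F \<omega> x) \<partial>\<kappa>' \<omega>) \<in> borel_measurable N"
      using k(2) by (rule integral_measurable_subprob_algebra2)
    show "(\<lambda>\<omega>. case hk of (h, k) \<Rightarrow> ennreal ((\<integral>x. h (T x) \<partial>\<kappa> \<omega>) + (\<integral>x. k (F \<omega> x) \<partial>\<kappa>' \<omega>))) \<in> borel_measurable N"
      using 1 2 by (simp add: hk(1))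
  qed
  moreover have "(SUP (h, k)\<in>\<P>. ennreal ((\<integral>x. h (T x) \<partial>\<kappa> \<omega>) + (\<integral>x. k (F \<omega> x) \<partial>\<kappa>' \<omega>))) =
      dual_value \<P> (pushforward \<Omega> T (\<kappa> \<omega>)) (pushforward \<Omega> (F \<omega>) (\<kappa>' \<omega>))" if \<omega>: "\<omega> \<in> space N" for \<omega>
    unfolding dual_value_def
  proof (rule SUP_cong[OF refl], clarify)
    fix h k' assume "(h, k') \<in> \<P>"
    note d = dual_familyD[OF this]
    have "T \<in> \<kappa> \<omega> \<rightarrow>\<^sub>M borel_on \<Omega>" "F \<omega> \<in> \<kappa>' \<omega> \<rightarrow>\<^sub>M borel_on \<Omega>"
      using T Fm[OF \<omega>] by (simp_all add: measurable_on_cong[OF sets(1)[OF \<omega>]] measurable_on_cong[OF sets(2)[OF \<omega>]])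
    then show "ennreal ((\<integral>x. h (T x) \<partial>\<kappa> \<omega>) + (\<integral>x. k' (F \<omega> x) \<partial>\<kappa>' \<omega>)) =
      ennreal ((\<integral>x. h x \<partial>pushforward \<Omega> T (\<kappa> \<omega>)) + (\<integral>x. k' x \<partial>pushforward \<Omega> (F \<omega>) (\<kappa>' \<omega>)))"
      using d by (simp add: integral_pushforward)
  qed
  ultimately show ?thesis by (rule measurable_cong[THEN iffD1, rotated])
qed

text \<open>The strict gain comes from perturbing the dual pair of \<open>\<phi>\<close> by a small multiple of a separating
  function, the strong convexity of \<open>\<phi>\<close> absorbing the quadratic error.\<close>

lemma dual_value_lower_bounds:
  assumes m: "m \<in> W2 \<Omega>" and T0: "T0 \<in> reg_maps L \<Omega>" and T: "T \<in> reg_maps L \<Omega>" and F: "F \<in> reg_maps L \<Omega>"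
    and P: "convex_potential \<phi> G S \<alpha> L" "\<And>x. x \<in> \<Omega> \<Longrightarrow> F x = G x"
  defines "\<rho> \<equiv> pushforward \<Omega> T m" and "\<sigma> \<equiv> pushforward \<Omega> T0 m"
  defines "r \<equiv> (\<integral>z. (norm (F z - z))\<^sup>2 \<partial>\<sigma>) +
    ((\<integral>x. (norm x)\<^sup>2 - 2 * \<phi> x \<partial>\<rho>) - (\<integral>x. (norm x)\<^sup>2 - 2 * \<phi> x \<partial>\<sigma>))"
  shows "ennreal r \<le> dual_value \<P> \<rho> (pushforward \<Omega> F \<sigma>)"
    and "\<not> (AE x in m. T x = T0 x) \<Longrightarrow> \<exists>r'>r. ennreal r' \<le> dual_value \<P> \<rho> (pushforward \<Omega> F \<sigma>)"
proof -
  interpret convex_potential \<phi> G S \<alpha> L by (rule P)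
  have W: "\<rho> \<in> W2 \<Omega>" "\<sigma> \<in> W2 \<Omega>" "pushforward \<Omega> F \<sigma> \<in> W2 \<Omega>"
    using m T T0 F by (auto simp: \<rho>_def \<sigma>_def intro: pushforward_W2)
  obtain b w K where b: "continuous_on UNIV b" "quad_growth b"
    and w: "continuous_on UNIV w" "quad_growth (\<lambda>x. (norm (w x))\<^sup>2)"
    and bw: "\<And>x z. b x \<le> b z + w z \<bullet> (x - z) + K * (norm (x - z))\<^sup>2"
    and sep: "\<not> (AE x in m. T x = T0 x) \<Longrightarrow> (\<integral>x. b x \<partial>\<sigma>) < (\<integral>x. b x \<partial>\<rho>)"
    using separating_function[OF m T0 T] unfolding \<rho>_def \<sigma>_def by blast
  define \<delta> where "\<delta> = (\<integral>x. b x \<partial>\<rho>) - (\<integral>x. b x \<partial>\<sigma>)"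
  define W where "W = (\<integral>x. (norm (w x))\<^sup>2 \<partial>\<sigma>)"
  have *: "ennreal (r + (t * \<delta> - t\<^sup>2 / (2 * \<alpha>) * W)) \<le> dual_value \<P> \<rho> (pushforward \<Omega> F \<sigma>)"
    if t: "0 \<le> t" "t * K \<le> \<alpha> / 2" for t
  proof -
    obtain f g where fg: "continuous_on UNIV f" "quad_growth f" "continuous_on UNIV g" "quad_growth g"
      "\<And>x y. f x + g y \<le> (norm (x - y))\<^sup>2"
      and eq: "(\<integral>x. f x \<partial>\<rho>) + (\<integral>y. g y \<partial>pushforward \<Omega> F \<sigma>) =
      (\<integral>x. (norm x)\<^sup>2 - 2 * \<phi> x \<partial>\<rho>) - (\<integral>x. (norm x)\<^sup>2 - 2 * \<phi> x \<partial>\<sigma>) + (\<integral>z. (norm (F z - z))\<^sup>2 \<partial>\<sigma>)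
      + t * ((\<integral>x. b x \<partial>\<rho>) - (\<integral>x. b x \<partial>\<sigma>)) - t\<^sup>2 / (2 * \<alpha>) * (\<integral>x. (norm (w x))\<^sup>2 \<partial>\<sigma>)"
      using dual_pair[OF W(1,2) F P(2) b w bw t] by blast
    have "r + (t * \<delta> - t\<^sup>2 / (2 * \<alpha>) * W) = (\<integral>x. f x \<partial>\<rho>) + (\<integral>y. g y \<partial>pushforward \<Omega> F \<sigma>)"
      unfolding eq r_def \<delta>_def W_def by simp
    with dual_value_ge[OF W(1,3) fg] show ?thesis by simp
  qed
  \<comment> \<open>At \<open>t = 0\<close> the perturbation is absent.\<close>
  from *[of 0] \<alpha>_pos show "ennreal r \<le> dual_value \<P> \<rho> (pushforward \<Omega> F \<sigma>)" by simp
  assume "\<not> (AE x in m. T x = T0 x)"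
  then have "0 < \<delta>" using sep by (simp add: \<delta>_def)
  have "0 \<le> W" unfolding W_def by simp
  \<comment> \<open>The first entry ensures \<open>t * K \<le> \<alpha> / 2\<close>; the second
    ensures \<open>t * W \<le> \<alpha> * \<delta>\<close>, so the loss is at most half the gain
    \<open>t * \<delta>\<close>. The added ones keep the denominators positive.\<close>
  define t where "t = min (\<alpha> / (2 * (\<bar>K\<bar> + 1))) (\<alpha> * \<delta> / (W + 1))"
  have "0 < t" using \<alpha>_pos \<open>0 < \<delta>\<close> \<open>0 \<le> W\<close> by (auto simp: t_def)
  have "t * K \<le> t * (\<bar>K\<bar> + 1)" using \<open>0 < t\<close> by (intro mult_left_mono) auto
  also have "\<dots> \<le> \<alpha> / (2 * (\<bar>K\<bar> + 1)) * (\<bar>K\<bar> + 1)" by (intro mult_right_mono) (auto simp: t_def)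
  also have "\<dots> = \<alpha> / 2"
  proof -
    have "0 < \<bar>K\<bar> + 1" by linarith
    then show ?thesis by (simp add: field_simps)
  qed
  finally have tK: "t * K \<le> \<alpha> / 2" .
  have "t * W \<le> \<alpha> * \<delta> / (W + 1) * (W + 1)"
    using \<open>0 \<le> W\<close> \<open>0 < \<delta>\<close> \<alpha>_pos by (intro mult_mono) (auto simp: t_def)
  then have "t * W \<le> \<alpha> * \<delta>" using \<open>0 \<le> W\<close> by simp
  then have "t * (t * W) \<le> t * (\<alpha> * \<delta>)" using \<open>0 < t\<close> by simp
  moreover have "0 < t * (\<alpha> * \<delta>)" using \<open>0 < t\<close> \<open>0 < \<delta>\<close> \<alpha>_pos by simp
  ultimately have "t * (t * W) < 2 * (t * (\<alpha> * \<delta>))" by linarith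
  then have "0 < t * \<delta> - t\<^sup>2 / (2 * \<alpha>) * W"
    using \<alpha>_pos by (simp add: field_simps power2_eq_square)
  with *[OF less_imp_le[OF \<open>0 < t\<close>] tK]
  show "\<exists>r'>r. ennreal r' \<le> dual_value \<P> \<rho> (pushforward \<Omega> F \<sigma>)"
    by (intro exI[of _ "r + (t * \<delta> - t\<^sup>2 / (2 * \<alpha>) * W)"]) simp
qed

end

lemma displacement_cost:
  assumes \<sigma>: "\<sigma> \<in> W2 \<Omega>" and F: "F \<in> reg_maps L \<Omega>"
  shows "(\<integral>\<^sup>+ z. ennreal ((norm (F z - z))\<^sup>2) \<partial>\<sigma>) = ennreal (\<integral>z. (norm (F z - z))\<^sup>2 \<partial>\<sigma>)"
    and "ennreal ((wass_dist \<Omega> \<sigma> (pushforward \<Omega> F \<sigma>))\<^sup>2) \<le> ennreal (\<integral>z. (norm (F z - z))\<^sup>2 \<partial>\<sigma>)"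
proof -
  note Fm = reg_maps_measurable[OF F W2D(2)[OF \<sigma>]]
  have idm: "(\<lambda>x. x) \<in> \<sigma> \<rightarrow>\<^sub>M borel_on \<Omega>"
    by (rule measurable_ident_sets[OF W2D(2)[OF \<sigma>]])
  have [measurable]: "F \<in> borel_measurable \<sigma>" "(\<lambda>x. x) \<in> borel_measurable \<sigma>"
    by (rule borel_measurable_compose_on[OF Fm, of "\<lambda>x. x"], simp)
      (rule borel_measurable_on[OF W2D(2)[OF \<sigma>]], simp)
  have "integrable \<sigma> (\<lambda>z. (norm (F z - z))\<^sup>2)"
  proof (rule Bochner_Integration.integrable_bound)
    have "integrable \<sigma> (\<lambda>z. (norm (F z))\<^sup>2)"
      by (intro integrable_pushforward[OF Fm pushforward_W2[OF \<sigma> F]] quad_growth_norm_sq) measurable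
    then show "integrable \<sigma> (\<lambda>z. 2 * (norm (F z))\<^sup>2 + 2 * (norm z)\<^sup>2)"
      using W2_integrable_norm_sq[OF \<sigma>] by simp
    have "(norm (F z - z))\<^sup>2 \<le> 2 * (norm (F z))\<^sup>2 + 2 * (norm z)\<^sup>2" for z
    proof -
      have "(norm (F z - z))\<^sup>2 \<le> (norm (F z) + norm z)\<^sup>2" by (intro power_mono norm_triangle_ineq4) auto
      also have "\<dots> \<le> 2 * (norm (F z))\<^sup>2 + 2 * (norm z)\<^sup>2"
        using sum_squares_bound[of "norm (F z)" "norm z"] by (simp add: power2_sum)
      finally show ?thesis .
    qed
    then show "AE z in \<sigma>. norm ((norm (F z - z))\<^sup>2) \<le> norm (2 * (norm (F z))\<^sup>2 + 2 * (norm z)\<^sup>2)"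
      by (intro AE_I2) simp
  qed measurable
  then show eq: "(\<integral>\<^sup>+ z. ennreal ((norm (F z - z))\<^sup>2) \<partial>\<sigma>) = ennreal (\<integral>z. (norm (F z - z))\<^sup>2 \<partial>\<sigma>)"
    by (intro nn_integral_eq_integral) auto
  have "distr \<sigma> (borel_on \<Omega>) (\<lambda>x. x) = \<sigma>"
    using distr_id2[OF W2D(2)[OF \<sigma>, symmetric]] by simp
  with wass_dist_sq_distr_le[OF W2D(1)[OF \<sigma>] idm Fm]
  show "ennreal ((wass_dist \<Omega> \<sigma> (pushforward \<Omega> F \<sigma>))\<^sup>2) \<le> ennreal (\<integral>z. (norm (F z - z))\<^sup>2 \<partial>\<sigma>)"
    unfolding eq[symmetric] by (simp add: pushforward_def norm_minus_commute)
qed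

text \<open>Independence is transferred to the identity maps into two coarser copies of the sample
  space. The outcome itself stays the variable of integration, so nothing has to be factored through
  the values of \<open>X\<close> and \<open>Y\<close>.\<close>

lemma (in prob_space) indep_vimage_algebras_distr:
  assumes X: "X \<in> M \<rightarrow>\<^sub>M S" and Y: "Y \<in> M \<rightarrow>\<^sub>M T"
    and indep: "indep_set (sets (vimage_algebra (space M) X S)) (sets (vimage_algebra (space M) Y T))"
  defines "A \<equiv> vimage_algebra (space M) X S" and "B \<equiv> vimage_algebra (space M) Y T"
  shows "(\<lambda>x. x) \<in> M \<rightarrow>\<^sub>M A" "(\<lambda>x. x) \<in> M \<rightarrow>\<^sub>M B"
    "distr M (A \<Otimes>\<^sub>M B) (\<lambda>x. (x, x)) = distr M A (\<lambda>x. x) \<Otimes>\<^sub>M distr M B (\<lambda>x. x)"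
proof -
  show id: "(\<lambda>x. x) \<in> M \<rightarrow>\<^sub>M A" "(\<lambda>x. x) \<in> M \<rightarrow>\<^sub>M B"
    unfolding A_def B_def
    using measurable_vimage_algebra2[where g="\<lambda>x. x" and N=M and f=X, OF _ X]
      measurable_vimage_algebra2[where g="\<lambda>x. x" and N=M and f=Y, OF _ Y] by auto
  have sig: "sigma_sets (space M) {(\<lambda>x. x) -` U \<inter> space M |U. U \<in> sets C} = sets C"
    if C: "space C = space M" for C
  proof -
    have "(\<lambda>x. x) -` U \<inter> space M = U" if "U \<in> sets C" for U
      using sets.sets_into_space[OF that] C by auto
    then have "(\<lambda>U. (\<lambda>x. x) -` U \<inter> space M) ` sets C = sets C" by (simp cong: image_cong)
    moreover have "{(\<lambda>x. x) -` U \<inter> space M |U. U \<in> sets C} = (\<lambda>U. (\<lambda>x. x) -` U \<inter> space M) ` sets C"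
      by (rule Setcompr_eq_image)
    ultimately show ?thesis using sets.sigma_sets_eq[of C] C by simp
  qed
  have "indep_var A (\<lambda>x. x) B (\<lambda>x. x)"
    unfolding indep_var_eq using id indep sig[of A] sig[of B] by (simp add: A_def B_def)
  then show "distr M (A \<Otimes>\<^sub>M B) (\<lambda>x. (x, x)) = distr M A (\<lambda>x. x) \<Otimes>\<^sub>M distr M B (\<lambda>x. x)"
    by (simp add: indep_var_distribution_eq)
qed

theorem theorem3p4:
  fixes \<Omega> :: "(real^'n) set" and L :: real
    and R :: "'w measure"
    and \<mu> \<nu> :: "'w \<Rightarrow> (real^'n) measure"
    and T0 T :: "real^'n \<Rightarrow> real^'n"
    and T\<epsilon> :: "'w \<Rightarrow> real^'n \<Rightarrow> real^'n"
    and P :: "((real^'n) measure \<times> (real^'n) measure) measure"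
    and P_M :: "(real^'n) measure measure"
    and Q :: "(real^'n) measure"
  assumes L: "L > 0"
    and convex: "convex \<Omega>" and interior: "interior \<Omega> \<noteq> {}"
    and prob: "prob_space R"
    and rv_\<mu>: "\<mu> \<in> R \<rightarrow>\<^sub>M W2_borel \<Omega>" and rv_\<nu>: "\<nu> \<in> R \<rightarrow>\<^sub>M W2_borel \<Omega>"
    and model: "\<And>\<omega>. \<omega> \<in> space R \<Longrightarrow> \<nu> \<omega> = pushforward \<Omega> (T\<epsilon> \<omega>) (pushforward \<Omega> T0 (\<mu> \<omega>))"
    and P: "P = distr R (W2_borel \<Omega> \<Otimes>\<^sub>M W2_borel \<Omega>) (\<lambda>\<omega>. (\<mu> \<omega>, \<nu> \<omega>))"
    and P_M: "P_M = distr P (W2_borel \<Omega>) fst"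
    and Q: "Q = linear_average \<Omega> P_M"
    and ac: "\<And>m. m \<in> W2_support \<Omega> P_M \<Longrightarrow> abs_cont m"
    and T0: "T0 \<in> reg_maps L \<Omega>"
    and T\<epsilon>_maps: "\<And>\<omega>. \<omega> \<in> space R \<Longrightarrow> T\<epsilon> \<omega> \<in> reg_maps L \<Omega>"
    and T\<epsilon>_rv: "(\<lambda>\<omega>. restrict (T\<epsilon> \<omega>) \<Omega>) \<in> R \<rightarrow>\<^sub>M map_algebra \<Omega>"
    and T\<epsilon>_indep: "prob_space.indep_set R
          (sets (vimage_algebra (space R) \<mu> (W2_borel \<Omega>)))
          (sets (vimage_algebra (space R) (\<lambda>\<omega>. restrict (T\<epsilon> \<omega>) \<Omega>) (map_algebra \<Omega>)))"
    and T\<epsilon>_mean: "has_bochner_mean R \<Omega> T\<epsilon> (\<lambda>x. x)"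
    and finite: "M_functional \<Omega> P T0 < \<infinity>"
    and T: "T \<in> reg_maps L \<Omega>"
    and T_neq: "L2_norm_sq Q (\<lambda>x. T x - T0 x) > 0"
  shows "M_functional \<Omega> P T > M_functional \<Omega> P T0"
proof -

  \<comment> \<open>Decoupling the covariate from the noise\<close>
  interpret R: prob_space R by (rule prob)
  obtain \<P> :: "((real^'n \<Rightarrow> real) \<times> (real^'n \<Rightarrow> real)) set" where \<P>: "dual_family \<P>"
    using dual_family_exists by blast
  \<comment> \<open>Points of \<open>map_algebra \<Omega>\<close> are extensional functions, hence
    the restriction.\<close>
  define \<tau> where "\<tau> \<omega> = restrict (T\<epsilon> \<omega>) \<Omega>" for \<omega>
  define V1 where "V1 = vimage_algebra (space R) \<mu> (W2_borel \<Omega>)"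
  define V2 where "V2 = vimage_algebra (space R) \<tau> (map_algebra \<Omega>)"
  have \<tau>_rv: "\<tau> \<in> R \<rightarrow>\<^sub>M map_algebra \<Omega>" using T\<epsilon>_rv by (simp add: \<tau>_def[abs_def])
  note ind = R.indep_vimage_algebras_distr[OF rv_\<mu> \<tau>_rv T\<epsilon>_indep[folded \<tau>_def], folded V1_def V2_def]
  define N1 where "N1 = distr R V1 (\<lambda>x. x)"
  define N2 where "N2 = distr R V2 (\<lambda>x. x)"
  have N2: "prob_space N2" unfolding N2_def by (rule R.prob_space_distr[OF ind(2)])
  interpret N1: prob_space N1 unfolding N1_def by (rule R.prob_space_distr[OF ind(1)])
  interpret N2: prob_space N2 by (rule N2)
  have sp: "space N1 = space R" "space N2 = space R" by (simp_all add: N1_def N2_def V1_def V2_def)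
  have joint: "(\<lambda>\<omega>. (\<omega>, \<omega>)) \<in> R \<rightarrow>\<^sub>M N1 \<Otimes>\<^sub>M N2"
    using ind(1,2) by (intro measurable_Pair) (simp_all add: N1_def N2_def)
  \<comment> \<open>From here on \<open>\<omega>\<close> governs \<open>\<mu>\<close> and
    \<open>\<omega>'\<close> governs the noise; the inner integral is the mean conditional on
    \<open>\<mu>\<close>.\<close>
  have diag: "(\<integral>\<^sup>+ \<omega>. g \<omega> \<omega> \<partial>R) = (\<integral>\<^sup>+ \<omega>. (\<integral>\<^sup>+ \<omega>'. g \<omega> \<omega>' \<partial>N2) \<partial>N1)"
    if g: "(\<lambda>(\<omega>, \<omega>'). g \<omega> \<omega>') \<in> borel_measurable (N1 \<Otimes>\<^sub>M N2)" for g :: "'w \<Rightarrow> 'w \<Rightarrow> ennreal"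
  proof -
    have s: "sets (N1 \<Otimes>\<^sub>M N2) = sets (V1 \<Otimes>\<^sub>M V2)"
      by (intro sets_pair_measure_cong) (simp_all add: N1_def N2_def)
    have "distr R (N1 \<Otimes>\<^sub>M N2) (\<lambda>\<omega>. (\<omega>, \<omega>)) = N1 \<Otimes>\<^sub>M N2"
      using ind(3) distr_cong[OF refl s, of R] by (simp add: N1_def N2_def)
    then have "(\<integral>\<^sup>+ \<omega>. g \<omega> \<omega> \<partial>R) = (\<integral>\<^sup>+ z. (case z of (\<omega>, \<omega>') \<Rightarrow> g \<omega> \<omega>') \<partial>(N1 \<Otimes>\<^sub>M N2))"
      using nn_integral_distr[OF joint, of "\<lambda>(\<omega>, \<omega>'). g \<omega> \<omega>'"] g by simp
    also have "\<dots> = (\<integral>\<^sup>+ \<omega>. (\<integral>\<^sup>+ \<omega>'. g \<omega> \<omega>' \<partial>N2) \<partial>N1)"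
      using N2.nn_integral_fst[OF g] by simp
    finally show ?thesis .
  qed

  \<comment> \<open>Measurability and mean on the two copies\<close>
  have \<mu>_W2: "\<mu> \<omega> \<in> W2 \<Omega>" if "\<omega> \<in> space R" for \<omega> using measurable_space[OF rv_\<mu> that] by simp
  have \<mu>_N1: "\<mu> \<in> N1 \<rightarrow>\<^sub>M W2_borel \<Omega>"
    unfolding N1_def V1_def using measurable_vimage_algebra1[of \<mu> "space R" "W2_borel \<Omega>"] \<mu>_W2 by auto
  note sub = measurable_W2_borel_subprob_algebra
  have \<mu>_kernel: "\<mu> \<in> N1 \<rightarrow>\<^sub>M subprob_algebra (borel_on \<Omega>)"
    using measurable_compose[OF \<mu>_N1 sub] by simp
  have T\<epsilon>_at: "(\<lambda>\<omega>. T\<epsilon> \<omega> x) \<in> borel_measurable V2" if "x \<in> \<Omega>" for x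
  proof -
    have "\<tau> \<in> V2 \<rightarrow>\<^sub>M map_algebra \<Omega>"
      unfolding V2_def using measurable_space[OF \<tau>_rv] by (intro measurable_vimage_algebra1) auto
    from measurable_compose[OF this measurable_component_singleton[OF that]]
    show ?thesis using that by (simp add: \<tau>_def)
  qed
  have T\<epsilon>_N2: "(\<lambda>\<omega>. T\<epsilon> \<omega> x) \<in> borel_measurable N2" if "x \<in> \<Omega>" for x
    using T\<epsilon>_at[OF that] by (simp add: N2_def)
  have N2_maps: "T\<epsilon> \<omega> \<in> reg_maps L \<Omega>" if "\<omega> \<in> space N2" for \<omega>
    using T\<epsilon>_maps that sp by simp
  have mean: "has_bochner_mean N2 \<Omega> T\<epsilon> (\<lambda>x. x)"
    unfolding has_bochner_mean_def
  proof
    fix x assume x: "x \<in> \<Omega>"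
    then have "has_bochner_integral R (\<lambda>\<omega>. T\<epsilon> \<omega> x) x" using T\<epsilon>_mean by (auto simp: has_bochner_mean_def)
    then show "has_bochner_integral N2 (\<lambda>\<omega>. T\<epsilon> \<omega> x) x"
      using T\<epsilon>_at[OF x] ind(2)
      by (simp add: N2_def has_bochner_integral_iff integrable_distr_eq integral_distr)
  qed
  have T\<epsilon>_joint: "(\<lambda>(\<omega>, x). T\<epsilon> \<omega> x) \<in> N2 \<Otimes>\<^sub>M borel_on \<Omega> \<rightarrow>\<^sub>M borel_on \<Omega>"
  proof (rule measurable_restrict_space2)
    show "(\<lambda>(\<omega>, x). T\<epsilon> \<omega> x) \<in> borel_measurable (N2 \<Otimes>\<^sub>M borel_on \<Omega>)"
      using N2_maps by (intro borel_measurable_caratheodory T\<epsilon>_N2 reg_maps_continuous)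
    show "(\<lambda>(\<omega>, x). T\<epsilon> \<omega> x) \<in> space (N2 \<Otimes>\<^sub>M borel_on \<Omega>) \<rightarrow> \<Omega>"
      using N2_maps by (fastforce simp: space_pair_measure space_restrict_space reg_maps_def)
  qed
  have T_m: "T \<in> borel_on \<Omega> \<rightarrow>\<^sub>M borel_on \<Omega>" "T0 \<in> borel_on \<Omega> \<rightarrow>\<^sub>M borel_on \<Omega>"
    by (rule reg_maps_measurable[OF T refl], rule reg_maps_measurable[OF T0 refl])

  \<comment> \<open>Dual value and displacement cost in independent variables\<close>
  define \<sigma> where "\<sigma> \<omega> = pushforward \<Omega> T0 (\<mu> \<omega>)" for \<omega>
  define D where "D \<omega> \<omega>' = dual_value \<P> (pushforward \<Omega> T (\<mu> \<omega>)) (pushforward \<Omega> (T\<epsilon> \<omega>') (\<sigma> \<omega>))" for \<omega> \<omega>'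
  define c where "c \<omega> \<omega>' = (\<integral>z. (norm (T\<epsilon> \<omega>' z - z))\<^sup>2 \<partial>\<sigma> \<omega>)" for \<omega> \<omega>'
  have \<sigma>_W2: "\<sigma> \<omega> \<in> W2 \<Omega>" if "\<omega> \<in> space R" for \<omega>
    unfolding \<sigma>_def using \<mu>_W2[OF that] T0 by (rule pushforward_W2)
  have \<sigma>_kernel: "\<sigma> \<in> N1 \<rightarrow>\<^sub>M subprob_algebra (borel_on \<Omega>)"
    unfolding \<sigma>_def[abs_def] pushforward_def
    using measurable_compose[OF \<mu>_kernel measurable_distr[OF T_m(2)]] by simp
  have T\<epsilon>_joint': "(\<lambda>(w, x). T\<epsilon> (snd w) x) \<in> (N1 \<Otimes>\<^sub>M N2) \<Otimes>\<^sub>M borel_on \<Omega> \<rightarrow>\<^sub>M borel_on \<Omega>"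
  proof -
    have "(\<lambda>y. (snd (fst y), snd y)) \<in> (N1 \<Otimes>\<^sub>M N2) \<Otimes>\<^sub>M borel_on \<Omega> \<rightarrow>\<^sub>M N2 \<Otimes>\<^sub>M borel_on \<Omega>" by measurable
    from measurable_compose[OF this T\<epsilon>_joint] show ?thesis by (simp add: case_prod_beta)
  qed
  have D_meas: "(\<lambda>(\<omega>, \<omega>'). D \<omega> \<omega>') \<in> borel_measurable (N1 \<Otimes>\<^sub>M N2)"
    using measurable_dual_value[OF \<P> T_m(1) T\<epsilon>_joint' measurable_compose[OF measurable_fst \<mu>_kernel]
        measurable_compose[OF measurable_fst \<sigma>_kernel]]
    by (simp add: D_def case_prod_beta)
  have c_meas: "(\<lambda>(\<omega>, \<omega>'). c \<omega> \<omega>') \<in> borel_measurable (N1 \<Otimes>\<^sub>M N2)"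
  proof -
    have i: "(\<lambda>x. x) \<in> borel_measurable (borel_on \<Omega>)" by (simp add: measurable_restrict_space1)
    have [measurable]: "(\<lambda>y. snd y) \<in> borel_measurable ((N1 \<Otimes>\<^sub>M N2) \<Otimes>\<^sub>M borel_on \<Omega>)"
      by (rule measurable_compose[OF measurable_snd i])
    have [measurable]: "(\<lambda>y. T\<epsilon> (snd (fst y)) (snd y)) \<in> borel_measurable ((N1 \<Otimes>\<^sub>M N2) \<Otimes>\<^sub>M borel_on \<Omega>)"
      using measurable_compose[OF T\<epsilon>_joint' i] by (simp add: case_prod_beta)
    have "(\<lambda>(w, x). (norm (T\<epsilon> (snd w) x - x))\<^sup>2) \<in> borel_measurable ((N1 \<Otimes>\<^sub>M N2) \<Otimes>\<^sub>M borel_on \<Omega>)"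
      unfolding case_prod_beta by measurable
    from integral_measurable_subprob_algebra2[OF this measurable_compose[OF measurable_fst \<sigma>_kernel]]
    show ?thesis by (simp add: c_def case_prod_beta)
  qed
  have c_meas': "(\<lambda>(\<omega>, \<omega>'). ennreal (c \<omega> \<omega>')) \<in> borel_measurable (N1 \<Otimes>\<^sub>M N2)"
    using c_meas by (simp add: case_prod_beta)

  \<comment> \<open>A measurable minorant of the squared distance under \<open>P\<close>\<close>
  have pair: "(\<lambda>\<omega>. (\<mu> \<omega>, \<nu> \<omega>)) \<in> R \<rightarrow>\<^sub>M W2_borel \<Omega> \<Otimes>\<^sub>M W2_borel \<Omega>"
    using rv_\<mu> rv_\<nu> by (rule measurable_Pair)
  have DV: "(\<lambda>(m, n). dual_value \<P> (pushforward \<Omega> S m) n) \<in> borel_measurable (W2_borel \<Omega> \<Otimes>\<^sub>M W2_borel \<Omega>)"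
    if S: "S \<in> borel_on \<Omega> \<rightarrow>\<^sub>M borel_on \<Omega>" for S
  proof -
    have "(\<lambda>(w, x). x) \<in> (W2_borel \<Omega> \<Otimes>\<^sub>M W2_borel \<Omega>) \<Otimes>\<^sub>M borel_on \<Omega> \<rightarrow>\<^sub>M borel_on \<Omega>"
      by (simp add: case_prod_beta)
    note * = measurable_dual_value[OF \<P> S this measurable_compose[OF measurable_fst sub] measurable_compose[OF measurable_snd sub]]
    have "pushforward \<Omega> (\<lambda>x. x) n = n" if "n \<in> W2 \<Omega>" for n
      unfolding pushforward_def using distr_id2[OF W2D(2)[OF that, symmetric]] by simp
    then show ?thesis
      by (intro measurable_cong[THEN iffD1, OF _ *]) (auto simp: space_pair_measure)
  qed
  have lower: "(\<integral>\<^sup>+ \<omega>. dual_value \<P> (pushforward \<Omega> S (\<mu> \<omega>)) (\<nu> \<omega>) \<partial>R) \<le>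
      (\<integral>\<^sup>+ (m, n). ennreal ((wass_dist \<Omega> (pushforward \<Omega> S m) n)\<^sup>2) \<partial>P)"
    if S: "S \<in> reg_maps L \<Omega>" for S
  proof -
    have "(\<integral>\<^sup>+ \<omega>. dual_value \<P> (pushforward \<Omega> S (\<mu> \<omega>)) (\<nu> \<omega>) \<partial>R) =
        (\<integral>\<^sup>+ (m, n). dual_value \<P> (pushforward \<Omega> S m) n \<partial>P)"
      unfolding P using DV[OF reg_maps_measurable[OF S refl]] by (subst nn_integral_distr[OF pair]) simp_all
    also have "\<dots> \<le> (\<integral>\<^sup>+ (m, n). ennreal ((wass_dist \<Omega> (pushforward \<Omega> S m) n)\<^sup>2) \<partial>P)"
      using S by (intro nn_integral_mono)
        (auto simp: P space_pair_measure intro!: dual_value_le_wass_dist_sq[OF \<P>] pushforward_W2)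
    finally show ?thesis .
  qed

  \<comment> \<open>Comparison conditional on the covariate\<close>
  have gap: "\<exists>E. integrable N2 E \<and> (\<integral>\<omega>'. E \<omega>' \<partial>N2) = 0 \<and>
      (\<forall>\<omega>'\<in>space N2. ennreal (c \<omega> \<omega>' + E \<omega>') \<le> D \<omega> \<omega>' \<and>
        (\<not> (AE x in \<mu> \<omega>. T x = T0 x) \<longrightarrow> (\<exists>r>c \<omega> \<omega>' + E \<omega>'. ennreal r \<le> D \<omega> \<omega>')))"
    if \<omega>: "\<omega> \<in> space R" for \<omega>
  proof -
    obtain E where E: "integrable N2 E" "(\<integral>\<omega>'. E \<omega>' \<partial>N2) = 0" and
      E_eq: "\<And>\<omega>' \<phi> G S \<alpha>. \<omega>' \<in> space N2 \<Longrightarrow> convex_potential \<phi> G S \<alpha> L \<Longrightarrow> (\<And>x. x \<in> \<Omega> \<Longrightarrow> T\<epsilon> \<omega>' x = G x) \<Longrightarrow>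
      E \<omega>' = (\<integral>x. (norm x)\<^sup>2 - 2 * \<phi> x \<partial>pushforward \<Omega> T (\<mu> \<omega>)) - (\<integral>x. (norm x)\<^sup>2 - 2 * \<phi> x \<partial>pushforward \<Omega> T0 (\<mu> \<omega>))"
      by (rule expected_potential_gap_zero[OF N2 N2_maps T\<epsilon>_N2 mean convex \<mu>_W2[OF \<omega>] T T0]) blast+
    have "ennreal (c \<omega> \<omega>' + E \<omega>') \<le> D \<omega> \<omega>' \<and>
        (\<not> (AE x in \<mu> \<omega>. T x = T0 x) \<longrightarrow> (\<exists>r>c \<omega> \<omega>' + E \<omega>'. ennreal r \<le> D \<omega> \<omega>'))"
      if \<omega>': "\<omega>' \<in> space N2" for \<omega>'
    proof -
      from reg_mapsE[OF N2_maps[OF \<omega>']] obtain \<phi> G S \<alpha>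
        where pot: "convex_potential \<phi> G S \<alpha> L" and G: "\<And>x. x \<in> \<Omega> \<Longrightarrow> T\<epsilon> \<omega>' x = G x" by blast
      show ?thesis
        using dual_value_lower_bounds[OF \<P> \<mu>_W2[OF \<omega>] T0 T N2_maps[OF \<omega>'] pot G] E_eq[OF \<omega>' pot G]
        by (simp add: c_def D_def \<sigma>_def)
    qed
    with E show ?thesis by blast
  qed
  have c_nonneg: "0 \<le> c \<omega> \<omega>'" for \<omega> \<omega>' by (simp add: c_def)
  define A where "A \<omega> = (\<integral>\<^sup>+ \<omega>'. D \<omega> \<omega>' \<partial>N2)" for \<omega>
  define C where "C \<omega> = (\<integral>\<^sup>+ \<omega>'. ennreal (c \<omega> \<omega>') \<partial>N2)" for \<omega>
  have AC: "C \<omega> \<le> A \<omega>" "\<not> (AE x in \<mu> \<omega>. T x = T0 x) \<Longrightarrow> C \<omega> < A \<omega>"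
    if \<omega>: "\<omega> \<in> space N1" and fin: "C \<omega> < \<infinity>" for \<omega>
  proof -
    obtain E where E: "integrable N2 E" "(\<integral>\<omega>'. E \<omega>' \<partial>N2) = 0"
      and le: "\<And>\<omega>'. \<omega>' \<in> space N2 \<Longrightarrow> ennreal (c \<omega> \<omega>' + E \<omega>') \<le> D \<omega> \<omega>'"
      and less: "\<And>\<omega>'. \<omega>' \<in> space N2 \<Longrightarrow> \<not> (AE x in \<mu> \<omega>. T x = T0 x) \<Longrightarrow>
        \<exists>r>c \<omega> \<omega>' + E \<omega>'. ennreal r \<le> D \<omega> \<omega>'"
      using gap[of \<omega>] \<omega> sp by auto
    have m: "D \<omega> \<in> borel_measurable N2" "c \<omega> \<in> borel_measurable N2"
      using measurable_Pair2[OF D_meas \<omega>] measurable_Pair2[OF c_meas \<omega>] by simp_all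
    note less_mean = N2.nn_integral_less_of_mean_zero[OF m c_nonneg fin[unfolded C_def] E]
    show "C \<omega> \<le> A \<omega>" unfolding A_def C_def by (rule less_mean(1)[OF le])
    show "C \<omega> < A \<omega>" if "\<not> (AE x in \<mu> \<omega>. T x = T0 x)"
      unfolding A_def C_def by (rule less_mean(2)[OF less[OF _ that]])
  qed
  have A_meas: "A \<in> borel_measurable N1" and C_meas: "C \<in> borel_measurable N1"
    using N2.borel_measurable_nn_integral[OF D_meas] N2.borel_measurable_nn_integral[OF c_meas']
    by (simp_all add: A_def[abs_def] C_def[abs_def])

  \<comment> \<open>Bounds for the two mean costs\<close>
  have A_int: "(\<integral>\<^sup>+ \<omega>. A \<omega> \<partial>N1) \<le> (\<integral>\<^sup>+ (m, n). ennreal ((wass_dist \<Omega> (pushforward \<Omega> T m) n)\<^sup>2) \<partial>P)"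
  proof -
    have "(\<integral>\<^sup>+ \<omega>. A \<omega> \<partial>N1) = (\<integral>\<^sup>+ \<omega>. D \<omega> \<omega> \<partial>R)" unfolding A_def using diag[OF D_meas] by simp
    also have "\<dots> = (\<integral>\<^sup>+ \<omega>. dual_value \<P> (pushforward \<Omega> T (\<mu> \<omega>)) (\<nu> \<omega>) \<partial>R)"
      by (intro nn_integral_cong) (simp add: D_def \<sigma>_def model)
    finally show ?thesis using lower[OF T] by simp
  qed
  have C_diag: "(\<integral>\<^sup>+ \<omega>. C \<omega> \<partial>N1) = (\<integral>\<^sup>+ \<omega>. ennreal (c \<omega> \<omega>) \<partial>R)"
    unfolding C_def using diag[OF c_meas'] by simp
  have C_int: "(\<integral>\<^sup>+ (m, n). ennreal ((wass_dist \<Omega> (pushforward \<Omega> T0 m) n)\<^sup>2) \<partial>P) \<le> (\<integral>\<^sup>+ \<omega>. C \<omega> \<partial>N1)"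
  proof -
    have "(\<integral>\<^sup>+ (m, n). ennreal ((wass_dist \<Omega> (pushforward \<Omega> T0 m) n)\<^sup>2) \<partial>P) \<le>
        (\<integral>\<^sup>+ \<omega>. ennreal ((wass_dist \<Omega> (\<sigma> \<omega>) (\<nu> \<omega>))\<^sup>2) \<partial>R)"
      unfolding P \<sigma>_def by (rule order_trans[OF nn_integral_distr_le[OF pair]]) simp
    also have "\<dots> \<le> (\<integral>\<^sup>+ \<omega>. ennreal (c \<omega> \<omega>) \<partial>R)"
      using displacement_cost(2)[OF \<sigma>_W2 T\<epsilon>_maps] by (intro nn_integral_mono) (simp add: model \<sigma>_def c_def)
    finally show ?thesis unfolding C_diag .
  qed
  \<comment> \<open>With \<open>T0\<close> in place of \<open>T\<close> the potential terms of the
    dual bound cancel for each outcome, so the dual value is at least the displacement cost.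
    Finiteness of the functional at \<open>T0\<close> thus passes to the mean of
    \<open>C\<close>.\<close>
  have C_fin: "(\<integral>\<^sup>+ \<omega>. C \<omega> \<partial>N1) \<noteq> \<infinity>"
  proof -
    have "ennreal (c \<omega> \<omega>) \<le> dual_value \<P> (pushforward \<Omega> T0 (\<mu> \<omega>)) (\<nu> \<omega>)" if \<omega>: "\<omega> \<in> space R" for \<omega>
    proof -
      from reg_mapsE[OF T\<epsilon>_maps[OF \<omega>]] obtain \<phi> G S \<alpha>
        where pot: "convex_potential \<phi> G S \<alpha> L" and G: "\<And>x. x \<in> \<Omega> \<Longrightarrow> T\<epsilon> \<omega> x = G x" by blast
      show ?thesis
        using dual_value_lower_bounds(1)[OF \<P> \<mu>_W2[OF \<omega>] T0 T0 T\<epsilon>_maps[OF \<omega>] pot G]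
        by (simp add: c_def \<sigma>_def model[OF \<omega>])
    qed
    then have "(\<integral>\<^sup>+ \<omega>. C \<omega> \<partial>N1) \<le> (\<integral>\<^sup>+ \<omega>. dual_value \<P> (pushforward \<Omega> T0 (\<mu> \<omega>)) (\<nu> \<omega>) \<partial>R)"
      unfolding C_diag by (rule nn_integral_mono)
    also note lower[OF T0]
    also have "(\<integral>\<^sup>+ (m, n). ennreal ((wass_dist \<Omega> (pushforward \<Omega> T0 m) n)\<^sup>2) \<partial>P) < \<infinity>"
      using finite by (auto simp: M_functional_def ennreal_mult_less_top ennreal_divide_eq_0_iff)
    finally show ?thesis by simp
  qed

  \<comment> \<open>Strict inequality\<close>
  have "(\<integral>\<^sup>+ \<omega>. C \<omega> \<partial>N1) < (\<integral>\<^sup>+ \<omega>. A \<omega> \<partial>N1)"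
  proof (rule nn_integral_less[OF C_meas A_meas C_fin])
    have C_AE: "AE \<omega> in N1. C \<omega> \<noteq> \<infinity>" using nn_integral_PInf_AE[OF C_meas] C_fin by simp
    then show "AE \<omega> in N1. C \<omega> \<le> A \<omega>"
      by (rule AE_mp) (auto intro!: AE_I2 AC(1) simp: less_top)
    \<comment> \<open>Otherwise conditional strictness forces \<open>T = T0\<close> almost
      everywhere under \<open>\<mu> \<omega>\<close>, for almost every \<open>\<omega>\<close>;
      integrating over the law of \<open>\<mu>\<close> makes the distance of \<open>T\<close> and
      \<open>T0\<close> under \<open>Q\<close> vanish.\<close>
    show "\<not> (AE \<omega> in N1. A \<omega> \<le> C \<omega>)"
    proof
      assume "AE \<omega> in N1. A \<omega> \<le> C \<omega>"
      with C_AE AE_space have eq: "AE \<omega> in N1. AE x in \<mu> \<omega>. T x = T0 x"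
        by eventually_elim (metis AC(2) infinity_ennreal_def leD less_top)
      have P_M_eq: "P_M = distr N1 (W2_borel \<Omega>) \<mu>"
      proof -
        have "P_M = distr R (W2_borel \<Omega>) \<mu>"
          unfolding P_M P by (subst distr_distr[OF measurable_fst pair]) (simp add: o_def)
        also have "\<dots> = distr N1 (W2_borel \<Omega>) \<mu>"
          using \<mu>_N1 distr_distr[OF _ ind(1), of \<mu> "W2_borel \<Omega>"] by (simp add: N1_def o_def)
        finally show ?thesis .
      qed
      have PM_space: "sets P_M = sets (W2_borel \<Omega>)" "space P_M \<noteq> {}"
        using \<mu>_W2 R.not_empty by (auto simp: P_M_eq)
      let ?f = "\<lambda>x. ennreal ((norm (T x - T0 x))\<^sup>2)"
      have f: "?f \<in> borel_measurable (borel_on \<Omega>)"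
      proof -
        have "(\<lambda>x. x) \<in> borel_measurable (borel_on \<Omega>)" by (simp add: measurable_restrict_space1)
        from measurable_compose[OF T_m(1) this] measurable_compose[OF T_m(2) this]
        show ?thesis by measurable
      qed
      have "L2_norm_sq Q (\<lambda>x. T x - T0 x) = (\<integral>\<^sup>+ m. (\<integral>\<^sup>+ x. ?f x \<partial>m) \<partial>P_M)"
        unfolding L2_norm_sq_def Q linear_average_eq_bind[OF PM_space]
        using sub PM_space(1) by (intro nn_integral_bind[OF f]) (simp cong: measurable_cong_sets)
      also have "\<dots> = (\<integral>\<^sup>+ \<omega>. (\<integral>\<^sup>+ x. ?f x \<partial>\<mu> \<omega>) \<partial>N1)"
        unfolding P_M_eq
        using measurable_compose[OF sub nn_integral_measurable_subprob_algebra[OF f]]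
        by (subst nn_integral_distr[OF \<mu>_N1]) simp_all
      also have "\<dots> = (\<integral>\<^sup>+ \<omega>. 0 \<partial>N1)"
      proof (rule nn_integral_cong_AE)
        show "AE \<omega> in N1. (\<integral>\<^sup>+ x. ?f x \<partial>\<mu> \<omega>) = 0"
          using eq
        proof eventually_elim
          fix \<omega> assume "AE x in \<mu> \<omega>. T x = T0 x"
          then have "(\<integral>\<^sup>+ x. ?f x \<partial>\<mu> \<omega>) = (\<integral>\<^sup>+ x. 0 \<partial>\<mu> \<omega>)"
            by (intro nn_integral_cong_AE) (auto elim: eventually_mono)
          then show "(\<integral>\<^sup>+ x. ?f x \<partial>\<mu> \<omega>) = 0" by simp
        qed
      qed
      finally show False using T_neq by simp
    qed
  qed
  then have "(\<integral>\<^sup>+ (m, n). ennreal ((wass_dist \<Omega> (pushforward \<Omega> T0 m) n)\<^sup>2) \<partial>P) <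
      (\<integral>\<^sup>+ (m, n). ennreal ((wass_dist \<Omega> (pushforward \<Omega> T m) n)\<^sup>2) \<partial>P)"
    using A_int C_int by (meson le_less_trans less_le_trans)
  then show ?thesis
    unfolding M_functional_def
    by (intro ennreal_mult_strict_left_mono)
      (auto simp: ennreal_zero_less_divide ennreal_divide_eq_top_iff less_top[symmetric])
qed

end
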